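(* Let $R\subset S$ be an integral FCP extension of commutative rings. If ${}_S^uR\subseteq S$ is catenarian, where ${}_S^uR$ is the u-closure of $R$ in $S$, then the co-subintegral closure of $R\subset S$ exists. In particular, these conditions hold if $R\subset S$ is catenarian.
   Context: All rings are commutative and unital; $\subset$ denotes proper inclusion. $[R,S]$ is the set of all $R$-subalgebras of $S$, ordered by inclusion; $R\subseteq S$ has FCP if each chain in $[R,S]$ is finite. An FCP extension $T\subseteq S$ is catenarian if all maximal chains of $[T,S]$ have the same length. $R\subseteq S$ is u-closed (anodal) if $b\in S$ lies in $R$ whenever $b^2-b\in R$ and $b^3-b^2\in R$; the u-closure ${}_S^uR$ is the smallest $B\in[R,S]$ such that $B\subseteq S$ is u-closed. An integral extension $U\subseteq S$ is subintegral if $\mathrm{Spec}(S)\to\mathrm{Spec}(U)$ is injective and all the residual field extensions $\kappa_U(Q\cap U)\to\kappa_S(Q)$ ($Q\in\mathrm{Spec}(S)$) are isomorphisms. The co-subintegral closure of $R\subseteq S$, if it exists, is the least $V\in[R,S]$ such that $V\subseteq S$ is subintegral. *)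

theory Defs
  imports "HOL-Algebra.Algebra"
begin

text \<open>An extension of rings is given by the big ring \<open>S\<close> and a subset \<open>R\<close> of its carrier;
  the small ring itself is \<open>S\<lparr>carrier := R\<rparr>\<close>.\<close>

definition ring_extension :: "'a set \<Rightarrow> ('a, 'b) ring_scheme \<Rightarrow> bool" where
  "ring_extension R S \<longleftrightarrow> cring S \<and> subring R S"

definition intermediate_rings :: "'a set \<Rightarrow> ('a, 'b) ring_scheme \<Rightarrow> 'a set set" where
  "intermediate_rings R S = {T. subring T S \<and> R \<subseteq> T}"

definition FCP :: "'a set \<Rightarrow> ('a, 'b) ring_scheme \<Rightarrow> bool" where
  "FCP R S \<longleftrightarrow> ring_extension R S \<and>
     (\<forall>C. subset.chain (intermediate_rings R S) C \<longrightarrow> finite C)"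

definition chain_length :: "'a set set \<Rightarrow> nat" where
  "chain_length C = card C - 1"

definition catenarian :: "'a set \<Rightarrow> ('a, 'b) ring_scheme \<Rightarrow> bool" where
  "catenarian R S \<longleftrightarrow> FCP R S \<and>
     (\<forall>C D. subset.maxchain (intermediate_rings R S) C \<and> subset.maxchain (intermediate_rings R S) D
        \<longrightarrow> chain_length C = chain_length D)"

text \<open>Polynomials are coefficient lists with the leading coefficient first.\<close>

definition integral_over :: "'a set \<Rightarrow> ('a, 'b) ring_scheme \<Rightarrow> 'a \<Rightarrow> bool" where
  "integral_over R S x \<longleftrightarrow>
     (\<exists>p. p \<noteq> [] \<and> set p \<subseteq> R \<and> lead_coeff p = \<one>\<^bsub>S\<^esub> \<and> ring.eval S p x = \<zero>\<^bsub>S\<^esub>)"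

definition integral_extension :: "'a set \<Rightarrow> ('a, 'b) ring_scheme \<Rightarrow> bool" where
  "integral_extension R S \<longleftrightarrow> ring_extension R S \<and> (\<forall>x \<in> carrier S. integral_over R S x)"

definition u_closed :: "'a set \<Rightarrow> ('a, 'b) ring_scheme \<Rightarrow> bool" where
  "u_closed R S \<longleftrightarrow> ring_extension R S \<and>
     (\<forall>b \<in> carrier S.
        b [^]\<^bsub>S\<^esub> (2::nat) \<ominus>\<^bsub>S\<^esub> b \<in> R \<and>
        b [^]\<^bsub>S\<^esub> (3::nat) \<ominus>\<^bsub>S\<^esub> b [^]\<^bsub>S\<^esub> (2::nat) \<in> R \<longrightarrow> b \<in> R)"

definition u_closure :: "'a set \<Rightarrow> ('a, 'b) ring_scheme \<Rightarrow> 'a set" where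
  "u_closure R S = (LEAST B. B \<in> intermediate_rings R S \<and> u_closed B S)"

text \<open>The least element exists, so \<^const>\<open>u_closure\<close> is meaningful.\<close>

lemma u_closure_eq_Inter:
  assumes ext: "ring_extension R S"
  shows "u_closure R S = \<Inter>{B \<in> intermediate_rings R S. u_closed B S}"
    and "u_closure R S \<in> intermediate_rings R S"
    and "u_closed (u_closure R S) S"
proof -
  let ?F = "{B \<in> intermediate_rings R S. u_closed B S}"
  interpret cring S using ext by (simp add: ring_extension_def)
  have "carrier S \<in> ?F"
    using ext carrier_is_subring subringE(1)[of R S]
    by (simp add: intermediate_rings_def u_closed_def ring_extension_def)
  moreover have "subring B S" if "B \<in> ?F" for B
    using that by (simp add: intermediate_rings_def)
  ultimately have sub: "subring (\<Inter>?F) S"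
    by (intro subring_Inter) blast+
  moreover have "R \<subseteq> \<Inter>?F"
    unfolding intermediate_rings_def by blast
  ultimately have I: "\<Inter>?F \<in> intermediate_rings R S"
    unfolding intermediate_rings_def by blast
  have U: "u_closed (\<Inter>?F) S"
  proof (rule u_closed_def[THEN iffD2], intro conjI ballI impI InterI)
    show "ring_extension (\<Inter>?F) S"
      using sub is_cring by (simp add: ring_extension_def)
  next
    fix b B
    assume b: "b \<in> carrier S"
      "b [^]\<^bsub>S\<^esub> (2::nat) \<ominus>\<^bsub>S\<^esub> b \<in> \<Inter>?F \<and>
       b [^]\<^bsub>S\<^esub> (3::nat) \<ominus>\<^bsub>S\<^esub> b [^]\<^bsub>S\<^esub> (2::nat) \<in> \<Inter>?F" and B: "B \<in> ?F"
    then have "u_closed B S" by blast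
    then show "b \<in> B" using b B unfolding u_closed_def by blast
  qed
  show *: "u_closure R S = \<Inter>?F"
    unfolding u_closure_def using I U by (intro Least_equality) blast+
  show "u_closure R S \<in> intermediate_rings R S" "u_closed (u_closure R S) S"
    using I U * by simp_all
qed

text \<open>\<open>fraction D a s\<close> is the class of all pairs representing the fraction \<open>a / s\<close>.\<close>

definition fraction :: "('a, 'b) ring_scheme \<Rightarrow> 'a \<Rightarrow> 'a \<Rightarrow> ('a \<times> 'a) set" where
  "fraction D a s =
     {(b, t). b \<in> carrier D \<and> t \<in> carrier D - {\<zero>\<^bsub>D\<^esub>} \<and> a \<otimes>\<^bsub>D\<^esub> t = b \<otimes>\<^bsub>D\<^esub> s}"

text \<open>As with the multiplication of cosets in a quotient ring, each union below is over
  sets that all coincide.\<close>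

definition fraction_field :: "('a, 'b) ring_scheme \<Rightarrow> ('a \<times> 'a) set ring" where
  "fraction_field D =
     \<lparr> carrier = {fraction D a s | a s. a \<in> carrier D \<and> s \<in> carrier D - {\<zero>\<^bsub>D\<^esub>}},
       monoid.mult = (\<lambda>F G. \<Union>(a, s)\<in>F. \<Union>(b, t)\<in>G. fraction D (a \<otimes>\<^bsub>D\<^esub> b) (s \<otimes>\<^bsub>D\<^esub> t)),
       one = fraction D \<one>\<^bsub>D\<^esub> \<one>\<^bsub>D\<^esub>,
       ring.zero = fraction D \<zero>\<^bsub>D\<^esub> \<one>\<^bsub>D\<^esub>,
       ring.add = (\<lambda>F G. \<Union>(a, s)\<in>F. \<Union>(b, t)\<in>G.
                fraction D (a \<otimes>\<^bsub>D\<^esub> t \<oplus>\<^bsub>D\<^esub> b \<otimes>\<^bsub>D\<^esub> s) (s \<otimes>\<^bsub>D\<^esub> t)) \<rparr>"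

definition residue_field :: "('a, 'b) ring_scheme \<Rightarrow> 'a set \<Rightarrow> ('a set \<times> 'a set) set ring" where
  "residue_field A P = fraction_field (A Quot P)"

text \<open>The maps \<open>U/(Q \<inter> U) \<rightarrow> S/Q\<close> and \<open>\<kappa>\<^sub>U(Q \<inter> U) \<rightarrow> \<kappa>\<^sub>S(Q)\<close> induced by an inclusion
  \<open>U \<subseteq> S\<close>.\<close>

definition quotient_map :: "('a, 'b) ring_scheme \<Rightarrow> 'a set \<Rightarrow> 'a set \<Rightarrow> 'a set" where
  "quotient_map S Q A = (\<Union>x\<in>A. Q +>\<^bsub>S\<^esub> x)"

definition residue_map ::
    "('a, 'b) ring_scheme \<Rightarrow> 'a set \<Rightarrow> ('a set \<times> 'a set) set \<Rightarrow> ('a set \<times> 'a set) set" where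
  "residue_map S Q F =
     (\<Union>(A, B)\<in>F. fraction (S Quot Q) (quotient_map S Q A) (quotient_map S Q B))"

definition subintegral :: "'a set \<Rightarrow> ('a, 'b) ring_scheme \<Rightarrow> bool" where
  "subintegral U S \<longleftrightarrow> integral_extension U S \<and>
     inj_on (\<lambda>Q. Q \<inter> U) {Q. primeideal Q S} \<and>
     (\<forall>Q. primeideal Q S \<longrightarrow>
        residue_map S Q \<in>
          ring_iso (residue_field (S\<lparr>carrier := U\<rparr>) (Q \<inter> U)) (residue_field S Q))"

definition is_co_subintegral_closure :: "'a set \<Rightarrow> ('a, 'b) ring_scheme \<Rightarrow> 'a set \<Rightarrow> bool" where
  "is_co_subintegral_closure R S V \<longleftrightarrow>
     V \<in> intermediate_rings R S \<and> subintegral V S \<and>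
     (\<forall>W \<in> intermediate_rings R S. subintegral W S \<longrightarrow> V \<subseteq> W)"

end

theory Submission
  imports Defs
begin

text \<open>If \<open>W \<subseteq> S\<close> is subintegral, then \<open>Spec S \<rightarrow> Spec W\<close> is injective and hence \<open>W\<close> is u-closed in \<open>S\<close>, so
  \<open>W\<close> contains the u-closure of \<open>R\<close>. Conversely, for integral FCP extensions u-closedness gives
  injectivity on spectra, because modulo the conductor every element has a power that is associated
  to an idempotent. By FCP it therefore suffices that the intersection \<open>V\<close> of two subintegral
  subextensions \<open>W\<^sub>1\<close>, \<open>W\<^sub>2\<close> has the same residue field as \<open>S\<close> at each prime \<open>Q\<close> of \<open>S\<close>. If the
  conductor of \<open>V\<close> in \<open>S\<close> is not contained in \<open>Q\<close> this is clear. Otherwise the same happens for the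
  conductor of some \<open>W\<^sub>i\<close>, and above \<open>W\<^sub>i\<close> there is a minimal extension \<open>A \<subset> B\<close> with conductor
  \<open>M = Q \<inter> A\<close>, where \<open>A\<close> already has the residue field of \<open>S\<close>. It is ramified: \<open>B = A[x]\<close> with
  \<open>x\<^sup>2 \<in> M\<close>. If \<open>V\<close> had a smaller residue field, then \<open>T = V + M \<subset> A\<close>, and the interval from \<open>T\<close>
  to \<open>B\<close> would have maximal chains of different lengths, contradicting catenarity.\<close>

section \<open>Ideals of subrings\<close>

text \<open>Spectra cause no trouble for \<open>V\<close>, since u-closedness survives
  intersections. Residue fields are the obstacle: two subrings may each reach the full residue field
  of \<open>S\<close> at \<open>Q\<close> while their intersection reaches less, and a comparison of
  chain lengths is what excludes this. Only primes over the conductor of \<open>V\<close> matter,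
  because a conductor element outside \<open>Q\<close> serves as a denominator for everything. Some
  \<open>W\<^sub>i\<close> is then bad as well: for elements of \<open>V\<close>, a product of one
  from each of the two conductors lies in the conductor of \<open>V\<close>. The step
  \<open>A \<subset> B\<close> is ramified because \<open>W\<^sub>i\<close> already reaches every
  residue: an element of \<open>B\<close> outside \<open>A\<close> can be moved into
  \<open>Q\<close> by subtracting an element of \<open>W\<^sub>i\<close>. If the square of the
  result \<open>x\<close> were outside \<open>A\<close>, minimality would give an element idempotent
  modulo \<open>M\<close>; u-closedness puts it into \<open>M\<close>, and then \<open>x\<close>
  would lie in \<open>A\<close>. Conversely, a failure of u-closedness at \<open>b\<close> produces
  two primes of \<open>S\<close> over one prime of \<open>W\<close>, one through \<open>b\<close>
  and one through \<open>1 - b\<close>.\<close>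

context cring
begin

section \<open>Ideals of a subring, expressed in the operations of the big ring\<close>

lemma nat_pow_two: "a \<in> carrier R \<Longrightarrow> a [^] (2::nat) = a \<otimes> a"
  by (simp add: numeral_2_eq_2)

lemma nat_pow_three: "a \<in> carrier R \<Longrightarrow> a [^] (3::nat) = a \<otimes> a \<otimes> a"
  by (simp add: numeral_3_eq_3)

lemma subring_minus_closed:
  assumes "subring T R" "a \<in> T" "b \<in> T"
  shows "a \<ominus> b \<in> T"
  using subringE(5,7)[OF assms(1)] assms(2,3) by (simp add: minus_eq)

lemma subring_pow_closed:
  assumes "subring T R" "a \<in> T"
  shows "a [^] (n::nat) \<in> T"
  using subringE(3,6)[OF assms(1)] assms(2) by (induction n) simp_all

lemma subring_cring:
  assumes "subring T R"
  shows "cring (R\<lparr>carrier := T\<rparr>)"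
  using subcring_iff[OF subringE(1)[OF assms]] subcringI'[OF assms] by blast

lemma ideal_of_subringE:
  assumes T: "subring T R" and P: "ideal P (R\<lparr>carrier := T\<rparr>)"
  shows "P \<subseteq> T" and "\<zero> \<in> P"
    and "\<And>a b. a \<in> P \<Longrightarrow> b \<in> P \<Longrightarrow> a \<oplus> b \<in> P"
    and "\<And>a x. x \<in> T \<Longrightarrow> a \<in> P \<Longrightarrow> x \<otimes> a \<in> P"
    and "\<And>a x. x \<in> T \<Longrightarrow> a \<in> P \<Longrightarrow> a \<otimes> x \<in> P"
    and "\<And>a. a \<in> P \<Longrightarrow> \<ominus> a \<in> P"
    and "\<And>a b. a \<in> P \<Longrightarrow> b \<in> P \<Longrightarrow> a \<ominus> b \<in> P"
proof -
  interpret P: ideal P "R\<lparr>carrier := T\<rparr>" by fact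
  show sub: "P \<subseteq> T" using P.a_subset by simp
  show "\<zero> \<in> P" using additive_subgroup.zero_closed[OF P.is_additive_subgroup] by simp
  show add: "a \<oplus> b \<in> P" if "a \<in> P" "b \<in> P" for a b using additive_subgroup.a_closed[OF P.is_additive_subgroup] that by simp
  show l: "x \<otimes> a \<in> P" if "x \<in> T" "a \<in> P" for a x using P.I_l_closed that by simp
  show "a \<otimes> x \<in> P" if "x \<in> T" "a \<in> P" for a x using P.I_r_closed that by simp
  show neg: "\<ominus> a \<in> P" if "a \<in> P" for a
  proof -
    have "a \<in> carrier R" using that sub subringE(1)[OF T] by blast
    then have "\<ominus> a = (\<ominus> \<one>) \<otimes> a" by (simp add: l_minus)
    with l[OF subringE(5)[OF T subringE(3)[OF T]] that] show ?thesis by simp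
  qed
  show "a \<ominus> b \<in> P" if "a \<in> P" "b \<in> P" for a b
    using add neg that by (simp add: minus_eq)
qed

lemma idealE:
  assumes "ideal P R"
  shows "P \<subseteq> carrier R" and "\<zero> \<in> P"
    and "\<And>a b. a \<in> P \<Longrightarrow> b \<in> P \<Longrightarrow> a \<oplus> b \<in> P"
    and "\<And>a x. x \<in> carrier R \<Longrightarrow> a \<in> P \<Longrightarrow> x \<otimes> a \<in> P"
    and "\<And>a x. x \<in> carrier R \<Longrightarrow> a \<in> P \<Longrightarrow> a \<otimes> x \<in> P"
    and "\<And>a. a \<in> P \<Longrightarrow> \<ominus> a \<in> P"
    and "\<And>a b. a \<in> P \<Longrightarrow> b \<in> P \<Longrightarrow> a \<ominus> b \<in> P"
  using ideal_of_subringE[OF carrier_is_subring, of P] assms by simp_all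

lemma ideal_of_subringI:
  assumes T: "subring T R" and "P \<subseteq> T" "\<zero> \<in> P"
    and add: "\<And>a b. a \<in> P \<Longrightarrow> b \<in> P \<Longrightarrow> a \<oplus> b \<in> P"
    and l: "\<And>a x. x \<in> T \<Longrightarrow> a \<in> P \<Longrightarrow> x \<otimes> a \<in> P"
  shows "ideal P (R\<lparr>carrier := T\<rparr>)"
proof (rule idealI)
  have sub: "T \<subseteq> carrier R" using subringE(1)[OF T] .
  show r: "ring (R\<lparr>carrier := T\<rparr>)" by (rule subring_is_ring[OF T])
  interpret T: ring "R\<lparr>carrier := T\<rparr>" by fact
  show "subgroup P (add_monoid (R\<lparr>carrier := T\<rparr>))"
  proof (rule T.add.subgroupI)
    fix a assume a: "a \<in> P"
    \<comment> \<open>The negative taken in the restricted ring is rewritten as a multiple of its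
      \<open>-1\<close>, so that closure under multiplication suffices.\<close>
    then have aT: "a \<in> T" using \<open>P \<subseteq> T\<close> by blast
    have "\<ominus>\<^bsub>R\<lparr>carrier := T\<rparr>\<^esub> a = (\<ominus>\<^bsub>R\<lparr>carrier := T\<rparr>\<^esub> \<one>) \<otimes> a"
      using T.l_minus[of \<one> a] aT sub subringE(3)[OF T] by (simp add: subset_iff)
    moreover have "\<ominus>\<^bsub>R\<lparr>carrier := T\<rparr>\<^esub> \<one> \<in> T"
      using T.a_inv_closed[of \<one>] subringE(3)[OF T] by simp
    ultimately show "\<ominus>\<^bsub>R\<lparr>carrier := T\<rparr>\<^esub> a \<in> P" using l a by simp
  qed (use assms in auto)
  fix a x assume "a \<in> P" "x \<in> carrier (R\<lparr>carrier := T\<rparr>)"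
  then show "x \<otimes>\<^bsub>R\<lparr>carrier := T\<rparr>\<^esub> a \<in> P" "a \<otimes>\<^bsub>R\<lparr>carrier := T\<rparr>\<^esub> x \<in> P"
    using l[of x a] m_comm[of x a] \<open>P \<subseteq> T\<close> sub by (auto simp: subset_iff)
qed

lemma cring_idealI:
  assumes "P \<subseteq> carrier R" "\<zero> \<in> P"
    and "\<And>a b. a \<in> P \<Longrightarrow> b \<in> P \<Longrightarrow> a \<oplus> b \<in> P"
    and "\<And>a x. x \<in> carrier R \<Longrightarrow> a \<in> P \<Longrightarrow> x \<otimes> a \<in> P"
  shows "ideal P R"
  using ideal_of_subringI[OF carrier_is_subring assms] by simp

lemma prime_of_subringE:
  assumes T: "subring T R" and P: "primeideal P (R\<lparr>carrier := T\<rparr>)"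
  shows "ideal P (R\<lparr>carrier := T\<rparr>)" and "\<one> \<notin> P"
    and "\<And>a b. a \<in> T \<Longrightarrow> b \<in> T \<Longrightarrow> a \<otimes> b \<in> P \<Longrightarrow> a \<in> P \<or> b \<in> P"
proof -
  interpret P: primeideal P "R\<lparr>carrier := T\<rparr>" by fact
  show "ideal P (R\<lparr>carrier := T\<rparr>)" by (rule P.is_ideal)
  show "\<one> \<notin> P" using P.one_imp_carrier P.I_notcarr by auto
  show "a \<in> P \<or> b \<in> P" if "a \<in> T" "b \<in> T" "a \<otimes> b \<in> P" for a b
    using P.I_prime that by simp
qed

lemma primeidealE:
  assumes "primeideal P R"
  shows "ideal P R" and "\<one> \<notin> P"
    and "\<And>a b. a \<in> carrier R \<Longrightarrow> b \<in> carrier R \<Longrightarrow> a \<otimes> b \<in> P \<Longrightarrow> a \<in> P \<or> b \<in> P"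
  using prime_of_subringE[OF carrier_is_subring, of P] assms by simp_all

lemma prime_of_subringI:
  assumes T: "subring T R" and P: "ideal P (R\<lparr>carrier := T\<rparr>)" "\<one> \<notin> P"
    and "\<And>a b. a \<in> T \<Longrightarrow> b \<in> T \<Longrightarrow> a \<otimes> b \<in> P \<Longrightarrow> a \<in> P \<or> b \<in> P"
  shows "primeideal P (R\<lparr>carrier := T\<rparr>)"
  using subringE(3)[OF T] assms(3,4)
  by (intro primeidealI[OF P(1) subring_cring[OF T]]) auto

lemma primeideal_contract:
  assumes T: "subring T R" and Q: "primeideal Q R"
  shows "primeideal (Q \<inter> T) (R\<lparr>carrier := T\<rparr>)"
proof (rule prime_of_subringI[OF T ideal_of_subringI[OF T]])
  note T' = subringE[OF T] and I = idealE[OF primeidealE(1)[OF Q]]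
  show "\<zero> \<in> Q \<inter> T" using T'(2) I(2) by simp
  show "a \<oplus> b \<in> Q \<inter> T" if "a \<in> Q \<inter> T" "b \<in> Q \<inter> T" for a b using T'(7) I(3) that by simp
  show "x \<otimes> a \<in> Q \<inter> T" if "x \<in> T" "a \<in> Q \<inter> T" for a x
    using T'(6) I(4) subsetD[OF T'(1)] that by simp
  show "\<one> \<notin> Q \<inter> T" using primeidealE(2)[OF Q] by blast
  show "a \<in> Q \<inter> T \<or> b \<in> Q \<inter> T" if "a \<in> T" "b \<in> T" "a \<otimes> b \<in> Q \<inter> T" for a b
    using primeidealE(3)[OF Q, of a b] subsetD[OF T'(1)] that by simp
qed blast

lemma prime_pow:
  assumes T: "subring T R" and P: "primeideal P (R\<lparr>carrier := T\<rparr>)" and "a \<in> T"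
  shows "a [^] (n::nat) \<in> P \<Longrightarrow> a \<in> P"
  using prime_of_subringE(2,3)[OF T P] subring_pow_closed[OF T \<open>a \<in> T\<close>] \<open>a \<in> T\<close>
  by (induction n) auto

section \<open>Primes from Zorn's lemma\<close>

lemma ideal_sum_principal:
  assumes I: "ideal I R" and a: "a \<in> carrier R"
  defines "J \<equiv> {i \<oplus> r \<otimes> a | i r. i \<in> I \<and> r \<in> carrier R}"
  shows "ideal J R" "I \<subseteq> J" "a \<in> J"
proof -
  note I' = idealE[OF I]
  show "ideal J R"
  proof (rule cring_idealI)
    show "J \<subseteq> carrier R" using subsetD[OF I'(1)] a by (auto simp: J_def)
    have "\<zero> = \<zero> \<oplus> \<zero> \<otimes> a" using a by simp
    then show "\<zero> \<in> J" unfolding J_def using I'(2) by blast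
  next
    fix x y assume "x \<in> J" "y \<in> J"
    then obtain i r j s where *: "x = i \<oplus> r \<otimes> a" "y = j \<oplus> s \<otimes> a" "i \<in> I" "j \<in> I"
      and rs: "r \<in> carrier R" "s \<in> carrier R" unfolding J_def by blast
    then have ij: "i \<in> carrier R" "j \<in> carrier R" using subsetD[OF I'(1)] by auto
    have "x \<oplus> y = (i \<oplus> j) \<oplus> (r \<oplus> s) \<otimes> a" unfolding * using rs ij a by algebra
    then show "x \<oplus> y \<in> J" unfolding J_def using rs a_closed I'(3)[OF *(3,4)] by blast
  next
    fix x y assume y: "y \<in> carrier R" and "x \<in> J"
    then obtain i r where *: "x = i \<oplus> r \<otimes> a" "i \<in> I" and r: "r \<in> carrier R" unfolding J_def by blast
    then have i: "i \<in> carrier R" using subsetD[OF I'(1)] by auto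
    have "y \<otimes> x = y \<otimes> i \<oplus> (y \<otimes> r) \<otimes> a" unfolding * using r i a y by algebra
    then show "y \<otimes> x \<in> J" unfolding J_def using I'(4)[OF y *(2)] m_closed[OF y r] by blast
  qed
  show "I \<subseteq> J"
  proof
    fix i assume "i \<in> I"
    moreover have "i = i \<oplus> \<zero> \<otimes> a" using a I'(1) \<open>i \<in> I\<close> by auto
    ultimately show "i \<in> J" unfolding J_def by blast
  qed
  have "a = \<zero> \<oplus> \<one> \<otimes> a" using a by simp
  then show "a \<in> J" unfolding J_def using I'(2) by blast
qed

text \<open>An ideal maximal among those disjoint from a multiplicative set is prime. The maximality
  is exported too, because \<open>lying_over\<close> uses it and not only primality.\<close>

lemma exists_prime_avoiding:
  assumes J: "ideal J R" and M: "M \<subseteq> carrier R" "\<one> \<in> M" "\<And>a b. a \<in> M \<Longrightarrow> b \<in> M \<Longrightarrow> a \<otimes> b \<in> M"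
    and "J \<inter> M = {}"
  obtains Q where "primeideal Q R" "J \<subseteq> Q" "Q \<inter> M = {}"
    "\<And>I. ideal I R \<Longrightarrow> Q \<subseteq> I \<Longrightarrow> I \<inter> M = {} \<Longrightarrow> I = Q"
proof -
  let ?F = "{I. ideal I R \<and> J \<subseteq> I \<and> I \<inter> M = {}}"
  have "\<exists>Q\<in>?F. \<forall>I\<in>?F. Q \<subseteq> I \<longrightarrow> I = Q"
  proof (rule subset_Zorn_nonempty)
    show "?F \<noteq> {}" using J \<open>J \<inter> M = {}\<close> by blast
    fix C assume "C \<noteq> {}" and "subset.chain ?F C"
    then have C: "\<And>I. I \<in> C \<Longrightarrow> ideal I R \<and> J \<subseteq> I \<and> I \<inter> M = {}"
      and lin: "\<And>I I'. I \<in> C \<Longrightarrow> I' \<in> C \<Longrightarrow> I \<subseteq> I' \<or> I' \<subseteq> I"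
      by (auto simp: subset_chain_def)
    have "ideal (\<Union>C) R"
    proof (rule cring_idealI)
      show "\<Union>C \<subseteq> carrier R" using C idealE(1) by blast
      show "\<zero> \<in> \<Union>C" using \<open>C \<noteq> {}\<close> C idealE(2) by blast
      show "a \<oplus> b \<in> \<Union>C" if ab: "a \<in> \<Union>C" "b \<in> \<Union>C" for a b
      proof -
        obtain I where "I \<in> C" "a \<in> I" "b \<in> I" using ab lin by blast
        then show ?thesis using C[of I] idealE(3)[of I a b] by blast
      qed
      show "x \<otimes> a \<in> \<Union>C" if xa: "x \<in> carrier R" "a \<in> \<Union>C" for a x
      proof -
        obtain I where "I \<in> C" "a \<in> I" using xa by blast
        then show ?thesis using C[of I] idealE(4)[of I x a] xa(1) by blast
      qed
    qed
    then show "\<Union>C \<in> ?F" using C \<open>C \<noteq> {}\<close> by blast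
  qed
  then obtain Q where QF: "Q \<in> ?F" and maxF: "\<forall>I\<in>?F. Q \<subseteq> I \<longrightarrow> I = Q" by (rule bexE)
  then have Q: "ideal Q R" "J \<subseteq> Q" "Q \<inter> M = {}" by simp_all
  have max: "I = Q" if "ideal I R" "Q \<subseteq> I" "I \<inter> M = {}" for I
    using maxF subset_trans[OF Q(2) that(2)] that by simp
  note Q' = idealE[OF Q(1)]
  \<comment> \<open>By maximality, enlarging \<open>Q\<close> by any further element makes it meet
    \<open>M\<close>.\<close>
  have meets: "\<exists>q r. q \<in> Q \<and> r \<in> carrier R \<and> q \<oplus> r \<otimes> a \<in> M" if "a \<in> carrier R" "a \<notin> Q" for a
  proof (rule ccontr)
    let ?J = "{i \<oplus> r \<otimes> a | i r. i \<in> Q \<and> r \<in> carrier R}"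
    assume "\<nexists>q r. q \<in> Q \<and> r \<in> carrier R \<and> q \<oplus> r \<otimes> a \<in> M"
    then have "?J \<inter> M = {}" by blast
    then have "?J = Q" using max ideal_sum_principal(1,2)[OF Q(1) that(1)] by simp
    then show False using ideal_sum_principal(3)[OF Q(1) that(1)] that(2) by simp
  qed
  have "primeideal Q R"
  proof (rule primeidealI[OF Q(1) is_cring])
    show "carrier R \<noteq> Q" using Q(3) M(2) by auto
    fix a b assume ab: "a \<in> carrier R" "b \<in> carrier R" "a \<otimes> b \<in> Q"
    show "a \<in> Q \<or> b \<in> Q"
    proof (rule ccontr)
      assume "\<not> (a \<in> Q \<or> b \<in> Q)"
      then obtain q r p s where *: "q \<in> Q" "r \<in> carrier R" "q \<oplus> r \<otimes> a \<in> M"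
        "p \<in> Q" "s \<in> carrier R" "p \<oplus> s \<otimes> b \<in> M" using meets ab by meson
      then have qp: "q \<in> carrier R" "p \<in> carrier R" using subsetD[OF Q'(1)] by auto
      \<comment> \<open>As a product of two elements of \<open>M\<close> this lies in
        \<open>M\<close>, yet every summand of the expansion lies in \<open>Q\<close> once
        \<open>a \<otimes> b\<close> does.\<close>
      have "(q \<oplus> r \<otimes> a) \<otimes> (p \<oplus> s \<otimes> b) = q \<otimes> (p \<oplus> s \<otimes> b) \<oplus> (r \<otimes> a) \<otimes> p \<oplus> (r \<otimes> s) \<otimes> (a \<otimes> b)"
        using * qp ab by algebra
      moreover have "\<dots> \<in> Q" using * qp ab Q'(3-5) by simp
      ultimately show False using M(3)[OF *(3,6)] Q(3) by auto
    qed
  qed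
  with Q max show ?thesis by (intro that) auto
qed

lemma exists_prime_superideal:
  assumes "ideal J R" "\<one> \<notin> J"
  obtains Q where "primeideal Q R" "J \<subseteq> Q"
proof (rule exists_prime_avoiding[OF assms(1), of "{\<one>}"])
  show "J \<inter> {\<one>} = {}" using assms(2) by blast
qed (use that in auto)

section \<open>Integral extensions\<close>

lemma pow_diff_in_ideal:
  assumes I: "ideal I R" and carr[simp]: "a \<in> carrier R" "b \<in> carrier R" and "a \<ominus> b \<in> I"
  shows "a [^] (n::nat) \<ominus> b [^] n \<in> I"
proof (induction n)
  case 0
  then show ?case using idealE(2)[OF I] by (simp add: minus_eq r_neg)
next
  case (Suc n)
  define an bn where ab: "an = a [^] n" "bn = b [^] n"
  then have carr'[simp]: "an \<in> carrier R" "bn \<in> carrier R" by auto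
  have "an \<otimes> a \<ominus> bn \<otimes> b = an \<otimes> (a \<ominus> b) \<oplus> b \<otimes> (an \<ominus> bn)" using carr carr' by algebra
  moreover have "\<dots> \<in> I" using Suc assms(4) by (intro idealE(3,4)[OF I]) (auto simp: ab)
  ultimately show ?case by (simp add: ab)
qed

text \<open>Modulo \<open>Q\<close>, \<open>s\<close> behaves like the fraction
  \<open>t / p\<close>. A list of length \<open>n\<close> has degree below \<open>n\<close>, so
  multiplying by \<open>p^n\<close> turns each term \<open>a s^k\<close> into
  \<open>a p^(n-k) t^k\<close>, where at least one factor \<open>p\<close> survives; that factor is
  the \<open>p\<close> in front of \<open>c\<close>.\<close>

lemma homogenized_eval:
  assumes T: "subring T R" and Q: "ideal Q R" and p: "p \<in> T" and s: "s \<in> carrier R" and t: "t \<in> T"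
    and pst: "p \<otimes> s \<ominus> t \<in> Q" and "set l \<subseteq> T"
  shows "\<exists>c\<in>T. p [^] length l \<otimes> eval l s \<ominus> p \<otimes> c \<in> Q"
  using \<open>set l \<subseteq> T\<close>
proof (induction l)
  case Nil
  have "p \<in> carrier R" using p subringE(1)[OF T] by blast
  then have "p [^] length [] \<otimes> eval [] s \<ominus> p \<otimes> \<zero> = \<zero>" by (simp add: minus_eq)
  then show ?case using idealE(2)[OF Q] subringE(2)[OF T] by (intro bexI[of _ \<zero>]) simp_all
next
  case (Cons a l)
  note T' = subringE[OF T]
  obtain c where c: "c \<in> T" "p [^] length l \<otimes> eval l s \<ominus> p \<otimes> c \<in> Q" using Cons by auto
  define P S N e where d: "P = p [^] length l" "S = s [^] length l" "N = t [^] length l" "e = eval l s"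
  have carr[simp]: "a \<in> carrier R" "c \<in> carrier R" "p \<in> carrier R" "t \<in> carrier R"
    using Cons.prems p c t T'(1) by auto
  have e: "e \<in> carrier R" using Cons.prems s T'(1) unfolding d by (intro eval_in_carrier) auto
  have PSN: "P \<in> carrier R" "S \<in> carrier R" "N \<in> carrier R" using s unfolding d by auto
  have NT: "N \<in> T" unfolding d using subring_pow_closed[OF T t] .
  have 1: "P \<otimes> S \<ominus> N \<in> Q"
    using pow_diff_in_ideal[OF Q _ _ pst, of "length l"] s by (simp add: d nat_pow_distrib)
  have "(P \<otimes> p) \<otimes> (a \<otimes> S \<oplus> e) \<ominus> p \<otimes> (a \<otimes> N \<oplus> p \<otimes> c) = (p \<otimes> a) \<otimes> (P \<otimes> S \<ominus> N) \<oplus> p \<otimes> (P \<otimes> e \<ominus> p \<otimes> c)"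
    using e PSN carr by algebra
  moreover have "\<dots> \<in> Q" using 1 c(2) unfolding d(1,4)[symmetric] by (intro idealE(3,4)[OF Q]) auto
  moreover have "a \<otimes> N \<oplus> p \<otimes> c \<in> T" using NT c p Cons.prems T'(6,7) by simp
  ultimately show ?case by (intro bexI[of _ "a \<otimes> N \<oplus> p \<otimes> c"]) (simp_all add: d)
qed

lemma integral_overE:
  assumes T: "subring T R" and "integral_over T R x" and x: "x \<in> carrier R"
  obtains l where "set l \<subseteq> T" "x [^] length l \<oplus> eval l x = \<zero>"
proof -
  obtain q where q: "q \<noteq> []" "set q \<subseteq> T" "lead_coeff q = \<one>" "eval q x = \<zero>"
    using assms(2) unfolding integral_over_def by blast
  then obtain l where "q = \<one> # l" by (cases q) auto
  with q x have "x [^] length l \<oplus> eval l x = \<zero>" "set l \<subseteq> T" by auto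
  then show ?thesis using that by blast
qed

lemma integral_over_mono: "integral_over T R x \<Longrightarrow> T \<subseteq> U \<Longrightarrow> integral_over U R x"
  unfolding integral_over_def by blast

text \<open>The monic equation of \<open>s\<close> is multiplied by \<open>p^n\<close>: the leading
  term becomes \<open>t^n\<close> and the rest stays divisible by \<open>p\<close>. With
  \<open>p\<close> in a prime this drives lying over; with \<open>t = 1\<close> it shows that an
  inverse of \<open>p\<close> already exists in \<open>T\<close> modulo \<open>Q\<close>.\<close>

lemma integral_homogenized:
  assumes T: "subring T R" and Q: "ideal Q R" and p: "p \<in> T" and s: "s \<in> carrier R" and t: "t \<in> T"
    and pst: "p \<otimes> s \<ominus> t \<in> Q" and "integral_over T R s"
  shows "\<exists>n. \<exists>c\<in>T. t [^] (n::nat) \<oplus> p \<otimes> c \<in> Q"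
proof -
  note T' = subringE[OF T]
  obtain l where l: "set l \<subseteq> T" "s [^] length l \<oplus> eval l s = \<zero>"
    using integral_overE[OF T assms(7) s] .
  obtain c where c: "c \<in> T" "p [^] length l \<otimes> eval l s \<ominus> p \<otimes> c \<in> Q"
    using homogenized_eval[OF T Q p s t pst l(1)] by blast
  define P S N e where d: "P = p [^] length l" "S = s [^] length l" "N = t [^] length l" "e = eval l s"
  have carr[simp]: "c \<in> carrier R" "p \<in> carrier R" "t \<in> carrier R" using p c t T'(1) by auto
  have e: "e \<in> carrier R" using l s T'(1) unfolding d by (intro eval_in_carrier) auto
  have PSN: "P \<in> carrier R" "S \<in> carrier R" "N \<in> carrier R" using s unfolding d by auto
  have 1: "P \<otimes> S \<ominus> N \<in> Q"
    using pow_diff_in_ideal[OF Q _ _ pst, of "length l"] s by (simp add: d nat_pow_distrib)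
  have "N \<oplus> p \<otimes> c = P \<otimes> (S \<oplus> e) \<ominus> ((P \<otimes> S \<ominus> N) \<oplus> (P \<otimes> e \<ominus> p \<otimes> c))"
    using e PSN carr by algebra
  also have "\<dots> \<in> Q"
    using l(2) c(2) 1 idealE(2,3,7)[OF Q] PSN unfolding d(1,2,4)[symmetric] by simp
  finally show ?thesis using c d by blast
qed

text \<open>\<open>Q\<close> is taken maximal among the ideals containing \<open>J\<close> that miss
  \<open>T - P\<close>. What remains is \<open>P \<subseteq> Q\<close>: if \<open>p\<close> in
  \<open>P\<close> were missing, \<open>Q\<close> together with \<open>p\<close> would contain some
  \<open>t\<close> in \<open>T - P\<close>, and integrality would force a power of \<open>t\<close>
  into \<open>P\<close>.\<close>

theorem lying_over:
  assumes T: "subring T R" and int: "\<And>x. x \<in> carrier R \<Longrightarrow> integral_over T R x"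
    and J: "ideal J R" and P: "primeideal P (R\<lparr>carrier := T\<rparr>)" and "J \<inter> T \<subseteq> P"
  obtains Q where "primeideal Q R" "J \<subseteq> Q" "Q \<inter> T = P"
proof -
  note T' = subringE[OF T] and P' = prime_of_subringE[OF T P]
  note PI = ideal_of_subringE[OF T P'(1)]
  obtain Q where Q: "primeideal Q R" "J \<subseteq> Q" "Q \<inter> (T - P) = {}"
    and max: "\<And>I. ideal I R \<Longrightarrow> Q \<subseteq> I \<Longrightarrow> I \<inter> (T - P) = {} \<Longrightarrow> I = Q"
  proof (rule exists_prime_avoiding[OF J, of "T - P"])
    show "T - P \<subseteq> carrier R" "\<one> \<in> T - P" "J \<inter> (T - P) = {}"
      using T'(1,3) P'(2) \<open>J \<inter> T \<subseteq> P\<close> by auto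
    show "a \<otimes> b \<in> T - P" if "a \<in> T - P" "b \<in> T - P" for a b
      using T'(6) P'(3)[of a b] that by auto
  qed (use that in auto)
  note QI = idealE[OF primeidealE(1)[OF Q(1)]]
  have "P \<subseteq> Q"
  proof
    fix p assume p: "p \<in> P"
    show "p \<in> Q"
    proof (rule ccontr)
      assume "p \<notin> Q"
      have pT: "p \<in> T" and pR: "p \<in> carrier R" using p PI(1) T'(1) by auto
      have "\<exists>q s. q \<in> Q \<and> s \<in> carrier R \<and> q \<oplus> s \<otimes> p \<in> T - P"
      proof (rule ccontr)
        let ?J = "{i \<oplus> r \<otimes> p | i r. i \<in> Q \<and> r \<in> carrier R}"
        note J' = ideal_sum_principal[OF primeidealE(1)[OF Q(1)] pR]
        assume "\<nexists>q s. q \<in> Q \<and> s \<in> carrier R \<and> q \<oplus> s \<otimes> p \<in> T - P"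
        then have "?J \<inter> (T - P) = {}" by blast
        then have "?J = Q" using max J'(1,2) by simp
        then show False using J'(3) \<open>p \<notin> Q\<close> by simp
      qed
      then obtain q s t where qs: "q \<in> Q" "s \<in> carrier R" "t = q \<oplus> s \<otimes> p" "t \<in> T" "t \<notin> P" by blast
      have qR: "q \<in> carrier R" using qs(1) QI(1) by blast
      have "p \<otimes> s \<ominus> t = \<ominus> q" unfolding qs(3) using qR qs(2) pR by algebra
      then have "p \<otimes> s \<ominus> t \<in> Q" using QI(6)[OF qs(1)] by simp
      \<comment> \<open>Modulo \<open>Q\<close>, \<open>t\<close> equals
        \<open>p \<otimes> s\<close>, so the integral equation of \<open>s\<close> becomes one for
        \<open>t\<close> whose lower terms are divisible by \<open>p\<close>.\<close>
      then obtain n c where nc: "c \<in> T" "t [^] (n::nat) \<oplus> p \<otimes> c \<in> Q"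
        using integral_homogenized[OF T primeidealE(1)[OF Q(1)] pT qs(2,4)] int qs(2) by blast
      have tn: "t [^] n \<in> T" using subring_pow_closed[OF T qs(4)] .
      have pc: "p \<otimes> c \<in> P" using PI(5)[OF nc(1) p] .
      have "t [^] n \<oplus> p \<otimes> c \<in> P" using nc(2) T'(7)[OF tn T'(6)[OF pT nc(1)]] Q(3) by blast
      then have "(t [^] n \<oplus> p \<otimes> c) \<ominus> p \<otimes> c \<in> P" using pc PI(7) by simp
      moreover have "(u \<oplus> v) \<ominus> v = u" if "u \<in> carrier R" "v \<in> carrier R" for u v
        using that by algebra
      moreover have "t [^] n \<in> carrier R" "p \<otimes> c \<in> carrier R"
        using tn T'(6)[OF pT nc(1)] T'(1) by auto
      ultimately have "t [^] n \<in> P" by simp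
      then show False using prime_pow[OF T P qs(4)] qs(5) by blast
    qed
  qed
  then have "Q \<inter> T = P" using Q(3) PI(1) by blast
  then show ?thesis using that Q by blast
qed

text \<open>For a proper ideal \<open>P\<close> of \<open>T\<close> this says that
  \<open>T/P\<close> is a field, that is, that \<open>P\<close> is maximal, without building the
  quotient.\<close>

definition field_mod :: "'a set \<Rightarrow> 'a set \<Rightarrow> bool" where
  "field_mod T P \<longleftrightarrow> (\<forall>a\<in>T - P. \<exists>c\<in>T. \<one> \<ominus> a \<otimes> c \<in> P)"

lemma field_mod_prime:
  assumes T: "subring T R" and P: "ideal P (R\<lparr>carrier := T\<rparr>)" "\<one> \<notin> P" and F: "field_mod T P"
  shows "primeideal P (R\<lparr>carrier := T\<rparr>)"
proof (rule prime_of_subringI[OF T P])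
  note PI = ideal_of_subringE[OF T P(1)]
  fix a b assume ab: "a \<in> T" "b \<in> T" "a \<otimes> b \<in> P"
  show "a \<in> P \<or> b \<in> P"
  proof (cases "a \<in> P")
    case False
    then obtain c where c: "c \<in> T" "\<one> \<ominus> a \<otimes> c \<in> P" using F ab(1) unfolding field_mod_def by blast
    have carr[simp]: "a \<in> carrier R" "b \<in> carrier R" "c \<in> carrier R"
      using ab c subringE(1)[OF T] by auto
    have "b = (\<one> \<ominus> a \<otimes> c) \<otimes> b \<oplus> c \<otimes> (a \<otimes> b)" using carr by algebra
    also have "\<dots> \<in> P" using PI(3)[OF PI(5)[OF ab(2) c(2)] PI(4)[OF c(1) ab(3)]] .
    finally show ?thesis ..
  qed simp
qed

text \<open>A domain integral over a field is a field: the constant coefficient of an integral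
  equation of \<open>x\<close> is either invertible, which yields an inverse of \<open>x\<close>, or
  zero, and then \<open>x\<close> can be cancelled.\<close>

lemma field_mod_ascend:
  assumes T: "subring T R" and int: "\<And>x. x \<in> carrier R \<Longrightarrow> integral_over T R x"
    and Q: "primeideal Q R" and F: "field_mod T (Q \<inter> T)"
  shows "field_mod (carrier R) Q"
  unfolding field_mod_def
proof
  note Q' = primeidealE[OF Q] and T' = subringE[OF T]
  note QI = idealE[OF Q'(1)]
  fix x assume "x \<in> carrier R - Q"
  then have x[simp]: "x \<in> carrier R" and "x \<notin> Q" by auto
  \<comment> \<open>A monic polynomial with value in \<open>Q\<close>, rather than value zero, lets
    the induction drop the constant coefficient, which is the last entry of the list.\<close>
  have "\<exists>y\<in>carrier R. \<one> \<ominus> x \<otimes> y \<in> Q" if "set l \<subseteq> T" "eval (\<one> # l) x \<in> Q" for l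
    using that
  proof (induction l rule: rev_induct)
    case Nil
    then show ?case using Q'(2) by simp
  next
    case (snoc a l)
    define e where "e = eval (\<one> # l) x"
    have aT: "a \<in> T" and "set l \<subseteq> carrier R" using snoc.prems(1) T'(1) by auto
    then have e[simp]: "e \<in> carrier R" unfolding e_def by (intro eval_in_carrier) simp_all
    have a[simp]: "a \<in> carrier R" using aT T'(1) by blast
    have "eval ((\<one> # l) @ [a]) x = e \<otimes> x \<oplus> a"
      unfolding e_def using snoc.prems(1) T'(1) by (intro eval_append_aux) auto
    then have exa: "e \<otimes> x \<oplus> a \<in> Q" using snoc.prems(2) by (simp del: eval.simps)
    show ?case
    proof (cases "a \<in> Q")
      case True
      have "e \<otimes> x = (e \<otimes> x \<oplus> a) \<ominus> a" using x e a by algebra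
      also have "\<dots> \<in> Q" using QI(7)[OF exa True] .
      finally have "e \<in> Q" using Q'(3)[of e x] \<open>x \<notin> Q\<close> by simp
      then show ?thesis using snoc unfolding e_def by (simp del: eval.simps)
    next
      case False
      then obtain c where c: "c \<in> T" "\<one> \<ominus> a \<otimes> c \<in> Q" using F aT unfolding field_mod_def by blast
      then have cR[simp]: "c \<in> carrier R" using T'(1) by blast
      have "\<one> \<ominus> x \<otimes> (\<ominus> (e \<otimes> c)) = (\<one> \<ominus> a \<otimes> c) \<oplus> (e \<otimes> x \<oplus> a) \<otimes> c"
        using x e a cR by algebra
      also have "\<dots> \<in> Q" using QI(3)[OF c(2) QI(5)[OF _ exa]] by simp
      finally show ?thesis by (intro bexI[of _ "\<ominus> (e \<otimes> c)"]) simp_all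
    qed
  qed
  moreover obtain l where "set l \<subseteq> T" "x [^] length l \<oplus> eval l x = \<zero>"
    using integral_overE[OF T int[OF x] x] .
  ultimately show "\<exists>c\<in>carrier R. \<one> \<ominus> x \<otimes> c \<in> Q" using QI(2) by simp
qed

text \<open>An inverse \<open>s\<close> of \<open>a\<close> modulo \<open>Q\<close> is found in
  \<open>A\<close>; homogenizing its integral equation over \<open>T\<close> by powers of
  \<open>a\<close> gives \<open>1 + a c\<close> in \<open>Q\<close> with \<open>c\<close> in
  \<open>T\<close>, so \<open>-c\<close> is an inverse in \<open>T\<close>.\<close>

lemma field_mod_descend:
  assumes T: "subring T R" and int: "\<And>x. x \<in> carrier R \<Longrightarrow> integral_over T R x"
    and A: "subring A R" "T \<subseteq> A" and Q: "primeideal Q R" and F: "field_mod A (Q \<inter> A)"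
  shows "field_mod T (Q \<inter> T)"
  unfolding field_mod_def
proof
  note Q' = primeidealE[OF Q] and T' = subringE[OF T]
  note QI = idealE[OF Q'(1)]
  fix a assume "a \<in> T - Q \<inter> T"
  then have a: "a \<in> T" "a \<in> A - Q \<inter> A" using A by auto
  then obtain s where s: "s \<in> A" "\<one> \<ominus> a \<otimes> s \<in> Q" using F unfolding field_mod_def by blast
  have carr[simp]: "a \<in> carrier R" "s \<in> carrier R" using a s subringE(1)[OF A(1)] by auto
  have "a \<otimes> s \<ominus> \<one> = \<ominus> (\<one> \<ominus> a \<otimes> s)" using carr by algebra
  also have "\<dots> \<in> Q" using QI(6)[OF s(2)] .
  finally obtain n c where c: "c \<in> T" "\<one> [^] (n::nat) \<oplus> a \<otimes> c \<in> Q"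
    using integral_homogenized[OF T Q'(1) a(1) _ T'(3), of s] int[of s] by auto
  then have carr[simp]: "c \<in> carrier R" using T'(1) by blast
  have "\<one> \<ominus> a \<otimes> (\<ominus> c) = \<one> [^] n \<oplus> a \<otimes> c" by (simp add: minus_eq r_minus)
  moreover have "\<one> \<ominus> a \<otimes> (\<ominus> c) \<in> T"
    using subring_minus_closed[OF T T'(3) T'(6)[OF a(1) T'(5)[OF c(1)]]] .
  ultimately show "\<exists>c\<in>T. \<one> \<ominus> a \<otimes> c \<in> Q \<inter> T" using c T'(5) by (intro bexI[of _ "\<ominus> c"]) auto
qed

section \<open>Minimal extensions and conductors\<close>

lemma mem_set_add: "x \<in> A <+>\<^bsub>R\<^esub> Z \<longleftrightarrow> (\<exists>a\<in>A. \<exists>z\<in>Z. x = a \<oplus> z)"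
  by (auto simp: set_add_def')

text \<open>Products within \<open>Z\<close> need only land in the sum, not in \<open>Z\<close>.
  This covers \<open>Z = W b\<close> with \<open>b^2 = b + r\<close>, where the product of two
  elements of \<open>Z\<close> has a component in \<open>W\<close>.\<close>

lemma subring_set_add:
  assumes A: "subring A R" and Z: "Z \<subseteq> carrier R" "\<zero> \<in> Z"
    and add: "\<And>y z. y \<in> Z \<Longrightarrow> z \<in> Z \<Longrightarrow> y \<oplus> z \<in> Z"
    and smult: "\<And>a z. a \<in> A \<Longrightarrow> z \<in> Z \<Longrightarrow> a \<otimes> z \<in> Z"
    and mult: "\<And>y z. y \<in> Z \<Longrightarrow> z \<in> Z \<Longrightarrow> y \<otimes> z \<in> A <+>\<^bsub>R\<^esub> Z"
  shows "subring (A <+>\<^bsub>R\<^esub> Z) R" "A \<subseteq> A <+>\<^bsub>R\<^esub> Z" "Z \<subseteq> A <+>\<^bsub>R\<^esub> Z"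
proof -
  note A' = subringE[OF A]
  have sub: "a \<in> carrier R" if "a \<in> A" for a using that A'(1) by blast
  have subZ: "z \<in> carrier R" if "z \<in> Z" for z using that Z by blast
  have addAZ: "x \<oplus> y \<in> A <+>\<^bsub>R\<^esub> Z" if "x \<in> A <+>\<^bsub>R\<^esub> Z" "y \<in> A <+>\<^bsub>R\<^esub> Z" for x y
  proof -
    obtain a z b w where *: "x = a \<oplus> z" "y = b \<oplus> w" "a \<in> A" "b \<in> A" "z \<in> Z" "w \<in> Z"
      using \<open>x \<in> A <+>\<^bsub>R\<^esub> Z\<close> \<open>y \<in> A <+>\<^bsub>R\<^esub> Z\<close> unfolding mem_set_add by blast
    have "x \<oplus> y = (a \<oplus> b) \<oplus> (z \<oplus> w)"
      unfolding * using sub[OF *(3)] sub[OF *(4)] subZ[OF *(5)] subZ[OF *(6)]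
      by algebra
    moreover have "a \<oplus> b \<in> A" "z \<oplus> w \<in> Z" using * A'(7) add by auto
    ultimately show ?thesis unfolding mem_set_add by blast
  qed
  show sA: "A \<subseteq> A <+>\<^bsub>R\<^esub> Z"
  proof
    fix a assume "a \<in> A"
    moreover have "a = a \<oplus> \<zero>" using sub[OF \<open>a \<in> A\<close>] by simp
    ultimately show "a \<in> A <+>\<^bsub>R\<^esub> Z" unfolding mem_set_add using Z(2) by blast
  qed
  show sZ: "Z \<subseteq> A <+>\<^bsub>R\<^esub> Z"
  proof
    fix a assume "a \<in> Z"
    moreover have "a = \<zero> \<oplus> a" using subZ[OF \<open>a \<in> Z\<close>] by simp
    ultimately show "a \<in> A <+>\<^bsub>R\<^esub> Z" unfolding mem_set_add using A'(2) by blast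
  qed
  show "subring (A <+>\<^bsub>R\<^esub> Z) R"
  proof (rule subringI)
    show "A <+>\<^bsub>R\<^esub> Z \<subseteq> carrier R" using sub subZ by (auto simp: mem_set_add)
    show "\<one> \<in> A <+>\<^bsub>R\<^esub> Z" using sA A'(3) by blast
    fix x assume "x \<in> A <+>\<^bsub>R\<^esub> Z"
    then obtain a z where *: "x = a \<oplus> z" "a \<in> A" "z \<in> Z" unfolding mem_set_add by blast
    \<comment> \<open>Closure of \<open>Z\<close> under negation comes from \<open>smult\<close>
      with the scalar \<open>-1\<close>.\<close>
    have "\<ominus> x = (\<ominus> a) \<oplus> (\<ominus> \<one>) \<otimes> z"
      unfolding * using sub[OF *(2)] subZ[OF *(3)] by algebra
    moreover have "(\<ominus> \<one>) \<otimes> z \<in> Z" "\<ominus> a \<in> A" using smult A'(3,5) * by auto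
    ultimately show "\<ominus> x \<in> A <+>\<^bsub>R\<^esub> Z" unfolding mem_set_add by blast
    fix y assume "y \<in> A <+>\<^bsub>R\<^esub> Z"
    then obtain b w where **: "y = b \<oplus> w" "b \<in> A" "w \<in> Z" unfolding mem_set_add by blast
    have "x \<otimes> y = (a \<otimes> b \<oplus> (a \<otimes> w \<oplus> b \<otimes> z)) \<oplus> z \<otimes> w"
      unfolding * ** using sub[OF *(2)] subZ[OF *(3)] sub[OF **(2)] subZ[OF **(3)]
      by algebra
    moreover have "a \<otimes> b \<oplus> (a \<otimes> w \<oplus> b \<otimes> z) \<in> A <+>\<^bsub>R\<^esub> Z"
      unfolding mem_set_add
      using A'(6)[OF *(2) **(2)] add[OF smult[OF *(2) **(3)] smult[OF **(2) *(3)]] by blast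
    ultimately show "x \<otimes> y \<in> A <+>\<^bsub>R\<^esub> Z" using addAZ mult * ** by simp
  qed (rule addAZ)
qed

text \<open>For subrings \<open>A \<subseteq> B\<close>, the annihilator of the
  \<open>A\<close>-module \<open>B/A\<close>, which is the largest ideal of \<open>B\<close>
  contained in \<open>A\<close>.\<close>

definition conductor :: "'a set \<Rightarrow> 'a set \<Rightarrow> 'a set" where
  "conductor A B = {a \<in> A. \<forall>b\<in>B. a \<otimes> b \<in> A}"

lemma conductor_ideal:
  assumes A: "subring A R" and B: "subring B R" and "A \<subseteq> B"
  shows "ideal (conductor A B) (R\<lparr>carrier := B\<rparr>)" "ideal (conductor A B) (R\<lparr>carrier := A\<rparr>)"
    "\<one> \<in> conductor A B \<longleftrightarrow> A = B"
proof -
  note A' = subringE[OF A] and B' = subringE[OF B]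
  have sub: "b \<in> carrier R" if "b \<in> B" for b using that B'(1) by blast
  have 1: "conductor A B \<subseteq> A" unfolding conductor_def by blast
  have 2: "\<zero> \<in> conductor A B" unfolding conductor_def using A'(2) sub by auto
  have 3: "x \<oplus> y \<in> conductor A B" if "x \<in> conductor A B" "y \<in> conductor A B" for x y
    using that A'(7) \<open>A \<subseteq> B\<close> sub by (auto simp: conductor_def l_distr subset_iff)
  have 4: "b \<otimes> x \<in> conductor A B" if "b \<in> B" "x \<in> conductor A B" for b x
  proof -
    have x: "x \<in> A" "\<And>c. c \<in> B \<Longrightarrow> x \<otimes> c \<in> A" using that unfolding conductor_def by auto
    have "b \<otimes> x \<otimes> c = x \<otimes> (b \<otimes> c)" if "c \<in> B" for c
      using x(1) that \<open>b \<in> B\<close> \<open>A \<subseteq> B\<close> sub m_lcomm m_assoc by (simp add: subset_iff)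
    moreover have "b \<otimes> x = x \<otimes> b" using x(1) \<open>b \<in> B\<close> \<open>A \<subseteq> B\<close> sub m_comm by (simp add: subset_iff)
    ultimately show ?thesis using x(2) B'(6) \<open>b \<in> B\<close> unfolding conductor_def by simp
  qed
  show "ideal (conductor A B) (R\<lparr>carrier := B\<rparr>)"
    using 1 2 3 4 \<open>A \<subseteq> B\<close> by (intro ideal_of_subringI[OF B]) auto
  show "ideal (conductor A B) (R\<lparr>carrier := A\<rparr>)"
    using 1 2 3 4 \<open>A \<subseteq> B\<close> by (intro ideal_of_subringI[OF A]) auto
  show "\<one> \<in> conductor A B \<longleftrightarrow> A = B"
    using A'(3,6) \<open>A \<subseteq> B\<close> sub unfolding conductor_def by auto
qed

section \<open>Minimal integral extensions and Nakayama's lemma\<close>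

definition minimal_extension :: "'a set \<Rightarrow> 'a set \<Rightarrow> bool" where
  "minimal_extension A B \<longleftrightarrow> subring A R \<and> subring B R \<and> A \<subset> B \<and>
     (\<forall>C. subring C R \<longrightarrow> A \<subseteq> C \<longrightarrow> C \<subseteq> B \<longrightarrow> C = A \<or> C = B)"

text \<open>The \<open>A\<close>-module generated by the \<open>n\<close> powers
  \<open>b^0, ..., b^(n-1)\<close>; thus index \<open>Suc 0\<close> gives \<open>A\<close> itself.
  The recursion exposes the top generator, which is the one removed in each step of Nakayama's
  lemma.\<close>

primrec pow_span :: "'a set \<Rightarrow> 'a \<Rightarrow> nat \<Rightarrow> 'a set" where
  "pow_span A b 0 = {\<zero>}"
| "pow_span A b (Suc n) = {a \<otimes> b [^] n \<oplus> y | a y. a \<in> A \<and> y \<in> pow_span A b n}"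

context
  fixes A :: "'a set" and b :: 'a
  assumes A: "subring A R" and b: "b \<in> carrier R"
begin

lemma pow_span_carrier: "pow_span A b n \<subseteq> carrier R"
  using subringE(1)[OF A] b by (induction n) auto

lemma pow_span_add:
  "x \<in> pow_span A b n \<Longrightarrow> y \<in> pow_span A b n \<Longrightarrow> x \<oplus> y \<in> pow_span A b n"
proof (induction n arbitrary: x y)
  case (Suc n)
  then obtain a z c w where *: "x = a \<otimes> b [^] n \<oplus> z" "y = c \<otimes> b [^] n \<oplus> w" "a \<in> A" "c \<in> A"
    "z \<in> pow_span A b n" "w \<in> pow_span A b n" by auto
  define bn where "bn = b [^] n"
  have carr[simp]: "a \<in> carrier R" "c \<in> carrier R" "z \<in> carrier R" "w \<in> carrier R" "bn \<in> carrier R"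
    using * subringE(1)[OF A] pow_span_carrier b unfolding bn_def by auto
  have "x \<oplus> y = (a \<oplus> c) \<otimes> bn \<oplus> (z \<oplus> w)"
    unfolding * bn_def[symmetric] using carr by algebra
  then show ?case using subringE(7)[OF A *(3,4)] Suc.IH[OF *(5,6)] unfolding bn_def pow_span.simps by blast
qed simp

lemma pow_span_smult: "c \<in> A \<Longrightarrow> x \<in> pow_span A b n \<Longrightarrow> c \<otimes> x \<in> pow_span A b n"
proof (induction n arbitrary: x)
  case 0
  then show ?case using subringE(1)[OF A] by auto
next
  case (Suc n)
  then obtain a z where *: "x = a \<otimes> b [^] n \<oplus> z" "a \<in> A" "z \<in> pow_span A b n" by auto
  define bn where "bn = b [^] n"
  have carr[simp]: "a \<in> carrier R" "c \<in> carrier R" "z \<in> carrier R" "bn \<in> carrier R"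
    using * Suc.prems subringE(1)[OF A] pow_span_carrier b unfolding bn_def by auto
  have "c \<otimes> x = (c \<otimes> a) \<otimes> bn \<oplus> c \<otimes> z"
    unfolding * bn_def[symmetric] using carr by algebra
  then show ?case
    using subringE(6)[OF A Suc.prems(1) *(2)] Suc.IH[OF Suc.prems(1) *(3)] unfolding bn_def pow_span.simps by blast
qed

lemma pow_span_Suc: "pow_span A b n \<subseteq> pow_span A b (Suc n)"
proof
  fix y assume y: "y \<in> pow_span A b n"
  then have "y = \<zero> \<otimes> b [^] n \<oplus> y" using subsetD[OF pow_span_carrier y] b by simp
  then show "y \<in> pow_span A b (Suc n)" using y subringE(2)[OF A] by auto
qed

lemma pow_span_one: "pow_span A b (Suc 0) = A"
proof -
  have "a \<otimes> b [^] (0::nat) \<oplus> \<zero> = a" if "a \<in> A" for a using that subringE(1)[OF A] by auto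
  then show ?thesis by (auto simp del: nat_pow_0) metis
qed

lemma subring_subset_pow_span: "A \<subseteq> pow_span A b (Suc n)"
proof (induction n)
  case 0
  then show ?case using pow_span_one by simp
next
  case (Suc n)
  then show ?case using pow_span_Suc[of "Suc n"] by blast
qed

lemma pow_span_times: "y \<in> pow_span A b n \<Longrightarrow> b \<otimes> y \<in> pow_span A b (Suc n)"
proof (induction n arbitrary: y)
  case 0
  then show ?case using pow_span_one subringE(2)[OF A] b by simp
next
  case (Suc n)
  then obtain a z where *: "y = a \<otimes> b [^] n \<oplus> z" "a \<in> A" "z \<in> pow_span A b n" by auto
  define bn where "bn = b [^] n"
  have carr[simp]: "a \<in> carrier R" "z \<in> carrier R" "bn \<in> carrier R" "b \<in> carrier R"
    using * Suc.prems subringE(1)[OF A] pow_span_carrier b unfolding bn_def by auto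
  have "b \<otimes> y = a \<otimes> (bn \<otimes> b) \<oplus> b \<otimes> z"
    unfolding * bn_def[symmetric] using carr by algebra
  then have "b \<otimes> y = a \<otimes> b [^] Suc n \<oplus> b \<otimes> z" by (simp add: bn_def)
  with Suc.IH[OF *(3)] *(2) show ?case unfolding pow_span.simps(2)[of A b "Suc n"] by blast
qed

lemma pow_span_eval: "set l \<subseteq> A \<Longrightarrow> eval l b \<in> pow_span A b (length l)"
  by (induction l) auto

declare pow_span.simps(2)[simp del]

text \<open>Once \<open>b^(n+1)\<close> reduces to lower powers, the span is stable under
  multiplication by \<open>b\<close>, hence by all powers of \<open>b\<close> and by their
  \<open>A\<close>-combinations.\<close>

lemma pow_span_subring:
  assumes n: "b [^] Suc n \<in> pow_span A b (Suc n)"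
  shows "subring (pow_span A b (Suc n)) R" "b \<in> pow_span A b (Suc n)"
proof -
  let ?X = "pow_span A b (Suc n)"
  have one: "\<one> \<in> ?X" using subring_subset_pow_span subringE(3)[OF A] by blast
  have times: "b \<otimes> y \<in> ?X" if y: "y \<in> ?X" for y
  proof -
    obtain a z where "b \<otimes> y = a \<otimes> b [^] Suc n \<oplus> z" "a \<in> A" "z \<in> ?X"
      using pow_span_times[OF y] unfolding pow_span.simps(2)[of A b "Suc n"] by blast
    then show ?thesis using n pow_span_smult pow_span_add by simp
  qed
  have pow: "b [^] k \<otimes> y \<in> ?X" if y: "y \<in> ?X" for k :: nat and y
  proof (induction k)
    case 0
    then show ?case using y pow_span_carrier[of "Suc n"] by auto
  next
    case (Suc k)
    have "b [^] Suc k \<otimes> y = b \<otimes> (b [^] k \<otimes> y)"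
      using b y pow_span_carrier[of "Suc n"] by (simp add: m_ac subset_iff)
    then show ?case using Suc times by simp
  qed
  have mult: "x \<otimes> y \<in> ?X" if "x \<in> pow_span A b k" "y \<in> ?X" for k x y
    using that
  proof (induction k arbitrary: x)
    case 0
    then show ?case
      using subsetD[OF subring_subset_pow_span subringE(2)[OF A]] subsetD[OF pow_span_carrier 0(2)] by simp
  next
    case (Suc k)
    then obtain a z where *: "x = a \<otimes> b [^] k \<oplus> z" "a \<in> A" "z \<in> pow_span A b k"
      by (auto simp: pow_span.simps(2))
    have "y \<in> carrier R" "z \<in> carrier R" "a \<in> carrier R"
      using Suc.prems(2) * subringE(1)[OF A] pow_span_carrier by blast+
    then have "x \<otimes> y = a \<otimes> (b [^] k \<otimes> y) \<oplus> z \<otimes> y"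
      unfolding * using b by (simp add: l_distr m_assoc)
    then show ?case using Suc * pow pow_span_smult pow_span_add by simp
  qed
  show "subring ?X R"
  proof (rule subringI)
    show "\<ominus> x \<in> ?X" if x: "x \<in> ?X" for x
    proof -
      have "\<ominus> x = (\<ominus> \<one>) \<otimes> x" using x pow_span_carrier[of "Suc n"] by (simp add: l_minus subset_iff)
      then show ?thesis using pow_span_smult[OF subringE(5)[OF A subringE(3)[OF A]] x] by simp
    qed
    show "x \<otimes> y \<in> ?X" if "x \<in> ?X" "y \<in> ?X" for x y using mult[OF that] .
    show "x \<oplus> y \<in> ?X" if "x \<in> ?X" "y \<in> ?X" for x y using pow_span_add[OF that] .
  qed (rule pow_span_carrier, rule one)
  show "b \<in> ?X" using times[OF one] b by simp
qed

lemma integral_pow_span: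
  assumes "integral_over A R b"
  obtains n where "b [^] Suc n \<in> pow_span A b (Suc n)"
proof -
  obtain l where l: "set l \<subseteq> A" "b [^] length l \<oplus> eval l b = \<zero>"
    using integral_overE[OF A assms b] .
  have e: "eval l b \<in> pow_span A b (length l)" "eval l b \<in> carrier R"
    using pow_span_eval[OF l(1)] pow_span_carrier by auto
  have "b [^] length l = \<ominus> eval l b" using l(2) e b by (simp add: minus_equality)
  also have "\<dots> = (\<ominus> \<one>) \<otimes> eval l b" using e by (simp add: l_minus)
  also have "\<dots> \<in> pow_span A b (length l)"
    using pow_span_smult[OF subringE(5)[OF A subringE(3)[OF A]] e(1)] .
  \<comment> \<open>One more multiplication by \<open>b\<close> makes the exponent a successor even
    when the integral equation has degree zero.\<close>
  finally have "b \<otimes> b [^] length l \<in> pow_span A b (Suc (length l))" by (rule pow_span_times)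
  then show ?thesis using that[of "length l"] b by (simp add: m_comm)
qed

text \<open>One step of Nakayama's lemma: the top generator is removed at the cost of multiplying by an
  element congruent to \<open>1\<close> modulo \<open>a\<close>.\<close>

lemma nakayama_step:
  assumes a: "a \<in> A" and c: "c \<in> A" and B: "subring B R" "b \<in> B"
    and gen: "\<And>y. y \<in> B \<Longrightarrow> \<exists>e\<in>A. \<exists>z\<in>B. y = e \<oplus> a \<otimes> z"
    and span: "\<And>y. y \<in> B \<Longrightarrow> (\<one> \<ominus> a \<otimes> c) \<otimes> y \<in> pow_span A b (Suc (Suc k))"
  shows "\<exists>c'\<in>A. \<forall>y\<in>B. (\<one> \<ominus> a \<otimes> c') \<otimes> y \<in> pow_span A b (Suc k)"
proof -
  note A' = subringE[OF A]
  have sub: "x \<in> carrier R" if "x \<in> A" for x using that A'(1) by blast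
  have subB: "x \<in> carrier R" if "x \<in> B" for x using that subringE(1)[OF B(1)] by blast
  have sp: "\<exists>e z. (\<one> \<ominus> a \<otimes> c) \<otimes> y = e \<otimes> b [^] Suc k \<oplus> z \<and> e \<in> A \<and> z \<in> pow_span A b (Suc k)"
    if "y \<in> B" for y
    using span[OF that] unfolding pow_span.simps(2)[of A b "Suc k"] by blast
  define p where "p = b [^] Suc k"
  have pB: "p \<in> B" unfolding p_def using subring_pow_closed[OF B] .
  \<comment> \<open>The top power satisfies \<open>p = a0 + a y0\<close>. Multiplying by
    \<open>d = 1 - a c\<close> and expanding \<open>d y0 = e p + z\<close> moves
    \<open>a e p\<close> to the left: \<open>(d - a e) p\<close> lies in the span of the lower
    powers.\<close>
  obtain a0 y0 where y0: "a0 \<in> A" "y0 \<in> B" "p = a0 \<oplus> a \<otimes> y0" using gen[OF pB] by blast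
  obtain e z where ez: "(\<one> \<ominus> a \<otimes> c) \<otimes> y0 = e \<otimes> p \<oplus> z" "e \<in> A" "z \<in> pow_span A b (Suc k)"
    using sp[OF y0(2)] unfolding p_def by blast
  define d where "d = \<one> \<ominus> a \<otimes> c"
  have dA: "d \<in> A" unfolding d_def using subring_minus_closed[OF A A'(3) A'(6)[OF a c]] .
  have zR: "z \<in> carrier R" using ez(3) pow_span_carrier by blast
  note carr[simp] = sub[OF a] sub[OF c] sub[OF y0(1)] subB[OF y0(2)] sub[OF ez(2)] zR subB[OF pB] sub[OF dA]
  have dy: "d \<otimes> y0 = e \<otimes> p \<oplus> z" using ez(1) unfolding d_def .
  have "(d \<ominus> a \<otimes> e) \<otimes> p = d \<otimes> (a0 \<oplus> a \<otimes> y0) \<ominus> a \<otimes> (e \<otimes> p)"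
    unfolding y0(3)[symmetric] using carr by algebra
  also have "\<dots> = d \<otimes> a0 \<oplus> a \<otimes> (d \<otimes> y0 \<ominus> e \<otimes> p)" using carr by algebra
  also have "\<dots> = d \<otimes> a0 \<oplus> a \<otimes> ((e \<otimes> p \<oplus> z) \<ominus> e \<otimes> p)" unfolding dy ..
  also have "\<dots> = d \<otimes> a0 \<oplus> a \<otimes> z" using carr by algebra
  finally have 1: "(d \<ominus> a \<otimes> e) \<otimes> p \<in> pow_span A b (Suc k)"
    using pow_span_add[OF subsetD[OF subring_subset_pow_span A'(6)[OF dA y0(1)]] pow_span_smult[OF a ez(3)]]
    by simp
  \<comment> \<open>Chosen so that \<open>1 - a c' = (1 - a c - a e) (1 - a c)\<close>: the second
    factor brings \<open>y\<close> into the larger span, the first removes its top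
    generator.\<close>
  define c' where "c' = c \<oplus> e \<oplus> c \<ominus> a \<otimes> (c \<oplus> e) \<otimes> c"
  have c'A: "c' \<in> A" unfolding c'_def using a c ez(2) A'(6,7) by (intro subring_minus_closed[OF A]) simp_all
  have "(\<one> \<ominus> a \<otimes> c') \<otimes> y \<in> pow_span A b (Suc k)" if y: "y \<in> B" for y
  proof -
    obtain f w where fw: "(\<one> \<ominus> a \<otimes> c) \<otimes> y = f \<otimes> p \<oplus> w" "f \<in> A" "w \<in> pow_span A b (Suc k)"
      using sp[OF y] unfolding p_def by blast
    have wR: "w \<in> carrier R" using fw(3) pow_span_carrier by blast
    note carr'[simp] = wR sub[OF fw(2)] subB[OF y]
    have "(\<one> \<ominus> a \<otimes> c') \<otimes> y = (\<one> \<ominus> a \<otimes> c \<ominus> a \<otimes> e) \<otimes> ((\<one> \<ominus> a \<otimes> c) \<otimes> y)"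
      unfolding c'_def using carr carr' by algebra
    also have "\<dots> = (d \<ominus> a \<otimes> e) \<otimes> (f \<otimes> p \<oplus> w)" unfolding fw(1) d_def ..
    also have "\<dots> = f \<otimes> ((d \<ominus> a \<otimes> e) \<otimes> p) \<oplus> (d \<ominus> a \<otimes> e) \<otimes> w"
      using carr carr' by algebra
    also have "\<dots> \<in> pow_span A b (Suc k)"
      using pow_span_add[OF pow_span_smult[OF fw(2) 1]
          pow_span_smult[OF subring_minus_closed[OF A dA A'(6)[OF a ez(2)]] fw(3)]] .
    finally show ?thesis .
  qed
  then show ?thesis using c'A by blast
qed

end

text \<open>If \<open>a\<close> is outside the conductor, then \<open>A + a B\<close> is a ring
  strictly above \<open>A\<close>, so it equals \<open>B\<close>. As \<open>B\<close> is a finite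
  \<open>A\<close>-module, Nakayama's lemma for \<open>B/A\<close> gives \<open>1 - a c\<close>
  annihilating \<open>B/A\<close>, which is an inverse of \<open>a\<close> modulo the
  conductor.\<close>

lemma minimal_extension_conductor:
  assumes AB: "minimal_extension A B" and int: "\<And>x. x \<in> B \<Longrightarrow> integral_over A R x"
  shows "field_mod A (conductor A B)"
  unfolding field_mod_def
proof
  have A: "subring A R" and B: "subring B R" and sub: "A \<subseteq> B" "A \<noteq> B"
    and min: "\<And>C. subring C R \<Longrightarrow> A \<subseteq> C \<Longrightarrow> C \<subseteq> B \<Longrightarrow> C = A \<or> C = B"
    using AB unfolding minimal_extension_def by auto
  note A' = subringE[OF A] and B' = subringE[OF B]
  fix a assume "a \<in> A - conductor A B"
  then have a: "a \<in> A" "a \<notin> conductor A B" by auto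
  have aR: "a \<in> carrier R" "a \<in> B" using a A'(1) sub by auto
  have BR: "x \<in> carrier R" if "x \<in> B" for x using that B'(1) by blast
  let ?Z = "{a \<otimes> z | z. z \<in> B}"
  have Z: "?Z \<subseteq> carrier R" "\<zero> \<in> ?Z"
    using aR BR B'(2) by (auto intro!: exI[of _ \<zero>])
  have Zadd: "y \<oplus> z \<in> ?Z" if yz: "y \<in> ?Z" "z \<in> ?Z" for y z
  proof -
    obtain u v where "y = a \<otimes> u" "z = a \<otimes> v" "u \<in> B" "v \<in> B" using yz by blast
    then show ?thesis using B'(7) aR BR by (auto simp: r_distr intro!: exI[of _ "u \<oplus> v"])
  qed
  have Zsm: "c \<otimes> z \<in> ?Z" if cz: "c \<in> B" "z \<in> ?Z" for c z
  proof -
    obtain u where "z = a \<otimes> u" "u \<in> B" using cz by blast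
    then show ?thesis using B'(6) aR BR \<open>c \<in> B\<close> by (auto simp: m_lcomm intro!: exI[of _ "c \<otimes> u"])
  qed
  have ZB: "?Z \<subseteq> B" using B'(6) aR by blast
  have Zm: "y \<otimes> z \<in> A <+>\<^bsub>R\<^esub> ?Z" if "y \<in> ?Z" "z \<in> ?Z" for y z
  proof -
    have "y \<otimes> z \<in> ?Z" using Zsm[of y z] ZB that by blast
    moreover have "y \<otimes> z = \<zero> \<oplus> y \<otimes> z" using subsetD[OF Z(1) that(1)] subsetD[OF Z(1) that(2)] by simp
    ultimately show ?thesis unfolding mem_set_add using A'(2) by blast
  qed
  have sum: "subring (A <+>\<^bsub>R\<^esub> ?Z) R" "A \<subseteq> A <+>\<^bsub>R\<^esub> ?Z" "?Z \<subseteq> A <+>\<^bsub>R\<^esub> ?Z"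
    by (rule subring_set_add[OF A Z]; (rule Zadd | rule Zsm[OF subsetD[OF sub(1)]] | rule Zm); assumption)+
  have "A <+>\<^bsub>R\<^esub> ?Z \<subseteq> B"
    using subsetD[OF sub(1)] aR(2) B'(6,7) by (auto simp: mem_set_add)
  moreover have "A <+>\<^bsub>R\<^esub> ?Z \<noteq> A"
  proof
    assume "A <+>\<^bsub>R\<^esub> ?Z = A"
    then have "?Z \<subseteq> A" using sum by simp
    then show False using a unfolding conductor_def by blast
  qed
  ultimately have "A <+>\<^bsub>R\<^esub> ?Z = B" using min sum by blast
  then have gen: "\<exists>e\<in>A. \<exists>z\<in>B. y = e \<oplus> a \<otimes> z" if "y \<in> B" for y
    using that mem_set_add[of y A ?Z] by auto
  obtain b where b: "b \<in> B" "b \<notin> A" using sub by blast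
  then have bR: "b \<in> carrier R" using BR by blast
  obtain n where n: "b [^] Suc n \<in> pow_span A b (Suc n)" using integral_pow_span[OF A bR int[OF b(1)]] .
  have psB: "pow_span A b k \<subseteq> B" for k
    using B'(2,6,7) subring_pow_closed[OF B b(1)] subsetD[OF sub(1)]
    by (induction k) (auto simp: pow_span.simps(2) subset_iff)
  have B_span: "pow_span A b (Suc n) = B"
    using min[OF pow_span_subring(1)[OF A bR n] subring_subset_pow_span[OF A bR] psB]
      pow_span_subring(2)[OF A bR n] b(2) by blast
  \<comment> \<open>After \<open>j\<close> steps, \<open>j\<close> of the generators above
    \<open>b^0\<close> are gone; at \<open>j = n\<close> only the span of \<open>b^0\<close>, which
    is \<open>A\<close>, remains.\<close>
  have "\<exists>c\<in>A. \<forall>y\<in>B. (\<one> \<ominus> a \<otimes> c) \<otimes> y \<in> pow_span A b (Suc (n - j))" if "j \<le> n" for j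
    using that
  proof (induction j)
    case 0
    have "\<one> \<ominus> a \<otimes> \<zero> = \<one>" using aR by (simp add: minus_eq)
    then have "(\<one> \<ominus> a \<otimes> \<zero>) \<otimes> y \<in> pow_span A b (Suc n)" if "y \<in> B" for y
      using that BR B_span by simp
    then show ?case using A'(2) by auto
  next
    case (Suc j)
    then obtain c where c: "c \<in> A" "\<And>y. y \<in> B \<Longrightarrow> (\<one> \<ominus> a \<otimes> c) \<otimes> y \<in> pow_span A b (Suc (n - j))"
      by auto
    have "Suc (n - j) = Suc (Suc (n - Suc j))" using Suc.prems by simp
    with c(2) have span: "\<And>y. y \<in> B \<Longrightarrow> (\<one> \<ominus> a \<otimes> c) \<otimes> y \<in> pow_span A b (Suc (Suc (n - Suc j)))"
      by metis
    show ?case by (rule nakayama_step[OF A bR a(1) c(1) B b(1)]) (erule gen, erule span)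
  qed
  from this[of n] obtain c where c: "c \<in> A" "\<And>y. y \<in> B \<Longrightarrow> (\<one> \<ominus> a \<otimes> c) \<otimes> y \<in> A"
    using pow_span_one[OF A bR] by auto
  then have "\<one> \<ominus> a \<otimes> c \<in> conductor A B"
    using subring_minus_closed[OF A A'(3) A'(6)[OF a(1) c(1)]] unfolding conductor_def by blast
  with c(1) show "\<exists>c\<in>A. \<one> \<ominus> a \<otimes> c \<in> conductor A B" by blast
qed

end

section \<open>Extensions with FCP\<close>

lemma FCP_mono:
  assumes "FCP R S" "subring U S" "R \<subseteq> U"
  shows "FCP U S"
proof -
  have "finite C" if "subset.chain (intermediate_rings U S) C" for C
  proof -
    have "intermediate_rings U S \<subseteq> intermediate_rings R S"
      using \<open>R \<subseteq> U\<close> unfolding intermediate_rings_def by blast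
    then have "subset.chain (intermediate_rings R S) C" using that by (auto simp: subset_chain_def)
    then show ?thesis using assms(1) unfolding FCP_def by blast
  qed
  then show ?thesis using assms unfolding FCP_def ring_extension_def by blast
qed

text \<open>A maximal chain of \<open>F\<close> is finite, so it has a top and a bottom; an element
  of \<open>F\<close> beyond either end would be comparable with the whole chain and hence belong to
  it.\<close>

lemma FCP_extremal:
  assumes "FCP R S" "F \<subseteq> intermediate_rings R S" "F \<noteq> {}"
  shows FCP_maximal: "\<exists>M\<in>F. \<forall>N\<in>F. M \<subseteq> N \<longrightarrow> N = M"
    and FCP_minimal: "\<exists>M\<in>F. \<forall>N\<in>F. N \<subseteq> M \<longrightarrow> N = M"
proof -
  obtain C where C: "subset.maxchain F C" using subset.Hausdorff by blast
  then have ch: "subset.chain F C" by (rule subset.maxchain_imp_chain)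
  then have "subset.chain (intermediate_rings R S) C" using assms(2) by (auto simp: subset_chain_def)
  then have fin: "finite C" using assms(1) unfolding FCP_def by blast
  have CF: "C \<subseteq> F" and lin: "\<And>A B. A \<in> C \<Longrightarrow> B \<in> C \<Longrightarrow> A \<subseteq> B \<or> B \<subseteq> A"
    using ch by (auto simp: subset_chain_def)
  have ext: "N \<in> C" if "N \<in> F" "\<And>A. A \<in> C \<Longrightarrow> A \<subseteq> N \<or> N \<subseteq> A" for N
  proof (rule ccontr)
    assume "N \<notin> C"
    moreover have "subset.chain F (insert N C)" using that CF lin by (auto simp: subset_chain_def)
    ultimately show False using C unfolding subset.maxchain_def by blast
  qed
  have ne: "C \<noteq> {}" using ext assms(3) by blast
  obtain M where M: "M \<in> C" "\<forall>A\<in>C. M \<le> A \<longrightarrow> M = A" using finite_has_maximal[OF fin ne] by blast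
  have "N = M" if "N \<in> F" "M \<subseteq> N" for N
  proof -
    have "A \<subseteq> M" if "A \<in> C" for A using M lin[OF that M(1)] that by blast
    then have "N \<in> C" using ext that by blast
    then show ?thesis using M \<open>M \<subseteq> N\<close> by blast
  qed
  then show "\<exists>M\<in>F. \<forall>N\<in>F. M \<subseteq> N \<longrightarrow> N = M" using M CF by blast
  obtain M where M: "M \<in> C" "\<forall>A\<in>C. A \<le> M \<longrightarrow> M = A" using finite_has_minimal[OF fin ne] by blast
  have "N = M" if "N \<in> F" "N \<subseteq> M" for N
  proof -
    have "M \<subseteq> A" if "A \<in> C" for A using M lin[OF that M(1)] that by blast
    then have "N \<in> C" using ext that by blast
    then show ?thesis using M \<open>N \<subseteq> M\<close> by blast
  qed
  then show "\<exists>M\<in>F. \<forall>N\<in>F. N \<subseteq> M \<longrightarrow> N = M" using M CF by blast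
qed

context cring
begin

text \<open>\<open>A\<close> is chosen as large as possible with its conductor still inside
  \<open>P\<close> on \<open>T\<close>, and \<open>B\<close> is minimal strictly above
  \<open>A\<close>. The defect at \<open>P\<close> is thereby concentrated in the single step from
  \<open>A\<close> to \<open>B\<close>, whose conductor is a maximal ideal of \<open>A\<close> lying
  over \<open>P\<close>.\<close>

lemma critical_minimal_extension:
  assumes T: "subring T R" and int: "\<And>x. x \<in> carrier R \<Longrightarrow> integral_over T R x"
    and FCP: "FCP T R" and P: "primeideal P (R\<lparr>carrier := T\<rparr>)" and cond: "conductor T (carrier R) \<subseteq> P"
  obtains A B Q where "minimal_extension A B" "T \<subseteq> A" "primeideal Q R" "Q \<inter> T = P"
    "Q \<inter> A = conductor A B" "field_mod A (Q \<inter> A)"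
proof -
  note P' = prime_of_subringE[OF T P] and T' = subringE[OF T]
  let ?F = "{A \<in> intermediate_rings T R. conductor A (carrier R) \<inter> T \<subseteq> P}"
  have "T \<in> ?F" using T cond unfolding intermediate_rings_def by blast
  then have "\<exists>A\<in>?F. \<forall>N\<in>?F. A \<subseteq> N \<longrightarrow> N = A" by (intro FCP_maximal[OF FCP]) auto
  then obtain A where AF: "A \<in> ?F" and Amax: "\<forall>N\<in>?F. A \<subseteq> N \<longrightarrow> N = A" by (rule bexE)
  have A: "subring A R" "T \<subseteq> A" and condA: "conductor A (carrier R) \<inter> T \<subseteq> P"
    using AF unfolding intermediate_rings_def by auto
  have AR: "A \<subseteq> carrier R" "A \<noteq> carrier R"
    using subringE(1)[OF A(1)] condA conductor_ideal(3)[OF A(1) carrier_is_subring] P'(2) T'(3) by auto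
  let ?G = "{B \<in> intermediate_rings T R. A \<subset> B}"
  have "carrier R \<in> ?G" using AR carrier_is_subring T'(1) unfolding intermediate_rings_def by blast
  then have "\<exists>B\<in>?G. \<forall>N\<in>?G. N \<subseteq> B \<longrightarrow> N = B" by (intro FCP_minimal[OF FCP]) auto
  then obtain B where BG: "B \<in> ?G" and Bmin: "\<forall>N\<in>?G. N \<subseteq> B \<longrightarrow> N = B" by (rule bexE)
  have B: "subring B R" "A \<subset> B" "T \<subseteq> B" using BG unfolding intermediate_rings_def by auto
  have "C = A \<or> C = B" if "subring C R" "A \<subseteq> C" "C \<subseteq> B" for C
    using Bmin that A(2) unfolding intermediate_rings_def by blast
  then have AB: "minimal_extension A B" unfolding minimal_extension_def using A B by blast
  have "B \<notin> ?F" using Amax B(2) by blast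
  \<comment> \<open>Maximality of \<open>A\<close> makes the conductor of \<open>B\<close> leave
    \<open>P\<close> inside \<open>T\<close>. If \<open>v\<close> carries \<open>B\<close> into
    \<open>A\<close>, then \<open>v \<otimes> u\<close> carries the whole ring into
    \<open>A\<close>, so \<open>v \<otimes> u\<close> and therefore \<open>v\<close> lies in
    \<open>P\<close>.\<close>
  then obtain u where u: "u \<in> conductor B (carrier R)" "u \<in> T" "u \<notin> P"
    using B(1,3) unfolding intermediate_rings_def by blast
  let ?M = "conductor A B"
  have sub: "?M \<inter> T \<subseteq> P"
  proof
    fix v assume v: "v \<in> ?M \<inter> T"
    then have vAB: "v \<in> A" "\<And>b. b \<in> B \<Longrightarrow> v \<otimes> b \<in> A" "v \<in> T" unfolding conductor_def by auto
    have "v \<otimes> u \<in> A" using subringE(6)[OF A(1)] vAB u A(2) by blast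
    moreover have "v \<otimes> u \<otimes> s \<in> A" if "s \<in> carrier R" for s
    proof -
      have "v \<otimes> u \<otimes> s = v \<otimes> (u \<otimes> s)" using that vAB(3) u(2) subsetD[OF T'(1)] m_assoc by simp
      then show ?thesis using vAB(2) u(1) that unfolding conductor_def by simp
    qed
    ultimately have "v \<otimes> u \<in> conductor A (carrier R)" unfolding conductor_def by blast
    then have "v \<otimes> u \<in> P" using condA T'(6)[OF vAB(3) u(2)] by blast
    then show "v \<in> P" using P'(3)[OF vAB(3) u(2)] u(3) by blast
  qed
  have intA: "integral_over A R x" if "x \<in> carrier R" for x
    using integral_over_mono[OF int[OF that] A(2)] .
  have F: "field_mod A ?M"
    using minimal_extension_conductor[OF AB] intA subringE(1)[OF B(1)] by blast
  have "\<one> \<notin> ?M" using conductor_ideal(3)[OF A(1) B(1)] B(2) by blast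
  then have "primeideal ?M (R\<lparr>carrier := A\<rparr>)"
    using field_mod_prime[OF A(1) conductor_ideal(2)[OF A(1) B(1)] _ F] B(2) by blast
  moreover have "{\<zero>} \<inter> A \<subseteq> ?M"
    using ideal_of_subringE(2)[OF A(1) conductor_ideal(2)[OF A(1) B(1)]] B(2) by blast
  ultimately obtain Q where Q: "primeideal Q R" "Q \<inter> A = ?M"
    using lying_over[OF A(1) intA zeroideal] by blast
  \<comment> \<open>\<open>Q \<inter> T\<close> is maximal, which turns its inclusion in
    \<open>P\<close> into an equality.\<close>
  have "field_mod T (Q \<inter> T)" using field_mod_descend[OF T int A Q(1)] F Q(2) by simp
  moreover have QT: "Q \<inter> T \<subseteq> P" using sub Q(2) A(2) by blast
  moreover have "P \<subseteq> Q"
  proof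
    fix p assume p: "p \<in> P"
    note PI = ideal_of_subringE[OF T P'(1)]
    have pT: "p \<in> T" using p PI(1) by blast
    show "p \<in> Q"
    proof (rule ccontr)
      assume "p \<notin> Q"
      then obtain c where c: "c \<in> T" "\<one> \<ominus> p \<otimes> c \<in> P"
        using \<open>field_mod T (Q \<inter> T)\<close> pT QT unfolding field_mod_def by blast
      have carr[simp]: "p \<in> carrier R" "c \<in> carrier R" using pT c T'(1) by auto
      have "\<one> = (\<one> \<ominus> p \<otimes> c) \<oplus> p \<otimes> c" using carr by algebra
      also have "\<dots> \<in> P" using PI(3)[OF c(2) PI(5)[OF c(1) p]] .
      finally show False using P'(2) by blast
    qed
  qed
  ultimately have "Q \<inter> T = P" using ideal_of_subringE(1)[OF T P'(1)] by blast
  then show ?thesis using that AB A(2) Q F by simp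
qed

text \<open>Zero-dimensionality modulo the conductor: the maximal ideal of the critical step
  descends along the integral extension to \<open>P\<close>.\<close>

lemma field_mod_of_conductor:
  assumes T: "subring T R" and int: "\<And>x. x \<in> carrier R \<Longrightarrow> integral_over T R x"
    and FCP: "FCP T R" and P: "primeideal P (R\<lparr>carrier := T\<rparr>)" and cond: "conductor T (carrier R) \<subseteq> P"
  shows "field_mod T P"
proof -
  obtain A B Q where *: "minimal_extension A B" "T \<subseteq> A" "primeideal Q R" "Q \<inter> T = P" "field_mod A (Q \<inter> A)"
    using critical_minimal_extension[OF T int FCP P cond] by blast
  then have "subring A R" unfolding minimal_extension_def by blast
  then show ?thesis using field_mod_descend[OF T int _ *(2,3,5)] *(4) by simp
qed

section \<open>u-closed extensions\<close>

text \<open>Inverting \<open>c\<close> makes the two rings equal, so primes not containing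
  \<open>c\<close> are determined by their contractions.\<close>

lemma prime_contract_inj_off_conductor:
  assumes T: "subring T R" and Q: "primeideal Q R" "primeideal Q' R" "Q \<inter> T \<subseteq> Q'"
    and c: "c \<in> conductor T (carrier R)" "c \<notin> Q'"
  shows "Q \<subseteq> Q'"
proof
  fix s assume s: "s \<in> Q"
  then have sR: "s \<in> carrier R" using idealE(1)[OF primeidealE(1)[OF Q(1)]] by blast
  have cR: "c \<in> carrier R" "c \<otimes> s \<in> T"
    using c(1) sR subringE(1)[OF T] unfolding conductor_def by auto
  then have "c \<otimes> s \<in> Q'" using idealE(4)[OF primeidealE(1)[OF Q(1)] _ s] Q(3) by blast
  then show "s \<in> Q'" using primeidealE(3)[OF Q(2) cR(1) sR] c(2) by blast
qed

text \<open>The elements \<open>x^n (1 - x y)\<close> form a multiplicative set. If it missed the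
  conductor, some prime \<open>Q\<close> over the conductor would avoid it; \<open>Q\<close> is
  maximal and does not contain \<open>x\<close>, so some \<open>1 - x y\<close> lies in
  \<open>Q\<close>, although it belongs to the set.\<close>

lemma pow_regular_mod_conductor:
  assumes T: "subring T R" and int: "\<And>x. x \<in> carrier R \<Longrightarrow> integral_over T R x"
    and FCP: "FCP T R" and x: "x \<in> carrier R"
  obtains n y where "y \<in> carrier R" "x [^] (n::nat) \<otimes> (\<one> \<ominus> x \<otimes> y) \<in> conductor T (carrier R)"
proof -
  let ?C = "conductor T (carrier R)"
  let ?M = "{x [^] n \<otimes> (\<one> \<ominus> x \<otimes> y) | (n::nat) y. y \<in> carrier R}"
  have CI: "ideal ?C R"
    using conductor_ideal(1)[OF T carrier_is_subring subringE(1)[OF T]] by simp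
  have "?C \<inter> ?M \<noteq> {}"
  proof
    assume empty: "?C \<inter> ?M = {}"
    obtain Q where Q: "primeideal Q R" "?C \<subseteq> Q" "Q \<inter> ?M = {}"
    proof (rule exists_prime_avoiding[OF CI, of ?M])
      show "?M \<subseteq> carrier R" using x by auto
      have "\<one> = x [^] (0::nat) \<otimes> (\<one> \<ominus> x \<otimes> \<zero>)" using x by (simp add: minus_eq)
      then show "\<one> \<in> ?M" by blast
      fix a b assume "a \<in> ?M" "b \<in> ?M"
      then obtain n y m z where *: "a = x [^] (n::nat) \<otimes> (\<one> \<ominus> x \<otimes> y)" "b = x [^] (m::nat) \<otimes> (\<one> \<ominus> x \<otimes> z)"
        and yz: "y \<in> carrier R" "z \<in> carrier R" by blast
      define u v where uv: "u = x [^] n" "v = x [^] m"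
      then have uvR: "u \<in> carrier R" "v \<in> carrier R" using x by auto
      \<comment> \<open>The factors \<open>1 - x y\<close> and \<open>1 - x z\<close> multiply to
        \<open>1 - x (y + z - x y z)\<close>.\<close>
      have "a \<otimes> b = (u \<otimes> v) \<otimes> (\<one> \<ominus> x \<otimes> (y \<oplus> z \<ominus> x \<otimes> y \<otimes> z))"
        unfolding * uv[symmetric] using x yz uvR by algebra
      also have "u \<otimes> v = x [^] (n + m)" unfolding uv using x by (simp add: nat_pow_mult)
      finally show "a \<otimes> b \<in> ?M" 
        using x yz by (intro CollectI exI[of _ "n + m"] exI[of _ "y \<oplus> z \<ominus> x \<otimes> y \<otimes> z"]) simp
    qed (use empty that in auto)
    have "?C \<subseteq> Q \<inter> T" using Q(2) unfolding conductor_def by blast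
    then have "field_mod T (Q \<inter> T)"
      using field_mod_of_conductor[OF T int FCP primeideal_contract[OF T Q(1)]] by simp
    then have F: "field_mod (carrier R) Q" using field_mod_ascend[OF T int Q(1)] by simp
    have "x = x [^] (1::nat) \<otimes> (\<one> \<ominus> x \<otimes> \<zero>)" using x by (simp add: minus_eq)
    then have "x \<in> ?M" by blast
    then have "x \<notin> Q" using Q(3) by blast
    then obtain y where y: "y \<in> carrier R" "\<one> \<ominus> x \<otimes> y \<in> Q" using F x unfolding field_mod_def by blast
    have "\<one> \<ominus> x \<otimes> y = x [^] (0::nat) \<otimes> (\<one> \<ominus> x \<otimes> y)" using x y by simp
    then have "\<one> \<ominus> x \<otimes> y \<in> ?M" using y(1) by blast
    then show False using Q(3) y(2) by blast
  qed
  then show ?thesis using that by blast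
qed

text \<open>For \<open>x\<close> in \<open>Q\<close>, a power of \<open>x y\<close> is idempotent
  modulo the conductor; u-closedness places it in \<open>T\<close>, so it passes from
  \<open>Q\<close> to \<open>Q'\<close>. Being a unit for \<open>x^n\<close> modulo the conductor,
  it takes \<open>x^n\<close> into \<open>Q'\<close>.\<close>

theorem u_closed_imp_inj:
  assumes U: "u_closed T R" and int: "\<And>x. x \<in> carrier R \<Longrightarrow> integral_over T R x" and FCP: "FCP T R"
  shows "inj_on (\<lambda>Q. Q \<inter> T) {Q. primeideal Q R}"
proof -
  have T: "subring T R" using U unfolding u_closed_def ring_extension_def by blast
  let ?C = "conductor T (carrier R)"
  have CI: "ideal ?C R"
    using conductor_ideal(1)[OF T carrier_is_subring subringE(1)[OF T]] by simp
  have CT: "?C \<subseteq> T" unfolding conductor_def by blast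
  have "Q \<subseteq> Q'" if Q: "primeideal Q R" "primeideal Q' R" "Q \<inter> T = Q' \<inter> T" for Q Q'
  proof (cases "?C \<subseteq> Q'")
    case False
    then show ?thesis using prime_contract_inj_off_conductor[OF T Q(1,2)] Q(3) by blast
  next
    case True
    show ?thesis
    proof
      fix x assume xQ: "x \<in> Q"
      have QI: "ideal Q R" "ideal Q' R" using Q primeidealE(1) by auto
      have x: "x \<in> carrier R" using xQ idealE(1)[OF QI(1)] by blast
      show "x \<in> Q'"
      proof (rule ccontr)
        assume xQ': "x \<notin> Q'"
        obtain n y where y: "y \<in> carrier R" and xy: "x [^] (n::nat) \<otimes> (\<one> \<ominus> x \<otimes> y) \<in> ?C"
          using pow_regular_mod_conductor[OF T int FCP x] .
        \<comment> \<open>Multiplication by \<open>x \<otimes> y\<close> fixes \<open>x^n\<close>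
          modulo the conductor, hence so does every power of it.\<close>
        have xn: "x [^] n \<ominus> x [^] n \<otimes> (x \<otimes> y) [^] k \<in> ?C" for k :: nat
        proof (induction k)
          case 0
          then show ?case using x y idealE(2)[OF CI] by (simp add: minus_eq r_neg)
        next
          case (Suc k)
          define u v where uv: "u = x [^] n" "v = (x \<otimes> y) [^] k"
          then have uvR: "u \<in> carrier R" "v \<in> carrier R" using x y by auto
          have "u \<ominus> u \<otimes> (v \<otimes> (x \<otimes> y)) = (u \<ominus> u \<otimes> v) \<oplus> v \<otimes> (u \<otimes> (\<one> \<ominus> x \<otimes> y))"
            using uvR x y by algebra
          also have "\<dots> \<in> ?C"
            using idealE(3)[OF CI Suc idealE(4)[OF CI _ xy]] uvR unfolding uv by simp
          finally show ?case unfolding uv by simp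
        qed
        \<comment> \<open>The exponent \<open>Suc n\<close> makes \<open>e\<close> a multiple of
          \<open>x^n\<close>, needed for idempotence, and also of \<open>x\<close> when
          \<open>n = 0\<close>, needed for membership in \<open>Q\<close>.\<close>
        define e where "e = (x \<otimes> y) [^] Suc n"
        define d where "d = (x \<otimes> y) [^] n"
        have d: "d \<in> carrier R" unfolding d_def using x y by simp
        have ed: "e = d \<otimes> (x \<otimes> y)" unfolding e_def d_def by simp
        have e: "e \<in> carrier R" unfolding e_def using x y by simp
        have "e [^] (2::nat) \<ominus> e = \<ominus> ((y [^] n \<otimes> (x \<otimes> y)) \<otimes> (x [^] n \<ominus> x [^] n \<otimes> e))"
        proof -
          define u v where uv: "u = x [^] n" "v = y [^] n"
          then have uvR: "u \<in> carrier R" "v \<in> carrier R" using x y by auto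
          have euv: "e = u \<otimes> v \<otimes> (x \<otimes> y)"
            unfolding ed d_def uv using x y by (simp add: nat_pow_distrib)
          show ?thesis unfolding nat_pow_two[OF e] unfolding uv[symmetric] euv
            using uvR x y by algebra
        qed
        also have "\<dots> \<in> ?C"
          using idealE(6)[OF CI idealE(4)[OF CI _ xn[of "Suc n"]]] x y unfolding e_def by simp
        finally have 1: "e [^] (2::nat) \<ominus> e \<in> ?C" .
        have "e [^] (3::nat) \<ominus> e [^] (2::nat) = e \<otimes> (e [^] (2::nat) \<ominus> e)"
          unfolding nat_pow_two[OF e] nat_pow_three[OF e] using e by algebra
        also have "\<dots> \<in> ?C" using idealE(4)[OF CI e 1] .
        finally have "e [^] (3::nat) \<ominus> e [^] (2::nat) \<in> T" using CT by blast
        then have "e \<in> T" using U e 1 CT unfolding u_closed_def by blast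
        moreover have "e \<in> Q"
        proof -
          have "e = (d \<otimes> y) \<otimes> x" unfolding ed using d x y by algebra
          then show ?thesis using idealE(4)[OF QI(1) _ xQ] d y by simp
        qed
        ultimately have eQ': "e \<in> Q'" using Q(3) by blast
        have "x [^] n \<ominus> x [^] n \<otimes> e \<in> Q'" using xn[of "Suc n"] True unfolding e_def by blast
        then have "(x [^] n \<ominus> x [^] n \<otimes> e) \<oplus> x [^] n \<otimes> e \<in> Q'"
          using idealE(3)[OF QI(2) _ idealE(4)[OF QI(2) _ eQ']] x by simp
        moreover have "(u \<ominus> v) \<oplus> v = u" if "u \<in> carrier R" "v \<in> carrier R" for u v
          using that by algebra
        ultimately have "x [^] n \<in> Q'" using x e by simp
        then show False using prime_pow[OF carrier_is_subring, of Q' x n] Q(2) x xQ' by simp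
      qed
    qed
  qed
  then show ?thesis unfolding inj_on_def by blast
qed

text \<open>The ring \<open>D = W + W b\<close> has the prime \<open>N = M + W b\<close> contracting
  to \<open>M\<close>, with the residue ring of \<open>W\<close> at \<open>M\<close>; lying over
  lifts it to the big ring. The last hypothesis says that all denominators of \<open>b\<close> lie
  in \<open>M\<close>, which keeps \<open>N\<close> from growing on \<open>W\<close>.\<close>

lemma exists_prime_containing_idempotent:
  assumes W: "subring W R" and int: "\<And>x. x \<in> carrier R \<Longrightarrow> integral_over W R x"
    and b: "b \<in> carrier R" and r: "b \<otimes> b \<ominus> b \<in> W" "(b \<otimes> b \<ominus> b) \<otimes> b \<in> W"
    and M: "primeideal M (R\<lparr>carrier := W\<rparr>)" and IM: "\<And>w. w \<in> W \<Longrightarrow> w \<otimes> b \<in> W \<Longrightarrow> w \<in> M"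
  obtains Q where "primeideal Q R" "Q \<inter> W = M" "b \<in> Q"
proof -
  note W' = subringE[OF W] and M' = prime_of_subringE[OF W M]
  note MI = ideal_of_subringE[OF W M'(1)]
  have WR: "w \<in> carrier R" if "w \<in> W" for w using that W'(1) by blast
  have MW: "w \<in> W" if "w \<in> M" for w using that MI(1) by blast
  define r where "r = b \<otimes> b \<ominus> b"
  have rW: "r \<in> W" "r \<otimes> b \<in> W" "r \<in> M" using r IM unfolding r_def by auto
  have rR: "r \<in> carrier R" using rW WR by blast
  have bb: "b \<otimes> b = b \<oplus> r" unfolding r_def using b by algebra
  \<comment> \<open>If \<open>w\<close> and \<open>w b\<close> are in \<open>W\<close>, then
    \<open>(w b) b = w b + w r\<close> is in \<open>W\<close> too, so \<open>w b\<close> is itself a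
    denominator of \<open>b\<close>.\<close>
  have wb: "w \<otimes> b \<in> M" if "w \<in> W" "w \<otimes> b \<in> W" for w
  proof (rule IM[OF that(2)])
    have "w \<otimes> b \<otimes> b = w \<otimes> b \<oplus> w \<otimes> r"
      using WR[OF that(1)] b rR bb by (simp add: m_assoc r_distr)
    then show "w \<otimes> b \<otimes> b \<in> W" using that(2) W'(7) W'(6)[OF that(1) rW(1)] by simp
  qed
  let ?Z = "{w \<otimes> b | w. w \<in> W}"
  have Zadd: "y \<oplus> z \<in> ?Z" if yz: "y \<in> ?Z" "z \<in> ?Z" for y z
  proof -
    obtain u v where uv: "y = u \<otimes> b" "z = v \<otimes> b" "u \<in> W" "v \<in> W" using yz by blast
    then have "y \<oplus> z = (u \<oplus> v) \<otimes> b" using WR b by (simp add: l_distr)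
    then show ?thesis using W'(7)[OF uv(3,4)] by blast
  qed
  have Zsm: "w \<otimes> z \<in> ?Z" if wz: "w \<in> W" "z \<in> ?Z" for w z
  proof -
    obtain u where u: "z = u \<otimes> b" "u \<in> W" using wz by blast
    then have "w \<otimes> z = (w \<otimes> u) \<otimes> b" using WR b wz(1) by (simp add: m_assoc)
    then show ?thesis using W'(6)[OF wz(1) u(2)] by blast
  qed
  have Z: "?Z \<subseteq> carrier R" "\<zero> \<in> ?Z" using WR b W'(2) by (auto intro!: exI[of _ \<zero>])
  have Zm: "y \<otimes> z \<in> W <+>\<^bsub>R\<^esub> ?Z" if yz: "y \<in> ?Z" "z \<in> ?Z" for y z
  proof -
    obtain u v where uv: "y = u \<otimes> b" "z = v \<otimes> b" "u \<in> W" "v \<in> W" using yz by blast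
    have uvR: "u \<in> carrier R" "v \<in> carrier R" using uv WR by auto
    have "y \<otimes> z = u \<otimes> v \<otimes> (b \<otimes> b)"
      unfolding uv using b uvR by algebra
    also have "\<dots> = u \<otimes> v \<otimes> r \<oplus> u \<otimes> v \<otimes> b"
      unfolding bb using b uvR rR by algebra
    finally show ?thesis unfolding mem_set_add using W'(6) uv rW(1) by blast
  qed
  define D where "D = W <+>\<^bsub>R\<^esub> ?Z"
  have D: "subring D R" "W \<subseteq> D" "?Z \<subseteq> D"
    unfolding D_def
    by (rule subring_set_add[OF W Z]; (rule Zadd | rule Zsm | rule Zm); assumption)+
  define N where "N = M <+>\<^bsub>R\<^esub> ?Z"
  have memN: "x \<in> N \<longleftrightarrow> (\<exists>m\<in>M. \<exists>w\<in>W. x = m \<oplus> w \<otimes> b)" for x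
    unfolding N_def mem_set_add by blast
  have memD: "x \<in> D \<longleftrightarrow> (\<exists>v\<in>W. \<exists>w\<in>W. x = v \<oplus> w \<otimes> b)" for x
    unfolding D_def mem_set_add by blast
  \<comment> \<open>The expression \<open>v + w b\<close> is not unique, but two expressions differ
    by an element of \<open>W b\<close> lying in \<open>W\<close>, which is in \<open>M\<close> by
    \<open>wb\<close>; so \<open>v\<close> is well defined modulo \<open>M\<close>.\<close>
  have NW: "v \<in> M" if v: "v \<in> W" "w \<in> W" "v \<oplus> w \<otimes> b \<in> N" for v w
  proof -
    obtain m w' where m: "m \<in> M" "w' \<in> W" "v \<oplus> w \<otimes> b = m \<oplus> w' \<otimes> b" using v(3) unfolding memN by blast
    have R: "v \<in> carrier R" "w \<in> carrier R" "m \<in> carrier R" "w' \<in> carrier R" using v m WR MW by auto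
    have "(w' \<ominus> w) \<otimes> b = (m \<oplus> w' \<otimes> b) \<ominus> m \<ominus> w \<otimes> b"
      using R b by algebra
    also have "\<dots> = v \<ominus> m" unfolding m(3)[symmetric] using R b by algebra
    finally have *: "(w' \<ominus> w) \<otimes> b = v \<ominus> m" .
    then have "(w' \<ominus> w) \<otimes> b \<in> W" using subring_minus_closed[OF W v(1) MW[OF m(1)]] by simp
    then have "v \<ominus> m \<in> M" using wb[OF subring_minus_closed[OF W m(2) v(2)]] * by simp
    then have "(v \<ominus> m) \<oplus> m \<in> M" using MI(3) m(1) by simp
    moreover have "(v \<ominus> m) \<oplus> m = v" using R by algebra
    ultimately show ?thesis by simp
  qed
  have NI: "ideal N (R\<lparr>carrier := D\<rparr>)"
  proof (rule ideal_of_subringI[OF D(1)])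
    show "N \<subseteq> D" unfolding subset_iff memN memD using MW by blast
    have "\<zero> = \<zero> \<oplus> \<zero> \<otimes> b" using b by simp
    then show "\<zero> \<in> N" unfolding memN using MI(2) W'(2) by blast
  next
    fix x y assume "x \<in> N" "y \<in> N"
    then obtain m w n v where *: "x = m \<oplus> w \<otimes> b" "y = n \<oplus> v \<otimes> b" "m \<in> M" "n \<in> M" "w \<in> W" "v \<in> W"
      unfolding memN by blast
    have "m \<in> carrier R" "n \<in> carrier R" "w \<in> carrier R" "v \<in> carrier R" using * WR MW by auto
    then have "x \<oplus> y = (m \<oplus> n) \<oplus> (w \<oplus> v) \<otimes> b" unfolding * using b by algebra
    then show "x \<oplus> y \<in> N" unfolding memN using MI(3)[OF *(3,4)] W'(7)[OF *(5,6)] by blast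
  next
    fix x y assume "y \<in> D" "x \<in> N"
    then obtain m w n v where *: "x = m \<oplus> w \<otimes> b" "y = n \<oplus> v \<otimes> b" "m \<in> M" "n \<in> W" "w \<in> W" "v \<in> W"
      unfolding memN memD by blast
    have R: "m \<in> carrier R" "n \<in> carrier R" "w \<in> carrier R" "v \<in> carrier R" using * WR MW by auto
    have "y \<otimes> x = n \<otimes> m \<oplus> (n \<otimes> w \<oplus> v \<otimes> m) \<otimes> b \<oplus> v \<otimes> w \<otimes> (b \<otimes> b)"
      unfolding * using R b by algebra
    also have "\<dots> = (n \<otimes> m \<oplus> v \<otimes> w \<otimes> r) \<oplus> (n \<otimes> w \<oplus> v \<otimes> m \<oplus> v \<otimes> w) \<otimes> b"
      unfolding bb using R b rR by algebra
    finally have "y \<otimes> x = (n \<otimes> m \<oplus> v \<otimes> w \<otimes> r) \<oplus> (n \<otimes> w \<oplus> v \<otimes> m \<oplus> v \<otimes> w) \<otimes> b" .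
    moreover have "n \<otimes> m \<oplus> v \<otimes> w \<otimes> r \<in> M" using * MI(3,4) W'(6) rW(3) by simp
    moreover have "n \<otimes> w \<oplus> v \<otimes> m \<oplus> v \<otimes> w \<in> W" using * W'(6,7) MW by simp
    ultimately show "y \<otimes> x \<in> N" unfolding memN by blast
  qed
  have "primeideal N (R\<lparr>carrier := D\<rparr>)"
  proof (rule prime_of_subringI[OF D(1) NI])
    have "\<one> = \<one> \<oplus> \<zero> \<otimes> b" using b by simp
    then show "\<one> \<notin> N" using NW[OF W'(3) W'(2)] M'(2) by auto
    fix x y assume "x \<in> D" "y \<in> D" and xy: "x \<otimes> y \<in> N"
    then obtain m w n v where *: "x = m \<oplus> w \<otimes> b" "y = n \<oplus> v \<otimes> b" "m \<in> W" "n \<in> W" "w \<in> W" "v \<in> W"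
      unfolding memD by blast
    have R: "m \<in> carrier R" "n \<in> carrier R" "w \<in> carrier R" "v \<in> carrier R" using * WR by auto
    have "x \<otimes> y = m \<otimes> n \<oplus> (m \<otimes> v \<oplus> w \<otimes> n) \<otimes> b \<oplus> w \<otimes> v \<otimes> (b \<otimes> b)"
      unfolding * using R b by algebra
    also have "\<dots> = (m \<otimes> n \<oplus> w \<otimes> v \<otimes> r) \<oplus> (m \<otimes> v \<oplus> w \<otimes> n \<oplus> w \<otimes> v) \<otimes> b"
      unfolding bb using R b rR by algebra
    \<comment> \<open>Modulo \<open>N\<close> only the coefficient outside \<open>b\<close> counts,
      and its extra term with \<open>r\<close> lies in \<open>M\<close>; primality of
      \<open>N\<close> thus reduces to that of \<open>M\<close>.\<close>
    finally have e: "x \<otimes> y = (m \<otimes> n \<oplus> w \<otimes> v \<otimes> r) \<oplus> (m \<otimes> v \<oplus> w \<otimes> n \<oplus> w \<otimes> v) \<otimes> b" .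
    have "m \<otimes> n \<oplus> w \<otimes> v \<otimes> r \<in> W" "m \<otimes> v \<oplus> w \<otimes> n \<oplus> w \<otimes> v \<in> W" using * W'(6,7) rW(1) by simp_all
    then have "m \<otimes> n \<oplus> w \<otimes> v \<otimes> r \<in> M" using NW xy unfolding e by blast
    moreover have "w \<otimes> v \<otimes> r \<in> M" using MI(4) W'(6) * rW(3) by simp
    ultimately have "(m \<otimes> n \<oplus> w \<otimes> v \<otimes> r) \<ominus> w \<otimes> v \<otimes> r \<in> M" by (rule MI(7))
    moreover have "(m \<otimes> n \<oplus> w \<otimes> v \<otimes> r) \<ominus> w \<otimes> v \<otimes> r = m \<otimes> n"
      using R rR by algebra
    ultimately have "m \<in> M \<or> n \<in> M" using M'(3)[OF *(3,4)] by simp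
    then show "x \<in> N \<or> y \<in> N" unfolding memN using * by blast
  qed
  moreover have "{\<zero>} \<inter> D \<subseteq> N" using ideal_of_subringE(2)[OF D(1) NI] by blast
  moreover have "integral_over D R x" if "x \<in> carrier R" for x
    using integral_over_mono[OF int[OF that] D(2)] .
  ultimately obtain Q where Q: "primeideal Q R" "Q \<inter> D = N"
    using lying_over[OF D(1) _ zeroideal] by blast
  have "Q \<inter> W = M"
  proof
    show "Q \<inter> W \<subseteq> M"
    proof
      fix v assume v: "v \<in> Q \<inter> W"
      then have "v \<in> N" using Q(2) D(2) by blast
      moreover have "v = v \<oplus> \<zero> \<otimes> b" using v WR b by simp
      ultimately show "v \<in> M" using NW[of v \<zero>] v W'(2) by simp
    qed
    show "M \<subseteq> Q \<inter> W"
    proof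
      fix m assume m: "m \<in> M"
      moreover have "m = m \<oplus> \<zero> \<otimes> b" using m WR[OF MW] b by simp
      ultimately have "m \<in> N" unfolding memN using W'(2) by blast
      then show "m \<in> Q \<inter> W" using Q(2) MW[OF m] by blast
    qed
  qed
  moreover have "b \<in> Q"
  proof -
    have "b = \<zero> \<oplus> \<one> \<otimes> b" using b by simp
    then have "b \<in> N" unfolding memN using MI(2) W'(3) by blast
    then show ?thesis using Q(2) by blast
  qed
  ultimately show ?thesis using that Q(1) by blast
qed

text \<open>The denominators of a bad \<open>b\<close> form a proper ideal, contained in a prime
  \<open>M\<close> of \<open>W\<close>. Over \<open>M\<close> there is a prime through
  \<open>b\<close> and one through \<open>1 - b\<close>; injectivity would make them equal, and then
  they would contain \<open>1\<close>.\<close>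

theorem inj_imp_u_closed:
  assumes W: "subring W R" and int: "\<And>x. x \<in> carrier R \<Longrightarrow> integral_over W R x"
    and inj: "inj_on (\<lambda>Q. Q \<inter> W) {Q. primeideal Q R}"
  shows "u_closed W R"
  unfolding u_closed_def
proof (intro conjI ballI impI)
  show "ring_extension W R" using W is_cring unfolding ring_extension_def by blast
  note W' = subringE[OF W]
  have WR: "w \<in> carrier R" if "w \<in> W" for w using that W'(1) by blast
  fix b assume b: "b \<in> carrier R"
    and "b [^] (2::nat) \<ominus> b \<in> W \<and> b [^] (3::nat) \<ominus> b [^] (2::nat) \<in> W"
  moreover have "b [^] (2::nat) \<ominus> b = b \<otimes> b \<ominus> b" "b [^] (3::nat) \<ominus> b [^] (2::nat) = (b \<otimes> b \<ominus> b) \<otimes> b"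
    unfolding nat_pow_two[OF b] nat_pow_three[OF b] using b by algebra+
  ultimately have r: "b \<otimes> b \<ominus> b \<in> W" "(b \<otimes> b \<ominus> b) \<otimes> b \<in> W" by simp_all
  show "b \<in> W"
  proof (rule ccontr)
    assume "b \<notin> W"
    let ?I = "{w \<in> W. w \<otimes> b \<in> W}"
    interpret W: cring "R\<lparr>carrier := W\<rparr>" by (rule subring_cring[OF W])
    have "ideal ?I (R\<lparr>carrier := W\<rparr>)"
    proof (rule ideal_of_subringI[OF W])
      show "\<zero> \<in> ?I" using W'(2) b by simp
      show "x \<oplus> y \<in> ?I" if "x \<in> ?I" "y \<in> ?I" for x y
        using that W'(7) WR b by (simp add: l_distr)
      show "w \<otimes> x \<in> ?I" if "w \<in> W" "x \<in> ?I" for w x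
        using that W'(6) WR b by (simp add: m_assoc)
    qed blast
    moreover have "\<one> \<notin> ?I" using b \<open>b \<notin> W\<close> by simp
    ultimately obtain M where M: "primeideal M (R\<lparr>carrier := W\<rparr>)" "?I \<subseteq> M"
      using W.exists_prime_superideal[of ?I] by auto
    obtain Q where Q: "primeideal Q R" "Q \<inter> W = M" "b \<in> Q"
      using exists_prime_containing_idempotent[OF W int b r M(1)] M(2) by blast
    \<comment> \<open>\<open>1 - b\<close> has the same denominators as \<open>b\<close> and
      satisfies the same two relations over \<open>W\<close>.\<close>
    let ?c = "\<one> \<ominus> b"
    have "?c \<otimes> ?c \<ominus> ?c = b \<otimes> b \<ominus> b" "(?c \<otimes> ?c \<ominus> ?c) \<otimes> ?c = (b \<otimes> b \<ominus> b) \<ominus> (b \<otimes> b \<ominus> b) \<otimes> b"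
      using b by algebra+
    then have c: "?c \<otimes> ?c \<ominus> ?c \<in> W" "(?c \<otimes> ?c \<ominus> ?c) \<otimes> ?c \<in> W"
      using r subring_minus_closed[OF W r] by simp_all
    have "w \<in> M" if w: "w \<in> W" "w \<otimes> ?c \<in> W" for w
    proof -
      have "w \<otimes> b = w \<ominus> w \<otimes> ?c" using WR[OF w(1)] b by algebra
      then have "w \<otimes> b \<in> W" using subring_minus_closed[OF W w] by simp
      then show ?thesis using w(1) M(2) by blast
    qed
    then obtain Q' where Q': "primeideal Q' R" "Q' \<inter> W = M" "?c \<in> Q'"
      using exists_prime_containing_idempotent[OF W int _ c M(1)] b by blast
    have "Q = Q'" using inj_onD[OF inj, of Q Q'] Q Q' by simp
    then have "b \<oplus> ?c \<in> Q" using idealE(3)[OF primeidealE(1)[OF Q(1)] Q(3)] Q'(3) by simp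
    moreover have "b \<oplus> ?c = \<one>" using b by algebra
    ultimately show False using primeidealE(2)[OF Q(1)] by simp
  qed
qed

end

section \<open>Residue fields\<close>

context domain
begin

section \<open>Arithmetic of fractions over a domain\<close>

lemma fraction_eq_iff:
  assumes ab: "a \<in> carrier R" "b \<in> carrier R" and st: "s \<in> carrier R - {\<zero>}" "t \<in> carrier R - {\<zero>}"
  shows "fraction R a s = fraction R b t \<longleftrightarrow> a \<otimes> t = b \<otimes> s"
proof
  assume "fraction R a s = fraction R b t"
  moreover have "(b, t) \<in> fraction R b t" using assms unfolding fraction_def by simp
  ultimately show "a \<otimes> t = b \<otimes> s" unfolding fraction_def by blast
next
  have *: "fraction R a s \<subseteq> fraction R b t" if eq: "a \<otimes> t = b \<otimes> s"
    and ab: "a \<in> carrier R" "b \<in> carrier R" and st: "s \<in> carrier R - {\<zero>}" "t \<in> carrier R - {\<zero>}" for a b s t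
  proof
    fix p assume "p \<in> fraction R a s"
    then obtain c v where p: "p = (c, v)" and c: "c \<in> carrier R" and v: "v \<in> carrier R - {\<zero>}" and av: "a \<otimes> v = c \<otimes> s"
      unfolding fraction_def by blast
    have R: "v \<in> carrier R" "s \<in> carrier R" "t \<in> carrier R" "s \<noteq> \<zero>" using v st by auto
    have "s \<otimes> (b \<otimes> v) = (b \<otimes> s) \<otimes> v" using R c ab by (simp add: m_ac)
    also have "\<dots> = t \<otimes> (a \<otimes> v)" unfolding eq[symmetric] using R c ab by (simp add: m_ac)
    also have "\<dots> = s \<otimes> (c \<otimes> t)" unfolding av using R c ab by (simp add: m_ac)
    finally have "b \<otimes> v = c \<otimes> t" using R c ab m_lcancel[of s "b \<otimes> v" "c \<otimes> t"] by simp
    then show "p \<in> fraction R b t" unfolding p fraction_def using c v by simp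
  qed
  assume "a \<otimes> t = b \<otimes> s"
  then show "fraction R a s = fraction R b t" using *[of a t b s] *[of b s a t] ab st by auto
qed

text \<open>Evaluates the unions over representatives on a single representative, once the value is
  shown not to depend on the choice.\<close>

lemma UN_fraction:
  assumes "a \<in> carrier R" "s \<in> carrier R - {\<zero>}"
    and eq: "\<And>b t. b \<in> carrier R \<Longrightarrow> t \<in> carrier R - {\<zero>} \<Longrightarrow> a \<otimes> t = b \<otimes> s \<Longrightarrow> h b t = h a s"
  shows "(\<Union>(b, t)\<in>fraction R a s. h b t) = h a s"
proof -
  have "(a, s) \<in> fraction R a s" using assms(1,2) unfolding fraction_def by simp
  moreover have "(case p of (b, t) \<Rightarrow> h b t) = h a s" if "p \<in> fraction R a s" for p
    using that eq unfolding fraction_def by auto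
  ultimately show ?thesis by blast
qed

lemma fraction_field_carrier:
  "F \<in> carrier (fraction_field R) \<longleftrightarrow>
     (\<exists>a\<in>carrier R. \<exists>s\<in>carrier R - {\<zero>}. F = fraction R a s)"
  unfolding fraction_field_def by auto

lemma fraction_mult:
  assumes a: "a \<in> carrier R" and s: "s \<in> carrier R - {\<zero>}" and b: "b \<in> carrier R" and t: "t \<in> carrier R - {\<zero>}"
  shows "fraction R a s \<otimes>\<^bsub>fraction_field R\<^esub> fraction R b t = fraction R (a \<otimes> b) (s \<otimes> t)"
proof -
  have nz: "x \<otimes> y \<in> carrier R - {\<zero>}" if "x \<in> carrier R - {\<zero>}" "y \<in> carrier R - {\<zero>}" for x y
    using that by (auto simp: integral_iff)
  have R: "s \<in> carrier R" "t \<in> carrier R" using s t by auto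
  \<comment> \<open>The inner union gets a name so that independence of representatives is proved
    for one argument at a time.\<close>
  define H where "H a' s' = (\<Union>(b', t')\<in>fraction R b t. fraction R (a' \<otimes> b') (s' \<otimes> t'))" for a' s'
  have H: "H a' s' = fraction R (a' \<otimes> b) (s' \<otimes> t)"
    if a': "a' \<in> carrier R" "s' \<in> carrier R - {\<zero>}" for a' s'
    unfolding H_def
  proof (rule UN_fraction[OF b t])
    fix b' t' assume b': "b' \<in> carrier R" "t' \<in> carrier R - {\<zero>}" and eq: "b \<otimes> t' = b' \<otimes> t"
    have R': "s' \<in> carrier R" "t' \<in> carrier R" using a' b' by auto
    have "(a' \<otimes> b') \<otimes> (s' \<otimes> t) = a' \<otimes> s' \<otimes> (b' \<otimes> t)" using a'(1) b'(1) R R' by (simp add: m_ac)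
    also have "\<dots> = (a' \<otimes> b) \<otimes> (s' \<otimes> t')" unfolding eq[symmetric] using a'(1) b R R' by (simp add: m_ac)
    finally show "fraction R (a' \<otimes> b') (s' \<otimes> t') = fraction R (a' \<otimes> b) (s' \<otimes> t)"
      using a'(1) b'(1) b nz[OF a'(2) b'(2)] nz[OF a'(2) t] by (subst fraction_eq_iff) auto
  qed
  have "(\<Union>(a', s')\<in>fraction R a s. H a' s') = H a s"
  proof (rule UN_fraction[OF a s])
    fix a' s' assume a': "a' \<in> carrier R" "s' \<in> carrier R - {\<zero>}" and eq: "a \<otimes> s' = a' \<otimes> s"
    have R': "s' \<in> carrier R" using a' by auto
    have "(a' \<otimes> b) \<otimes> (s \<otimes> t) = b \<otimes> t \<otimes> (a' \<otimes> s)" using a'(1) b R R' by (simp add: m_ac)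
    also have "\<dots> = (a \<otimes> b) \<otimes> (s' \<otimes> t)" unfolding eq[symmetric] using a b R R' by (simp add: m_ac)
    finally show "H a' s' = H a s"
      unfolding H[OF a'] H[OF a s] using a'(1) a b nz[OF a'(2) t] nz[OF s t] by (subst fraction_eq_iff) auto
  qed
  then show ?thesis unfolding H[OF a s] unfolding fraction_field_def H_def by simp
qed

lemma fraction_add:
  assumes a: "a \<in> carrier R" and s: "s \<in> carrier R - {\<zero>}" and b: "b \<in> carrier R" and t: "t \<in> carrier R - {\<zero>}"
  shows "fraction R a s \<oplus>\<^bsub>fraction_field R\<^esub> fraction R b t = fraction R (a \<otimes> t \<oplus> b \<otimes> s) (s \<otimes> t)"
proof -
  have nz: "x \<otimes> y \<in> carrier R - {\<zero>}" if "x \<in> carrier R - {\<zero>}" "y \<in> carrier R - {\<zero>}" for x y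
    using that by (auto simp: integral_iff)
  have R: "s \<in> carrier R" "t \<in> carrier R" using s t by auto
  define H where "H a' s' = (\<Union>(b', t')\<in>fraction R b t. fraction R (a' \<otimes> t' \<oplus> b' \<otimes> s') (s' \<otimes> t'))" for a' s'
  have H: "H a' s' = fraction R (a' \<otimes> t \<oplus> b \<otimes> s') (s' \<otimes> t)"
    if a': "a' \<in> carrier R" "s' \<in> carrier R - {\<zero>}" for a' s'
    unfolding H_def
  proof (rule UN_fraction[OF b t])
    fix b' t' assume b': "b' \<in> carrier R" "t' \<in> carrier R - {\<zero>}" and eq: "b \<otimes> t' = b' \<otimes> t"
    have R': "s' \<in> carrier R" "t' \<in> carrier R" using a' b' by auto
    have "(a' \<otimes> t' \<oplus> b' \<otimes> s') \<otimes> (s' \<otimes> t) = a' \<otimes> t' \<otimes> s' \<otimes> t \<oplus> s' \<otimes> s' \<otimes> (b' \<otimes> t)"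
      using a'(1) b'(1) R R' by algebra
    also have "\<dots> = (a' \<otimes> t \<oplus> b \<otimes> s') \<otimes> (s' \<otimes> t')"
      unfolding eq[symmetric] using a'(1) b R R' by algebra
    finally show "fraction R (a' \<otimes> t' \<oplus> b' \<otimes> s') (s' \<otimes> t') = fraction R (a' \<otimes> t \<oplus> b \<otimes> s') (s' \<otimes> t)"
      using a'(1) b'(1) b R R' nz[OF a'(2) b'(2)] nz[OF a'(2) t] by (subst fraction_eq_iff) auto
  qed
  have "(\<Union>(a', s')\<in>fraction R a s. H a' s') = H a s"
  proof (rule UN_fraction[OF a s])
    fix a' s' assume a': "a' \<in> carrier R" "s' \<in> carrier R - {\<zero>}" and eq: "a \<otimes> s' = a' \<otimes> s"
    have R': "s' \<in> carrier R" using a' by auto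
    have "(a' \<otimes> t \<oplus> b \<otimes> s') \<otimes> (s \<otimes> t) = t \<otimes> t \<otimes> (a' \<otimes> s) \<oplus> b \<otimes> s' \<otimes> s \<otimes> t"
      using a'(1) b R R' by algebra
    also have "\<dots> = (a \<otimes> t \<oplus> b \<otimes> s) \<otimes> (s' \<otimes> t)"
      unfolding eq[symmetric] using a b R R' by algebra
    finally show "H a' s' = H a s"
      unfolding H[OF a'] H[OF a s] using a'(1) a b R R' nz[OF a'(2) t] nz[OF s t] by (subst fraction_eq_iff) auto
  qed
  then show ?thesis unfolding H[OF a s] unfolding fraction_field_def H_def by simp
qed

end

text \<open>The induced map is always an injective homomorphism, so only surjectivity is at stake.
  It may be tested on the fractions \<open>e / 1\<close>, whose preimages \<open>a / s\<close> are
  exactly solutions of \<open>f s * e = f a\<close>.\<close>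

lemma fraction_field_iso_iff:
  assumes "domain D" "domain E" and f: "f \<in> ring_hom D E" and inj: "inj_on f (carrier D)"
  defines "g \<equiv> \<lambda>F. \<Union>(a, s)\<in>F. fraction E (f a) (f s)"
  shows "g \<in> ring_iso (fraction_field D) (fraction_field E) \<longleftrightarrow>
    (\<forall>e\<in>carrier E. \<exists>a\<in>carrier D. \<exists>s\<in>carrier D - {\<zero>\<^bsub>D\<^esub>}. f s \<otimes>\<^bsub>E\<^esub> e = f a)"
proof -
  interpret D: domain D by fact
  interpret E: domain E by fact
  interpret f: ring_hom_ring D E f using f by unfold_locales
  have f0: "f x \<in> carrier E - {\<zero>\<^bsub>E\<^esub>}" if "x \<in> carrier D - {\<zero>\<^bsub>D\<^esub>}" for x
    using that inj_onD[OF inj, of x "\<zero>\<^bsub>D\<^esub>"] by auto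
  have g: "g (fraction D a s) = fraction E (f a) (f s)"
    if as: "a \<in> carrier D" "s \<in> carrier D - {\<zero>\<^bsub>D\<^esub>}" for a s
    unfolding g_def
  proof (rule D.UN_fraction[OF as])
    fix b t assume b: "b \<in> carrier D" "t \<in> carrier D - {\<zero>\<^bsub>D\<^esub>}" and eq: "a \<otimes>\<^bsub>D\<^esub> t = b \<otimes>\<^bsub>D\<^esub> s"
    have "f (a \<otimes>\<^bsub>D\<^esub> t) = f (b \<otimes>\<^bsub>D\<^esub> s)" unfolding eq ..
    then show "fraction E (f b) (f t) = fraction E (f a) (f s)"
      using as b f0[OF as(2)] f0[OF b(2)] by (subst E.fraction_eq_iff) auto
  qed
  have hom: "g \<in> ring_hom (fraction_field D) (fraction_field E)"
  proof (rule ring_hom_memI)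
    show "g F \<in> carrier (fraction_field E)" if F: "F \<in> carrier (fraction_field D)" for F
    proof -
      obtain a s where as: "a \<in> carrier D" "s \<in> carrier D - {\<zero>\<^bsub>D\<^esub>}" "F = fraction D a s"
        using F unfolding D.fraction_field_carrier by blast
      then show ?thesis
        unfolding E.fraction_field_carrier using g[OF as(1,2)] f0[OF as(2)] f.hom_closed[OF as(1)] by blast
    qed
    show "g \<one>\<^bsub>fraction_field D\<^esub> = \<one>\<^bsub>fraction_field E\<^esub>"
      using g[of "\<one>\<^bsub>D\<^esub>" "\<one>\<^bsub>D\<^esub>"] unfolding fraction_field_def by simp
  next
    fix F G assume "F \<in> carrier (fraction_field D)" "G \<in> carrier (fraction_field D)"
    then obtain a s b t where *: "a \<in> carrier D" "s \<in> carrier D - {\<zero>\<^bsub>D\<^esub>}" "F = fraction D a s"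
      "b \<in> carrier D" "t \<in> carrier D - {\<zero>\<^bsub>D\<^esub>}" "G = fraction D b t"
      unfolding D.fraction_field_carrier by blast
    have st: "s \<in> carrier D" "t \<in> carrier D" using * by auto
    have nz: "s \<otimes>\<^bsub>D\<^esub> t \<in> carrier D - {\<zero>\<^bsub>D\<^esub>}" using * by (auto simp: D.integral_iff)
    show "g (F \<otimes>\<^bsub>fraction_field D\<^esub> G) = g F \<otimes>\<^bsub>fraction_field E\<^esub> g G"
      unfolding * D.fraction_mult[OF *(1,2,4,5)] g[OF *(1,2)] g[OF *(4,5)]
      using g[OF D.m_closed[OF *(1,4)] nz] E.fraction_mult[OF _ f0[OF *(2)] _ f0[OF *(5)], of "f a" "f b"] *(1,4) st
      by simp
    show "g (F \<oplus>\<^bsub>fraction_field D\<^esub> G) = g F \<oplus>\<^bsub>fraction_field E\<^esub> g G"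
      unfolding * D.fraction_add[OF *(1,2,4,5)] g[OF *(1,2)] g[OF *(4,5)]
      using g[OF D.a_closed[OF D.m_closed[OF *(1) st(2)] D.m_closed[OF *(4) st(1)]] nz]
        E.fraction_add[OF _ f0[OF *(2)] _ f0[OF *(5)], of "f a" "f b"] *(1,4) st
      by simp
  qed
  have inj_g: "inj_on g (carrier (fraction_field D))"
  proof
    fix F G assume "F \<in> carrier (fraction_field D)" "G \<in> carrier (fraction_field D)" and gFG: "g F = g G"
    then obtain a s b t where *: "a \<in> carrier D" "s \<in> carrier D - {\<zero>\<^bsub>D\<^esub>}" "F = fraction D a s"
      "b \<in> carrier D" "t \<in> carrier D - {\<zero>\<^bsub>D\<^esub>}" "G = fraction D b t"
      unfolding D.fraction_field_carrier by blast
    have st: "s \<in> carrier D" "t \<in> carrier D" using * by auto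
    have "f a \<otimes>\<^bsub>E\<^esub> f t = f b \<otimes>\<^bsub>E\<^esub> f s"
      using gFG E.fraction_eq_iff[OF _ _ f0[OF *(2)] f0[OF *(5)], of "f a" "f b"] *(1,4)
      unfolding * g[OF *(1,2)] g[OF *(4,5)] by simp
    then have "f (a \<otimes>\<^bsub>D\<^esub> t) = f (b \<otimes>\<^bsub>D\<^esub> s)" using * st by simp
    then have "a \<otimes>\<^bsub>D\<^esub> t = b \<otimes>\<^bsub>D\<^esub> s" using inj_onD[OF inj] * st by simp
    then show "F = G" unfolding * using D.fraction_eq_iff[OF *(1,4,2,5)] by simp
  qed
  have img: "g ` carrier (fraction_field D) \<subseteq> carrier (fraction_field E)"
    using ring_hom_closed[OF hom] by blast
  have "carrier (fraction_field E) \<subseteq> g ` carrier (fraction_field D) \<longleftrightarrow>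
    (\<forall>e\<in>carrier E. \<exists>a\<in>carrier D. \<exists>s\<in>carrier D - {\<zero>\<^bsub>D\<^esub>}. f s \<otimes>\<^bsub>E\<^esub> e = f a)" (is "?L \<longleftrightarrow> ?R")
  proof
    assume L: ?L
    show ?R
    proof
      fix e assume e: "e \<in> carrier E"
      have "fraction E e \<one>\<^bsub>E\<^esub> \<in> carrier (fraction_field E)"
        unfolding E.fraction_field_carrier using e by force
      then have "fraction E e \<one>\<^bsub>E\<^esub> \<in> g ` carrier (fraction_field D)" using L by blast
      then obtain F where F: "F \<in> carrier (fraction_field D)" "fraction E e \<one>\<^bsub>E\<^esub> = g F" by blast
      then obtain a s where as: "a \<in> carrier D" "s \<in> carrier D - {\<zero>\<^bsub>D\<^esub>}" "F = fraction D a s"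
        unfolding D.fraction_field_carrier by blast
      then have "e \<otimes>\<^bsub>E\<^esub> f s = f a"
        using E.fraction_eq_iff[OF e _ _ f0[OF as(2)], of "f a" "\<one>\<^bsub>E\<^esub>"] g[OF as(1,2)] F(2) by simp
      then show "\<exists>a\<in>carrier D. \<exists>s\<in>carrier D - {\<zero>\<^bsub>D\<^esub>}. f s \<otimes>\<^bsub>E\<^esub> e = f a"
        using as(1,2) E.m_comm[OF e, of "f s"] f0[OF as(2)] by (metis Diff_iff)
    qed
  next
    assume R: ?R
    show ?L
    proof
      fix F assume "F \<in> carrier (fraction_field E)"
      then obtain e t where F: "e \<in> carrier E" "t \<in> carrier E - {\<zero>\<^bsub>E\<^esub>}" "F = fraction E e t"
        unfolding E.fraction_field_carrier by blast
      have t: "t \<in> carrier E" "t \<noteq> \<zero>\<^bsub>E\<^esub>" using F by auto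
      obtain a s where as: "a \<in> carrier D" "s \<in> carrier D - {\<zero>\<^bsub>D\<^esub>}" "f s \<otimes>\<^bsub>E\<^esub> e = f a" using R F(1) by blast
      \<comment> \<open>The denominator \<open>t\<close> gets a preimage \<open>b / v\<close> of its
        own; as \<open>b\<close> is nonzero, \<open>e / t\<close> comes from
        \<open>(a v) / (s b)\<close>.\<close>
      obtain b v where bv: "b \<in> carrier D" "v \<in> carrier D - {\<zero>\<^bsub>D\<^esub>}" "f v \<otimes>\<^bsub>E\<^esub> t = f b" using R t(1) by blast
      have "f v \<otimes>\<^bsub>E\<^esub> t \<noteq> \<zero>\<^bsub>E\<^esub>" using f0[OF bv(2)] t by (auto simp: E.integral_iff)
      then have "b \<noteq> \<zero>\<^bsub>D\<^esub>" using bv(3) by auto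
      then have b: "b \<in> carrier D - {\<zero>\<^bsub>D\<^esub>}" using bv(1) by blast
      have sv: "s \<in> carrier D" "v \<in> carrier D" using as bv by auto
      have sb: "s \<otimes>\<^bsub>D\<^esub> b \<in> carrier D - {\<zero>\<^bsub>D\<^esub>}" using as(2) b by (auto simp: D.integral_iff)
      have av: "a \<otimes>\<^bsub>D\<^esub> v \<in> carrier D" using as sv by simp
      have "e \<otimes>\<^bsub>E\<^esub> f (s \<otimes>\<^bsub>D\<^esub> b) = (f s \<otimes>\<^bsub>E\<^esub> e) \<otimes>\<^bsub>E\<^esub> f b" using F(1) sv bv(1) by (simp add: E.m_ac)
      also have "\<dots> = f a \<otimes>\<^bsub>E\<^esub> (f v \<otimes>\<^bsub>E\<^esub> t)" unfolding as(3) bv(3) ..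
      also have "\<dots> = f (a \<otimes>\<^bsub>D\<^esub> v) \<otimes>\<^bsub>E\<^esub> t" using as(1) sv t by (simp add: E.m_ac)
      finally have "F = fraction E (f (a \<otimes>\<^bsub>D\<^esub> v)) (f (s \<otimes>\<^bsub>D\<^esub> b))"
        unfolding F using E.fraction_eq_iff[OF F(1) _ F(2) f0[OF sb], of "f (a \<otimes>\<^bsub>D\<^esub> v)"] av by simp
      then have "F = g (fraction D (a \<otimes>\<^bsub>D\<^esub> v) (s \<otimes>\<^bsub>D\<^esub> b))" using g[OF av sb] by simp
      moreover have "fraction D (a \<otimes>\<^bsub>D\<^esub> v) (s \<otimes>\<^bsub>D\<^esub> b) \<in> carrier (fraction_field D)"
        unfolding D.fraction_field_carrier using av sb by blast
      ultimately show "F \<in> g ` carrier (fraction_field D)" by (rule image_eqI)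
    qed
  qed
  then show ?thesis unfolding ring_iso_def bij_betw_def using hom inj_g img by blast
qed

context cring
begin

text \<open>Replaces residue fields by congruences modulo \<open>Q\<close>: every \<open>x\<close>
  becomes a fraction \<open>w / u\<close> over \<open>U\<close>. This is the surjectivity criterion
  for fraction fields with the cosets unfolded.\<close>

theorem residue_map_iso_iff:
  assumes U: "subring U R" and Q: "primeideal Q R"
  shows "residue_map R Q \<in> ring_iso (residue_field (R\<lparr>carrier := U\<rparr>) (Q \<inter> U)) (residue_field R Q) \<longleftrightarrow>
    (\<forall>x\<in>carrier R. \<exists>u\<in>U - Q. \<exists>w\<in>U. u \<otimes> x \<ominus> w \<in> Q)"
proof -
  let ?U = "R\<lparr>carrier := U\<rparr>" and ?P = "Q \<inter> U"
  let ?D = "?U Quot ?P" and ?E = "R Quot Q"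
  interpret Q: primeideal Q R by fact
  interpret P: primeideal ?P ?U by (rule primeideal_contract[OF U Q])
  note U' = subringE[OF U]
  have UR: "u \<in> carrier R" if "u \<in> U" for u using that U'(1) by blast
  have carD: "carrier ?D = {?P +>\<^bsub>?U\<^esub> u | u. u \<in> U}"
    unfolding FactRing_def A_RCOSETS_def RCOSETS_def a_r_coset_def by auto
  have carE: "carrier ?E = {Q +> x | x. x \<in> carrier R}"
    unfolding FactRing_def A_RCOSETS_def RCOSETS_def a_r_coset_def by auto
  have cosD: "?P +>\<^bsub>?U\<^esub> u = {q \<oplus> u | q. q \<in> ?P}" for u
    unfolding a_r_coset_def' by auto
  let ?f = "quotient_map R Q"
  have fu: "?f (?P +>\<^bsub>?U\<^esub> u) = Q +> u" if u: "u \<in> U" for u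
  proof -
    have "Q +> (q \<oplus> u) = Q +> u" if q: "q \<in> ?P" for q
    proof -
      have qR: "q \<in> carrier R" using q UR by blast
      have "(q \<oplus> u) \<ominus> u = q" using UR[OF u] qR by algebra
      then show ?thesis using quotient_eq_iff_same_a_r_cos[OF Q.is_ideal, of "q \<oplus> u" u] UR[OF u] qR q by simp
    qed
    moreover have "?P \<noteq> {}" using ideal_of_subringE(2)[OF U P.is_ideal] by blast
    ultimately show ?thesis unfolding quotient_map_def cosD by auto
  qed
  have eqD: "?P +>\<^bsub>?U\<^esub> u = ?P +>\<^bsub>?U\<^esub> v" if uv: "u \<in> U" "v \<in> U" "u \<ominus> v \<in> Q" for u v
  proof -
    have "u = (u \<ominus> v) \<oplus> v" using UR[OF uv(1)] UR[OF uv(2)] by algebra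
    moreover have "u \<ominus> v \<in> ?P" using uv(3) subring_minus_closed[OF U uv(1,2)] by blast
    ultimately have "u \<in> ?P +>\<^bsub>?U\<^esub> v" unfolding cosD by blast
    then show ?thesis using P.a_repr_independence'[of u v] uv(2) by simp
  qed
  have hom: "?f \<in> ring_hom ?D ?E"
  proof (rule ring_hom_memI)
    show "?f A \<in> carrier ?E" if "A \<in> carrier ?D" for A
      using that fu UR unfolding carD carE by auto
    have "\<one>\<^bsub>?D\<^esub> = ?P +>\<^bsub>?U\<^esub> \<one>" "\<one>\<^bsub>?E\<^esub> = Q +> \<one>" unfolding FactRing_def by simp_all
    then show "?f \<one>\<^bsub>?D\<^esub> = \<one>\<^bsub>?E\<^esub>" using fu U'(3) by simp
  next
    fix A B assume "A \<in> carrier ?D" "B \<in> carrier ?D"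
    then obtain u v where *: "A = ?P +>\<^bsub>?U\<^esub> u" "B = ?P +>\<^bsub>?U\<^esub> v" "u \<in> U" "v \<in> U" unfolding carD by blast
    have "A \<otimes>\<^bsub>?D\<^esub> B = ?P +>\<^bsub>?U\<^esub> (u \<otimes> v)" "A \<oplus>\<^bsub>?D\<^esub> B = ?P +>\<^bsub>?U\<^esub> (u \<oplus> v)"
      unfolding * FactRing_def using P.rcoset_mult_add[of u v] P.a_rcos_sum[of u v] *(3,4) by simp_all
    moreover have "(Q +> u) \<otimes>\<^bsub>?E\<^esub> (Q +> v) = Q +> (u \<otimes> v)" "(Q +> u) \<oplus>\<^bsub>?E\<^esub> (Q +> v) = Q +> (u \<oplus> v)"
      unfolding FactRing_def using Q.rcoset_mult_add[of u v] Q.a_rcos_sum[of u v] *(3,4) UR by simp_all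
    ultimately show "?f (A \<otimes>\<^bsub>?D\<^esub> B) = ?f A \<otimes>\<^bsub>?E\<^esub> ?f B" "?f (A \<oplus>\<^bsub>?D\<^esub> B) = ?f A \<oplus>\<^bsub>?E\<^esub> ?f B"
      using fu[OF U'(6)[OF *(3,4)]] fu[OF U'(7)[OF *(3,4)]] fu[OF *(3)] fu[OF *(4)] *(1,2) by simp_all
  qed
  have inj: "inj_on ?f (carrier ?D)"
  proof
    fix A B assume "A \<in> carrier ?D" "B \<in> carrier ?D" and eq: "?f A = ?f B"
    then obtain u v where *: "A = ?P +>\<^bsub>?U\<^esub> u" "B = ?P +>\<^bsub>?U\<^esub> v" "u \<in> U" "v \<in> U" unfolding carD by blast
    then have "Q +> u = Q +> v" using eq fu by simp
    then have "u \<ominus> v \<in> Q" using quotient_eq_iff_same_a_r_cos[OF Q.is_ideal] UR * by simp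
    then show "A = B" using eqD * by simp
  qed
  have zero: "?P +>\<^bsub>?U\<^esub> u \<noteq> \<zero>\<^bsub>?D\<^esub> \<longleftrightarrow> u \<notin> Q" if u: "u \<in> U" for u
    using P.rcos_const_imp_mem[of u] P.a_rcos_const[of u] u unfolding FactRing_def by auto
  have mul: "(Q +> u) \<otimes>\<^bsub>?E\<^esub> (Q +> x) = Q +> w \<longleftrightarrow> u \<otimes> x \<ominus> w \<in> Q"
    if "u \<in> carrier R" "x \<in> carrier R" "w \<in> carrier R" for u x w
    using that Q.rcoset_mult_add[of u x] quotient_eq_iff_same_a_r_cos[OF Q.is_ideal, of "u \<otimes> x" w]
    unfolding FactRing_def by simp
  have "residue_map R Q = (\<lambda>F. \<Union>(a, s)\<in>F. fraction ?E (?f a) (?f s))"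
    unfolding residue_map_def by (rule ext) simp
  then have "residue_map R Q \<in> ring_iso (residue_field ?U ?P) (residue_field R Q) \<longleftrightarrow>
    (\<forall>e\<in>carrier ?E. \<exists>a\<in>carrier ?D. \<exists>s\<in>carrier ?D - {\<zero>\<^bsub>?D\<^esub>}. ?f s \<otimes>\<^bsub>?E\<^esub> e = ?f a)"
    using fraction_field_iso_iff[OF P.quotient_is_domain Q.quotient_is_domain hom inj]
    unfolding residue_field_def by simp
  also have "\<dots> \<longleftrightarrow> (\<forall>x\<in>carrier R. \<exists>w\<in>U. \<exists>u\<in>U. u \<notin> Q \<and> (Q +> u) \<otimes>\<^bsub>?E\<^esub> (Q +> x) = Q +> w)"
  proof -
    have "(\<exists>a\<in>carrier ?D. \<exists>s\<in>carrier ?D - {\<zero>\<^bsub>?D\<^esub>}. ?f s \<otimes>\<^bsub>?E\<^esub> e = ?f a) \<longleftrightarrow>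
      (\<exists>w\<in>U. \<exists>u\<in>U. u \<notin> Q \<and> (Q +> u) \<otimes>\<^bsub>?E\<^esub> e = Q +> w)" for e
    proof
      assume "\<exists>a\<in>carrier ?D. \<exists>s\<in>carrier ?D - {\<zero>\<^bsub>?D\<^esub>}. ?f s \<otimes>\<^bsub>?E\<^esub> e = ?f a"
      then obtain w u where "w \<in> U" "u \<in> U" "?P +>\<^bsub>?U\<^esub> u \<noteq> \<zero>\<^bsub>?D\<^esub>"
        "?f (?P +>\<^bsub>?U\<^esub> u) \<otimes>\<^bsub>?E\<^esub> e = ?f (?P +>\<^bsub>?U\<^esub> w)" unfolding carD by blast
      then show "\<exists>w\<in>U. \<exists>u\<in>U. u \<notin> Q \<and> (Q +> u) \<otimes>\<^bsub>?E\<^esub> e = Q +> w" using fu zero by auto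
    next
      assume "\<exists>w\<in>U. \<exists>u\<in>U. u \<notin> Q \<and> (Q +> u) \<otimes>\<^bsub>?E\<^esub> e = Q +> w"
      then obtain w u where wu: "w \<in> U" "u \<in> U" "u \<notin> Q" "(Q +> u) \<otimes>\<^bsub>?E\<^esub> e = Q +> w" by blast
      have "?P +>\<^bsub>?U\<^esub> w \<in> carrier ?D" "?P +>\<^bsub>?U\<^esub> u \<in> carrier ?D - {\<zero>\<^bsub>?D\<^esub>}"
        "?f (?P +>\<^bsub>?U\<^esub> u) \<otimes>\<^bsub>?E\<^esub> e = ?f (?P +>\<^bsub>?U\<^esub> w)"
        using wu zero fu unfolding carD by auto
      then show "\<exists>a\<in>carrier ?D. \<exists>s\<in>carrier ?D - {\<zero>\<^bsub>?D\<^esub>}. ?f s \<otimes>\<^bsub>?E\<^esub> e = ?f a" by blast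
    qed
    then show ?thesis unfolding carE by blast
  qed
  also have "\<dots> \<longleftrightarrow> (\<forall>x\<in>carrier R. \<exists>u\<in>U - Q. \<exists>w\<in>U. u \<otimes> x \<ominus> w \<in> Q)"
    using mul UR by (intro ball_cong refl) (simp add: Bex_def, blast)
  finally show ?thesis .
qed

lemma subintegral_iff:
  assumes U: "subring U R"
  shows "subintegral U R \<longleftrightarrow> integral_extension U R \<and> inj_on (\<lambda>Q. Q \<inter> U) {Q. primeideal Q R} \<and>
    (\<forall>Q. primeideal Q R \<longrightarrow> (\<forall>x\<in>carrier R. \<exists>u\<in>U - Q. \<exists>w\<in>U. u \<otimes> x \<ominus> w \<in> Q))"
  unfolding subintegral_def using residue_map_iso_iff[OF U] by blast

lemma subintegral_carrier: "subintegral (carrier R) R"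
proof -
  have "integral_over (carrier R) R x" if x: "x \<in> carrier R" for x
  proof -
    have "eval [\<one>, \<ominus> x] x = \<zero>" using x by (simp add: r_neg)
    then show ?thesis unfolding integral_over_def using x by (intro exI[of _ "[\<one>, \<ominus> x]"]) auto
  qed
  then have "integral_extension (carrier R) R"
    unfolding integral_extension_def ring_extension_def using carrier_is_subring is_cring by blast
  moreover have "inj_on (\<lambda>Q. Q \<inter> carrier R) {Q. primeideal Q R}"
    using idealE(1)[OF primeidealE(1)] by (intro inj_onI) (metis inf.absorb1 mem_Collect_eq)
  moreover have "\<exists>u\<in>carrier R - Q. \<exists>w\<in>carrier R. u \<otimes> x \<ominus> w \<in> Q"
    if Q: "primeideal Q R" and x: "x \<in> carrier R" for Q x
  proof (intro bexI)
    show "\<one> \<otimes> x \<ominus> x \<in> Q" using x idealE(2)[OF primeidealE(1)[OF Q]] by (simp add: minus_eq r_neg)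
  qed (use x primeidealE(2)[OF Q] in auto)
  ultimately show ?thesis unfolding subintegral_iff[OF carrier_is_subring] by blast
qed

end

section \<open>Maximal chains\<close>

lemma maxchain_iff:
  "subset.maxchain \<A> C \<longleftrightarrow>
     subset.chain \<A> C \<and> (\<forall>Z\<in>\<A>. (\<forall>Y\<in>C. Y \<subseteq> Z \<or> Z \<subseteq> Y) \<longrightarrow> Z \<in> C)"
proof
  assume C: "subset.maxchain \<A> C"
  then have ch: "subset.chain \<A> C" by (rule subset.maxchain_imp_chain)
  moreover have "Z \<in> C" if "Z \<in> \<A>" "\<forall>Y\<in>C. Y \<subseteq> Z \<or> Z \<subseteq> Y" for Z
  proof (rule ccontr)
    assume "Z \<notin> C"
    moreover have "subset.chain \<A> (insert Z C)" using ch that by (auto simp: subset_chain_def)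
    ultimately show False using C unfolding subset.maxchain_def by blast
  qed
  ultimately show "subset.chain \<A> C \<and> (\<forall>Z\<in>\<A>. (\<forall>Y\<in>C. Y \<subseteq> Z \<or> Z \<subseteq> Y) \<longrightarrow> Z \<in> C)" by blast
next
  assume C: "subset.chain \<A> C \<and> (\<forall>Z\<in>\<A>. (\<forall>Y\<in>C. Y \<subseteq> Z \<or> Z \<subseteq> Y) \<longrightarrow> Z \<in> C)"
  have False if E: "subset.chain \<A> E" "C \<subset> E" for E
  proof -
    obtain Z where Z: "Z \<in> E" "Z \<notin> C" using E(2) by blast
    have "Z \<in> \<A>" using E(1) Z(1) unfolding subset_chain_def by blast
    moreover have "Y \<subseteq> Z \<or> Z \<subseteq> Y" if "Y \<in> C" for Y
      using E Z(1) that unfolding subset_chain_def by blast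
    ultimately show False using C Z(2) by blast
  qed
  then show "subset.maxchain \<A> C" using C unfolding subset.maxchain_def by blast
qed

text \<open>Hausdorff's principle is applied to the elements comparable with all of
  \<open>D\<close>; there a maximal chain cannot omit any element of \<open>D\<close>.\<close>

lemma chain_extends_to_maxchain:
  assumes D: "subset.chain \<A> D"
  obtains C where "subset.maxchain \<A> C" "D \<subseteq> C"
proof -
  let ?B = "{Z \<in> \<A>. \<forall>Y\<in>D. Y \<subseteq> Z \<or> Z \<subseteq> Y}"
  obtain C where C: "subset.maxchain ?B C" using subset.Hausdorff by blast
  then have ch: "subset.chain ?B C" and mx: "\<And>Z. Z \<in> ?B \<Longrightarrow> \<forall>Y\<in>C. Y \<subseteq> Z \<or> Z \<subseteq> Y \<Longrightarrow> Z \<in> C"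
    unfolding maxchain_iff by auto
  have "D \<subseteq> C"
  proof
    fix Z assume Z: "Z \<in> D"
    then have "Z \<in> ?B" using D unfolding subset_chain_def by blast
    moreover have "Y \<subseteq> Z \<or> Z \<subseteq> Y" if "Y \<in> C" for Y
    proof -
      have "Y \<in> ?B" using that ch unfolding subset_chain_def by blast
      then show ?thesis using Z by blast
    qed
    ultimately show "Z \<in> C" by (intro mx ballI)
  qed
  moreover have "subset.maxchain \<A> C"
    unfolding maxchain_iff
  proof (intro conjI ballI impI)
    show "subset.chain \<A> C" using ch unfolding subset_chain_def by blast
    fix Z assume "Z \<in> \<A>" and "\<forall>Y\<in>C. Y \<subseteq> Z \<or> Z \<subseteq> Y"
    then show "Z \<in> C" using mx[of Z] \<open>D \<subseteq> C\<close> by blast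
  qed
  ultimately show ?thesis using that by blast
qed

section \<open>Chains in intervals and catenarity\<close>

definition interval :: "'a set set \<Rightarrow> 'a set \<Rightarrow> 'a set \<Rightarrow> 'a set set" where
  "interval \<A> A B = {Y \<in> \<A>. A \<subseteq> Y \<and> Y \<subseteq> B}"

lemma maxchain_interval_ends:
  assumes "subset.maxchain (interval \<A> A B) C" "A \<in> \<A>" "B \<in> \<A>" "A \<subseteq> B"
  shows "A \<in> C" "B \<in> C"
proof -
  have C: "\<And>Y. Y \<in> C \<Longrightarrow> A \<subseteq> Y \<and> Y \<subseteq> B"
    and mx: "\<And>Z. Z \<in> interval \<A> A B \<Longrightarrow> \<forall>Y\<in>C. Y \<subseteq> Z \<or> Z \<subseteq> Y \<Longrightarrow> Z \<in> C"
    using assms(1) unfolding maxchain_iff subset_chain_def by (auto simp: interval_def)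
  have "A \<in> interval \<A> A B" "B \<in> interval \<A> A B" using assms(2-4) unfolding interval_def by auto
  then show "A \<in> C" "B \<in> C" using C by (intro mx; simp)+
qed

text \<open>Whatever is comparable with \<open>B\<close> lies in the lower or the upper interval, so
  maximality of the union splits into the two given ones.\<close>

lemma maxchain_glue:
  assumes C: "subset.maxchain (interval \<A> A B) C" and D: "subset.maxchain (interval \<A> B E) D"
    and AB: "A \<in> \<A>" "B \<in> \<A>" "E \<in> \<A>" "A \<subseteq> B" "B \<subseteq> E"
  shows "subset.maxchain (interval \<A> A E) (C \<union> D)" "C \<inter> D = {B}"
proof -
  have BC: "B \<in> C" "B \<in> D" using maxchain_interval_ends C D AB by blast+
  have ch: "subset.chain (interval \<A> A B) C" "subset.chain (interval \<A> B E) D"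
    using C D unfolding maxchain_iff by auto
  have C': "\<And>Y. Y \<in> C \<Longrightarrow> Y \<in> \<A> \<and> A \<subseteq> Y \<and> Y \<subseteq> B" and D': "\<And>Y. Y \<in> D \<Longrightarrow> Y \<in> \<A> \<and> B \<subseteq> Y \<and> Y \<subseteq> E"
    using ch unfolding subset_chain_def interval_def by auto
  have lin: "Y \<subseteq> Z \<or> Z \<subseteq> Y" if "Y \<in> C \<and> Z \<in> C \<or> Y \<in> D \<and> Z \<in> D" for Y Z
    using that ch unfolding subset_chain_def by blast
  have CD: "Y \<subseteq> Z" if "Y \<in> C" "Z \<in> D" for Y Z using C'[OF that(1)] D'[OF that(2)] by blast
  show "subset.maxchain (interval \<A> A E) (C \<union> D)"
    unfolding maxchain_iff
  proof (intro conjI ballI impI)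
    have "C \<union> D \<subseteq> interval \<A> A E" using C' D' AB unfolding interval_def by blast
    moreover have "Y \<subseteq> Z \<or> Z \<subseteq> Y" if "Y \<in> C \<union> D" "Z \<in> C \<union> D" for Y Z
      using that CD[of Y Z] CD[of Z Y] lin[of Y Z] by blast
    ultimately show "subset.chain (interval \<A> A E) (C \<union> D)" unfolding subset_chain_def by blast
    fix Z assume Z: "Z \<in> interval \<A> A E" and comp: "\<forall>Y\<in>C \<union> D. Y \<subseteq> Z \<or> Z \<subseteq> Y"
    then consider "Z \<subseteq> B" | "B \<subseteq> Z" using BC by blast
    then show "Z \<in> C \<union> D"
    proof cases
      case 1
      then have "Z \<in> interval \<A> A B" using Z unfolding interval_def by blast
      then show ?thesis using C comp unfolding maxchain_iff by blast
    next
      case 2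
      then have "Z \<in> interval \<A> B E" using Z unfolding interval_def by blast
      then show ?thesis using D comp unfolding maxchain_iff by blast
    qed
  qed
  show "C \<inter> D = {B}" using BC CD C' D' by blast
qed

lemma intermediate_rings_eq_interval:
  assumes "R \<subseteq> U"
  shows "intermediate_rings U S = interval (intermediate_rings R S) U (carrier S)"
proof -
  have "Y \<subseteq> carrier S" if "subring Y S" for Y using subringE(1)[OF that] .
  then show ?thesis using assms unfolding intermediate_rings_def interval_def by auto
qed

text \<open>Maximal chains of the interval are padded by the same chains below \<open>T\<close> and
  above \<open>B\<close>; equal total lengths then force equal lengths inside. The chain
  \<open>D\<close> is first extended to a maximal one.\<close>

lemma catenarian_interval:
  assumes cat: "catenarian R S" and TB: "T \<in> intermediate_rings R S" "B \<in> intermediate_rings R S" "T \<subseteq> B"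
    and C: "subset.maxchain (interval (intermediate_rings R S) T B) C"
    and D: "subset.chain (interval (intermediate_rings R S) T B) D"
  shows "finite C" "finite D" "card D \<le> card C"
proof -
  let ?A = "intermediate_rings R S"
  have FCP: "FCP R S" using cat unfolding catenarian_def by blast
  then interpret cring S unfolding FCP_def ring_extension_def by blast
  have fin: "finite G" if "subset.maxchain (interval ?A Y Z) G" for Y Z G
  proof -
    have "subset.chain ?A G"
      using subset.maxchain_imp_chain[OF that] unfolding subset_chain_def interval_def by blast
    then show ?thesis using FCP unfolding FCP_def by blast
  qed
  have ends: "R \<in> ?A" "carrier S \<in> ?A" "R \<subseteq> T" "B \<subseteq> carrier S"
    using FCP carrier_is_subring TB subringE(1)[of _ S]
    unfolding FCP_def ring_extension_def intermediate_rings_def by blast+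
  obtain E1 where E1: "subset.maxchain (interval ?A R T) E1" using subset.Hausdorff by blast
  obtain E2 where E2: "subset.maxchain (interval ?A B (carrier S)) E2" using subset.Hausdorff by blast
  \<comment> \<open>The \<open>2\<close> accounts for \<open>T\<close> and \<open>B\<close>, each
    shared by two of the three pieces.\<close>
  have len: "card E1 + card G + card E2 = card (E1 \<union> G \<union> E2) + 2"
    "subset.maxchain ?A (E1 \<union> G \<union> E2)" if G: "subset.maxchain (interval ?A T B) G" for G
  proof -
    note 1 = maxchain_glue[OF E1 G ends(1) TB(1,2) ends(3) TB(3)]
    have "R \<subseteq> B" using ends(3) TB(3) by blast
    note 2 = maxchain_glue[OF 1(1) E2 ends(1) TB(2) ends(2) this ends(4)]
    have "?A = interval ?A R (carrier S)"
      using intermediate_rings_eq_interval[OF subset_refl] .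
    then show "subset.maxchain ?A (E1 \<union> G \<union> E2)" using 2(1) by simp
    show "card E1 + card G + card E2 = card (E1 \<union> G \<union> E2) + 2"
      using card_Un_Int[OF fin[OF E1] fin[OF G]] card_Un_Int[OF fin[OF 1(1)] fin[OF E2]] 1(2) 2(2)
      by simp
  qed
  obtain G where G: "subset.maxchain (interval ?A T B) G" "D \<subseteq> G"
    using chain_extends_to_maxchain[OF D] .
  have "chain_length (E1 \<union> C \<union> E2) = chain_length (E1 \<union> G \<union> E2)"
    using cat len(2)[OF C] len(2)[OF G(1)] unfolding catenarian_def by blast
  \<comment> \<open>\<open>chain_length\<close> uses truncated subtraction, so equal lengths give
    equal cardinalities only for nonempty chains.\<close>
  moreover have "E1 \<noteq> {}" using maxchain_interval_ends(1)[OF E1 ends(1) TB(1) ends(3)] by blast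
  then have "card (E1 \<union> C \<union> E2) \<noteq> 0" "card (E1 \<union> G \<union> E2) \<noteq> 0"
    using fin[OF E1] fin[OF C] fin[OF G(1)] fin[OF E2] by auto
  ultimately have "card C = card G"
    using len(1)[OF C] len(1)[OF G(1)] unfolding chain_length_def by linarith
  then show "finite C" "finite D" "card D \<le> card C"
    using fin[OF C] fin[OF G(1)] G(2) finite_subset card_mono by auto
qed

lemma catenarian_mono:
  assumes cat: "catenarian R S" and U: "subring U S" "R \<subseteq> U"
  shows "catenarian U S"
proof -
  have FCP: "FCP R S" using cat unfolding catenarian_def by blast
  then interpret cring S unfolding FCP_def ring_extension_def by blast
  have int: "U \<in> intermediate_rings R S" "carrier S \<in> intermediate_rings R S" "U \<subseteq> carrier S"
    using U carrier_is_subring subringE(1)[OF U(1)] unfolding intermediate_rings_def by blast+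
  have "card C = card D" if "subset.maxchain (intermediate_rings U S) C"
    "subset.maxchain (intermediate_rings U S) D" for C D
    using that catenarian_interval(3)[OF cat int] subset.maxchain_imp_chain
    unfolding intermediate_rings_eq_interval[OF U(2), of S] by (meson le_antisym)
  then show ?thesis
    unfolding catenarian_def chain_length_def using FCP_mono[OF FCP U] by metis
qed

section \<open>Intersections of subintegral subextensions\<close>

context cring
begin

text \<open>Going from \<open>T\<close> up to \<open>A\<close> and then adjoining \<open>x\<close> takes one step more than a chain from \<open>T\<close> to
  \<open>A\<close>. Adjoining \<open>A x\<close> first takes at least two steps, since \<open>T + T x\<close> lies strictly in between,
  and the chain from \<open>T\<close> to \<open>A\<close> can still be run afterwards.\<close>

lemma not_catenarian_of_ramified_step:
  assumes AB: "minimal_extension A B" and T: "subring T R" "V \<subseteq> T" "T \<subset> A"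
    and M: "ideal M (R\<lparr>carrier := A\<rparr>)" "M \<subseteq> T" and F: "field_mod A M"
    and x: "x \<in> B" "x \<notin> A" "x \<otimes> x \<in> M" and Mx: "\<And>m. m \<in> M \<Longrightarrow> m \<otimes> x \<in> M"
  shows "\<not> catenarian V R"
proof
  assume cat: "catenarian V R"
  have A: "subring A R" and B: "subring B R" and sub: "A \<subset> B"
    and min: "\<And>C. subring C R \<Longrightarrow> A \<subseteq> C \<Longrightarrow> C \<subseteq> B \<Longrightarrow> C = A \<or> C = B"
    using AB unfolding minimal_extension_def by auto
  note A' = subringE[OF A] and B' = subringE[OF B] and T' = subringE[OF T(1)]
  note MI = ideal_of_subringE[OF A M(1)]
  have AR: "a \<in> carrier R" if "a \<in> A" for a using that A'(1) by blast
  have xR: "x \<in> carrier R" using x(1) B'(1) by blast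
  let ?Z = "\<lambda>K. {k \<otimes> x | k. k \<in> K}"
  \<comment> \<open>\<open>Y + K x\<close> is closed under products because
    \<open>x \<otimes> x\<close> lies in \<open>M\<close>, an ideal of \<open>A\<close> contained in
    \<open>Y\<close>.\<close>
  have ring: "subring (Y <+>\<^bsub>R\<^esub> ?Z K) R" "Y \<subseteq> Y <+>\<^bsub>R\<^esub> ?Z K" "?Z K \<subseteq> Y <+>\<^bsub>R\<^esub> ?Z K"
    "Y <+>\<^bsub>R\<^esub> ?Z K \<subseteq> B"
    if Y: "subring Y R" "M \<subseteq> Y" "Y \<subseteq> K" and K: "subring K R" "K \<subseteq> A" for Y K
  proof -
    note K' = subringE[OF K(1)]
    have KR: "k \<in> carrier R" if "k \<in> K" for k using that K'(1) by blast
    have Z: "?Z K \<subseteq> carrier R" using KR xR by auto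
    have "\<zero> = \<zero> \<otimes> x" using xR by simp
    then have Z0: "\<zero> \<in> ?Z K" using K'(2) by blast
    have Zadd: "y \<oplus> z \<in> ?Z K" if yz: "y \<in> ?Z K" "z \<in> ?Z K" for y z
    proof -
      obtain u v where uv: "y = u \<otimes> x" "z = v \<otimes> x" "u \<in> K" "v \<in> K" using yz by blast
      then have "y \<oplus> z = (u \<oplus> v) \<otimes> x" using KR xR by (simp add: l_distr)
      then show ?thesis using K'(7)[OF uv(3,4)] by blast
    qed
    have Zsm: "a \<otimes> z \<in> ?Z K" if az: "a \<in> Y" "z \<in> ?Z K" for a z
    proof -
      obtain u where u: "z = u \<otimes> x" "u \<in> K" using az by blast
      have aK: "a \<in> K" using az(1) Y(3) by blast
      then have "a \<otimes> z = (a \<otimes> u) \<otimes> x" using u KR xR by (simp add: m_assoc)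
      then show ?thesis using K'(6)[OF aK u(2)] by blast
    qed
    have Zm: "y \<otimes> z \<in> Y <+>\<^bsub>R\<^esub> ?Z K" if yz: "y \<in> ?Z K" "z \<in> ?Z K" for y z
    proof -
      obtain u v where uv: "y = u \<otimes> x" "z = v \<otimes> x" "u \<in> K" "v \<in> K" using yz by blast
      have uvR: "u \<in> carrier R" "v \<in> carrier R" using uv KR by auto
      have "y \<otimes> z = (u \<otimes> v) \<otimes> (x \<otimes> x)" unfolding uv using uvR xR by (simp add: m_ac)
      also have "\<dots> \<in> M" using MI(4)[OF subsetD[OF K(2) K'(6)[OF uv(3,4)]] x(3)] .
      finally have "y \<otimes> z \<in> Y" using Y(2) by blast
      moreover have "y \<otimes> z = y \<otimes> z \<oplus> \<zero>" using subsetD[OF Z yz(1)] subsetD[OF Z yz(2)] by simp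
      ultimately show ?thesis unfolding mem_set_add using Z0 by blast
    qed
    show "subring (Y <+>\<^bsub>R\<^esub> ?Z K) R" "Y \<subseteq> Y <+>\<^bsub>R\<^esub> ?Z K" "?Z K \<subseteq> Y <+>\<^bsub>R\<^esub> ?Z K"
      by (rule subring_set_add[OF Y(1) Z Z0]; (rule Zadd | rule Zsm | rule Zm); assumption)+
    have YB: "y \<in> B" if "y \<in> Y" for y using that Y(3) K(2) sub by blast
    have KB: "k \<otimes> x \<in> B" if "k \<in> K" for k using B'(6)[OF _ x(1)] that K(2) sub by blast
    show "Y <+>\<^bsub>R\<^esub> ?Z K \<subseteq> B" using B'(7)[OF YB KB] by (auto simp: mem_set_add)
  qed
  \<comment> \<open>Independence of \<open>x\<close> over \<open>A\<close> modulo \<open>M\<close>: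
    a coefficient outside \<open>M\<close> would be invertible modulo \<open>M\<close> and would
    bring \<open>x\<close> into \<open>A\<close>.\<close>
  have indep: "a \<in> M" if a: "a \<in> A" "a \<otimes> x \<in> A" for a
  proof (rule ccontr)
    assume "a \<notin> M"
    then obtain c where c: "c \<in> A" "\<one> \<ominus> a \<otimes> c \<in> M" using F a(1) unfolding field_mod_def by blast
    have "x = (\<one> \<ominus> a \<otimes> c) \<otimes> x \<oplus> c \<otimes> (a \<otimes> x)"
      using AR[OF a(1)] AR[OF c(1)] xR by algebra
    also have "\<dots> \<in> A" using A'(7)[OF subsetD[OF MI(1) Mx[OF c(2)]] A'(6)[OF c(1) a(2)]] .
    finally show False using x(2) by blast
  qed
  let ?\<A> = "intermediate_rings V R"
  have TA: "T \<in> ?\<A>" "A \<in> ?\<A>" "B \<in> ?\<A>" "T \<subseteq> A" "A \<subseteq> B" "T \<subseteq> B"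
    using T A B sub unfolding intermediate_rings_def by auto
  have int_iff: "Y \<in> interval ?\<A> T K \<longleftrightarrow> subring Y R \<and> T \<subseteq> Y \<and> Y \<subseteq> K" for Y K
    using T(2) unfolding interval_def intermediate_rings_def by blast
  obtain E where E: "subset.maxchain (interval ?\<A> T A) E" using subset.Hausdorff by blast
  have Ech: "subset.chain (interval ?\<A> T A) E"
    and Emax: "\<And>Z. Z \<in> interval ?\<A> T A \<Longrightarrow> \<forall>Y\<in>E. Y \<subseteq> Z \<or> Z \<subseteq> Y \<Longrightarrow> Z \<in> E"
    using E unfolding maxchain_iff by auto
  have EY: "subring Y R" "T \<subseteq> Y" "Y \<subseteq> A" if "Y \<in> E" for Y
    using that Ech unfolding subset_chain_def int_iff subset_iff by auto
  have Elin: "Y \<subseteq> Z \<or> Z \<subseteq> Y" if "Y \<in> E" "Z \<in> E" for Y Z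
    using that Ech unfolding subset_chain_def by blast
  have TE: "T \<in> E" "A \<in> E" using maxchain_interval_ends[OF E TA(1,2,4)] by auto
  have BE: "B \<notin> E" using EY(3) sub by blast
  \<comment> \<open>Nothing fits between \<open>A\<close> and \<open>B\<close>, so adding
    \<open>B\<close> on top of a maximal chain up to \<open>A\<close> keeps it maximal.\<close>
  have C: "subset.maxchain (interval ?\<A> T B) (insert B E)"
    unfolding maxchain_iff
  proof (intro conjI ballI impI)
    have "insert B E \<subseteq> interval ?\<A> T B"
      using EY B TA(5,6) unfolding subset_iff int_iff by blast
    moreover have "Y \<subseteq> Z \<or> Z \<subseteq> Y" if "Y \<in> insert B E" "Z \<in> insert B E" for Y Z
      using that Elin[of Y Z] EY(3)[of Y] EY(3)[of Z] TA(5) by blast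
    ultimately show "subset.chain (interval ?\<A> T B) (insert B E)" unfolding subset_chain_def by blast
    fix Z assume Z: "Z \<in> interval ?\<A> T B" and comp: "\<forall>Y\<in>insert B E. Y \<subseteq> Z \<or> Z \<subseteq> Y"
    then have Z': "subring Z R" "T \<subseteq> Z" "Z \<subseteq> B" unfolding int_iff by auto
    consider "Z \<subseteq> A" | "A \<subseteq> Z" using comp TE by blast
    then show "Z \<in> insert B E"
    proof cases
      case 1
      then have "Z \<in> interval ?\<A> T A" using Z' unfolding int_iff by blast
      then show ?thesis using Emax comp by blast
    next
      case 2
      then show ?thesis using min[OF Z'(1) 2 Z'(3)] TE(2) by blast
    qed
  qed
  define h where "h Y = Y <+>\<^bsub>R\<^esub> ?Z A" for Y
  define T1 where "T1 = T <+>\<^bsub>R\<^esub> ?Z T"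
  have hY: "subring (h Y) R" "Y \<subseteq> h Y" "?Z A \<subseteq> h Y" "h Y \<subseteq> B" if "Y \<in> E" for Y
    unfolding h_def using ring[OF EY(1)[OF that] _ EY(3)[OF that] A] EY(2)[OF that] M(2) by auto
  have T1: "subring T1 R" "T \<subseteq> T1" "?Z T \<subseteq> T1" "T1 \<subseteq> B"
    unfolding T1_def using ring[OF T(1) M(2) subset_refl T(1) TA(4)] by auto
  have mono: "Y <+>\<^bsub>R\<^esub> ?Z K \<subseteq> Y' <+>\<^bsub>R\<^esub> ?Z K'" if "Y \<subseteq> Y'" "K \<subseteq> K'" for Y Y' K K'
    unfolding subset_iff mem_set_add using that by blast
  have hmono: "h Y \<subseteq> h Z" if "Y \<subseteq> Z" for Y Z unfolding h_def using mono[OF that subset_refl] .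
  \<comment> \<open>Intersecting with \<open>A\<close> recovers \<open>Y\<close>, since by
    \<open>indep\<close> a multiple of \<open>x\<close> lying in \<open>A\<close> already lies in
    \<open>M\<close>. Hence \<open>h\<close> loses no step of the chain.\<close>
  have hA: "h Y \<inter> A = Y" if Y: "Y \<in> E" for Y
  proof
    show "Y \<subseteq> h Y \<inter> A" using hY(2)[OF Y] EY(3)[OF Y] by blast
    show "h Y \<inter> A \<subseteq> Y"
    proof
      fix z assume "z \<in> h Y \<inter> A"
      then have "z \<in> h Y" "z \<in> A" by auto
      then obtain y a where ya: "z = y \<oplus> a \<otimes> x" "y \<in> Y" "a \<in> A" "z \<in> A"
        unfolding h_def mem_set_add by blast
      have yA: "y \<in> A" using ya EY(3)[OF Y] by blast
      have "a \<otimes> x = z \<ominus> y" unfolding ya(1)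
        using AR[OF yA] AR[OF ya(3)] xR by algebra
      then have "a \<otimes> x \<in> A" using subring_minus_closed[OF A ya(4) yA] by simp
      then have "a \<otimes> x \<in> M" using Mx[OF indep[OF ya(3)]] by blast
      then have "a \<otimes> x \<in> Y" using M(2) EY(2)[OF Y] by blast
      then show "z \<in> Y" unfolding ya(1) using subringE(7)[OF EY(1)[OF Y] ya(2)] by blast
    qed
  qed
  have inj: "inj_on h E" using hA by (metis inj_onI)
  have x1: "x = \<one> \<otimes> x" using xR by simp
  have xT1: "x \<in> T1" using T1(3) T'(3) x1 by blast
  have xh: "x \<in> h Y" if "Y \<in> E" for Y using hY(3)[OF that] A'(3) x1 by blast
  \<comment> \<open>Equality would express \<open>a x\<close> as \<open>t + u x\<close> with
    \<open>t\<close> and \<open>u\<close> in \<open>T\<close>; then \<open>(a - u) x\<close> is in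
    \<open>A\<close>, so \<open>a - u\<close> is in \<open>M\<close>, and every \<open>a\<close> of
    \<open>A\<close> would lie in \<open>T\<close>.\<close>
  have notT1: "h Y \<noteq> T1" if Y: "Y \<in> E" for Y
  proof
    assume eq: "h Y = T1"
    have "A \<subseteq> T"
    proof
      fix a assume a: "a \<in> A"
      then have "a \<otimes> x \<in> T1" using hY(3)[OF Y] eq by blast
      then obtain t u where tu: "a \<otimes> x = t \<oplus> u \<otimes> x" "t \<in> T" "u \<in> T"
        unfolding T1_def mem_set_add by blast
      have tuA: "t \<in> A" "u \<in> A" using tu T(3) by auto
      have "(a \<ominus> u) \<otimes> x = a \<otimes> x \<ominus> u \<otimes> x"
        using AR[OF a] AR[OF tuA(2)] xR by algebra
      also have "\<dots> = t" unfolding tu(1)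
        using AR[OF tuA(1)] AR[OF tuA(2)] xR by algebra
      finally have "a \<ominus> u \<in> M" using indep[OF subring_minus_closed[OF A a tuA(2)]] tuA(1) by simp
      then have "(a \<ominus> u) \<oplus> u \<in> T" using T'(7) M(2) tu(3) by blast
      moreover have "(a \<ominus> u) \<oplus> u = a" using AR[OF a] AR[OF tuA(2)] by algebra
      ultimately show "a \<in> T" by simp
    qed
    then show False using T(3) by blast
  qed
  let ?D = "insert T (insert T1 (h ` E))"
  have D: "subset.chain (interval ?\<A> T B) ?D"
  proof -
    have "h Y \<in> interval ?\<A> T B" if "Y \<in> E" for Y
      unfolding int_iff using hY(1,4)[OF that] subset_trans[OF EY(2)[OF that] hY(2)[OF that]] by simp
    moreover have "T \<in> interval ?\<A> T B" "T1 \<in> interval ?\<A> T B"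
      unfolding int_iff using T(1) TA(6) T1(1,2,4) by auto
    ultimately have "?D \<subseteq> interval ?\<A> T B" by auto
    moreover have "T1 \<subseteq> h Y" "T \<subseteq> h Y" if "Y \<in> E" for Y
      using mono[OF EY(2)[OF that] TA(4)] hY(2)[OF that] EY(2)[OF that] unfolding h_def T1_def by auto
    moreover have "h Y \<subseteq> h Z \<or> h Z \<subseteq> h Y" if "Y \<in> E" "Z \<in> E" for Y Z
      using Elin[OF that] hmono by blast
    ultimately show ?thesis using T1(2) unfolding subset_chain_def by simp
  qed
  note cd = catenarian_interval[OF cat TA(1,3,6) C D]
  have "T \<notin> insert T1 (h ` E)" using xT1 xh x(2) TA(4) by auto
  moreover have "T1 \<notin> h ` E" using notT1 by auto
  ultimately have "card ?D = card E + 2"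
    using cd(2) card_image[OF inj] by simp
  moreover have "card (insert B E) = card E + 1" using cd(1) BE by simp
  ultimately show False using cd(3) by simp
qed

text \<open>Contradicts catenarity from a single missed residue \<open>s0\<close>, by constructing
  the ramified step above \<open>W\<close> and the proper subring \<open>V + M\<close> of
  \<open>A\<close> below it.\<close>

lemma residue_surj_of_catenarian:
  assumes V: "subring V R" and int: "\<And>x. x \<in> carrier R \<Longrightarrow> integral_over V R x"
    and inj: "inj_on (\<lambda>Q. Q \<inter> V) {Q. primeideal Q R}" and cat: "catenarian V R"
    and W: "subring W R" "V \<subseteq> W" and Q: "primeideal Q R"
    and res: "\<And>s. s \<in> carrier R \<Longrightarrow> \<exists>u\<in>W - Q. \<exists>w\<in>W. u \<otimes> s \<ominus> w \<in> Q"
    and cond: "conductor W (carrier R) \<inter> V \<subseteq> Q" and s0: "s0 \<in> carrier R"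
  shows "\<exists>v\<in>V. s0 \<ominus> v \<in> Q"
proof (rule ccontr)
  assume contra: "\<not> (\<exists>v\<in>V. s0 \<ominus> v \<in> Q)"
  have FCP: "FCP V R" using cat unfolding catenarian_def by blast
  note QI = idealE[OF primeidealE(1)[OF Q]]
  have uniq: "Q' = Q" if "primeideal Q' R" "Q' \<inter> V = Q \<inter> V" for Q'
    using inj_onD[OF inj, of Q' Q] that Q by simp
  have intW: "integral_over W R x" if "x \<in> carrier R" for x
    using integral_over_mono[OF int[OF that] W(2)] .
  \<comment> \<open>The hypothesis controls only the part inside \<open>V\<close>. Lying over from
    \<open>V\<close> gives a prime containing the whole conductor, and injectivity identifies it
    with \<open>Q\<close>.\<close>
  have "conductor W (carrier R) \<subseteq> Q"
  proof -
    have "ideal (conductor W (carrier R)) R"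
      using conductor_ideal(1)[OF W(1) carrier_is_subring subringE(1)[OF W(1)]] by simp
    moreover have "conductor W (carrier R) \<inter> V \<subseteq> Q \<inter> V" using cond by blast
    ultimately obtain Q' where "primeideal Q' R" "conductor W (carrier R) \<subseteq> Q'" "Q' \<inter> V = Q \<inter> V"
      using lying_over[OF V int _ primeideal_contract[OF V Q]] by blast
    then show ?thesis using uniq by blast
  qed
  then have "conductor W (carrier R) \<subseteq> Q \<inter> W" unfolding conductor_def by blast
  then obtain A B Q' where AB: "minimal_extension A B" and WA: "W \<subseteq> A" and Q': "primeideal Q' R" "Q' \<inter> W = Q \<inter> W"
      "Q' \<inter> A = conductor A B" "field_mod A (Q' \<inter> A)"
    using critical_minimal_extension[OF W(1) intW FCP_mono[OF FCP W] primeideal_contract[OF W(1) Q]] by blast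
  have "Q' = Q" using uniq[OF Q'(1)] Q'(2) W(2) by blast
  then have M: "Q \<inter> A = conductor A B" and F: "field_mod A (Q \<inter> A)" using Q' by auto
  have A: "subring A R" and B: "subring B R" and sub: "A \<subseteq> B" "A \<noteq> B"
    and min: "\<And>C. subring C R \<Longrightarrow> A \<subseteq> C \<Longrightarrow> C \<subseteq> B \<Longrightarrow> C = A \<or> C = B"
    using AB unfolding minimal_extension_def by auto
  note A' = subringE[OF A] and B' = subringE[OF B]
  have BR: "b \<in> carrier R" if "b \<in> B" for b using that B'(1) by blast
  have AR: "b \<in> carrier R" if "b \<in> A" for b using that A'(1) by blast
  have VA: "V \<subseteq> A" using W(2) WA by blast
  have FW: "field_mod W (Q \<inter> W)" using field_mod_descend[OF W(1) intW A WA Q F] .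
  \<comment> \<open>The residue ring of \<open>W\<close> is a field, so the denominator
    \<open>u\<close> can be inverted and every residue is attained without denominators.\<close>
  have split: "\<exists>w\<in>W. s \<ominus> w \<in> Q" if s: "s \<in> carrier R" for s
  proof -
    obtain u w where uw: "u \<in> W" "u \<notin> Q" "w \<in> W" "u \<otimes> s \<ominus> w \<in> Q" using res[OF s] by blast
    then obtain c where c: "c \<in> W" "\<one> \<ominus> u \<otimes> c \<in> Q" using FW unfolding field_mod_def by blast
    have R: "u \<in> carrier R" "w \<in> carrier R" "c \<in> carrier R" using uw c WA AR by auto
    have "s \<ominus> c \<otimes> w = (\<one> \<ominus> u \<otimes> c) \<otimes> s \<oplus> c \<otimes> (u \<otimes> s \<ominus> w)"
      using R s by algebra
    also have "\<dots> \<in> Q" using QI(3)[OF QI(5)[OF s c(2)] QI(4)[OF R(3) uw(4)]] .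
    finally show ?thesis using subringE(6)[OF W(1) c(1) uw(3)] by blast
  qed
  let ?M = "Q \<inter> A"
  have MIA: "ideal ?M (R\<lparr>carrier := A\<rparr>)" and MIB: "ideal ?M (R\<lparr>carrier := B\<rparr>)"
    unfolding M using conductor_ideal[OF A B sub(1)] by auto
  note MA = ideal_of_subringE[OF A MIA] and MB = ideal_of_subringE[OF B MIB]
  \<comment> \<open>The preimage in \<open>A\<close> of the image of \<open>V\<close> modulo
    \<open>M\<close>. If it were all of \<open>A\<close>, the residue of \<open>s0\<close>, attained
    on \<open>W\<close>, would be attained on \<open>V\<close>.\<close>
  define T where "T = V <+>\<^bsub>R\<^esub> ?M"
  have T: "subring T R" "V \<subseteq> T" "?M \<subseteq> T"
  proof -
    have Z: "?M \<subseteq> carrier R" "\<zero> \<in> ?M" using AR MA(2) by auto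
    have sm: "a \<otimes> z \<in> ?M" if "a \<in> V" "z \<in> ?M" for a z using MA(4)[of a z] that VA by blast
    have mm: "y \<otimes> z \<in> V <+>\<^bsub>R\<^esub> ?M" if "y \<in> ?M" "z \<in> ?M" for y z
    proof -
      have yz: "y \<otimes> z \<in> ?M" using MA(4)[of y z] that by blast
      then have "y \<otimes> z = \<zero> \<oplus> y \<otimes> z" using AR by simp
      then show ?thesis unfolding mem_set_add using yz subringE(2)[OF V] by blast
    qed
    show "subring T R" "V \<subseteq> T" "?M \<subseteq> T"
      unfolding T_def by (rule subring_set_add[OF V Z]; (rule MA(3) | rule sm | rule mm); assumption)+
  qed
  have "T \<subseteq> A" unfolding T_def using subsetD[OF VA] A'(7) by (auto simp: mem_set_add)
  moreover have "T \<noteq> A"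
  proof
    assume eq: "T = A"
    obtain w where w: "w \<in> W" "s0 \<ominus> w \<in> Q" using split[OF s0] by blast
    then have "w \<in> T" using eq WA by blast
    then obtain v m where vm: "v \<in> V" "m \<in> ?M" "w = v \<oplus> m" unfolding T_def mem_set_add by blast
    have R: "v \<in> carrier R" "m \<in> carrier R" using vm VA AR by auto
    have "s0 \<ominus> v = (s0 \<ominus> w) \<oplus> m" unfolding vm(3) using R s0 by algebra
    also have "\<dots> \<in> Q" using QI(3) w(2) vm(2) by simp
    finally show False using contra vm(1) by blast
  qed
  ultimately have TA: "T \<subset> A" by blast
  obtain b where b: "b \<in> B" "b \<notin> A" using sub by blast
  obtain w where w: "w \<in> W" "b \<ominus> w \<in> Q" using split[OF BR[OF b(1)]] by blast
  \<comment> \<open>Subtracting the residue of \<open>b\<close>, taken from \<open>W\<close>, gives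
    a new element of \<open>B\<close> outside \<open>A\<close> that lies in
    \<open>Q\<close>.\<close>
  define x where "x = b \<ominus> w"
  have wA: "w \<in> A" using w WA by blast
  have xB: "x \<in> B" unfolding x_def using subring_minus_closed[OF B b(1)] wA sub(1) by blast
  have xA: "x \<notin> A"
  proof
    assume "x \<in> A"
    then have "x \<oplus> w \<in> A" using A'(7) wA by blast
    moreover have "x \<oplus> w = b" unfolding x_def using BR[OF b(1)] AR[OF wA] by algebra
    ultimately show False using b(2) by simp
  qed
  have xQ: "x \<in> Q" unfolding x_def using w(2) .
  have xR: "x \<in> carrier R" using BR[OF xB] .
  have Mx: "m \<otimes> x \<in> ?M" if "m \<in> ?M" for m using MB(5)[OF xB that] .
  \<comment> \<open>Injectivity on spectra passes from \<open>V\<close> to the larger ring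
    \<open>A\<close>, hence so does u-closedness.\<close>
  have uA: "u_closed A R"
  proof (rule inj_imp_u_closed[OF A])
    show "integral_over A R x" if "x \<in> carrier R" for x using integral_over_mono[OF int[OF that] VA] .
    show "inj_on (\<lambda>Q. Q \<inter> A) {Q. primeideal Q R}"
    proof (rule inj_onI)
      fix Q1 Q2 assume "Q1 \<in> {Q. primeideal Q R}" "Q2 \<in> {Q. primeideal Q R}" "Q1 \<inter> A = Q2 \<inter> A"
      moreover from this(3) have "Q1 \<inter> V = Q2 \<inter> V" using VA by blast
      ultimately show "Q1 = Q2" using inj_onD[OF inj] by simp
    qed
  qed
  have "x \<otimes> x \<in> A"
  proof (rule ccontr)
    assume xx: "x \<otimes> x \<notin> A"
    let ?Z = "{(x \<otimes> x) \<otimes> y | y. y \<in> B}"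
    have xxB: "x \<otimes> x \<in> B" "x \<otimes> x \<in> carrier R" using B'(6)[OF xB xB] xR by auto
    have Z: "?Z \<subseteq> carrier R" using xxB BR by auto
    have ZB: "?Z \<subseteq> B" using B'(6)[OF xxB(1)] by blast
    have "\<zero> = (x \<otimes> x) \<otimes> \<zero>" using xR by simp
    then have Z0: "\<zero> \<in> ?Z" using B'(2) by blast
    have Zadd: "y \<oplus> z \<in> ?Z" if yz: "y \<in> ?Z" "z \<in> ?Z" for y z
    proof -
      obtain u v where uv: "y = (x \<otimes> x) \<otimes> u" "z = (x \<otimes> x) \<otimes> v" "u \<in> B" "v \<in> B" using yz by blast
      then have "y \<oplus> z = (x \<otimes> x) \<otimes> (u \<oplus> v)" using BR xxB by (simp add: r_distr)
      then show ?thesis using B'(7)[OF uv(3,4)] by blast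
    qed
    have Zsm: "a \<otimes> z \<in> ?Z" if az: "a \<in> B" "z \<in> ?Z" for a z
    proof -
      obtain u where u: "z = (x \<otimes> x) \<otimes> u" "u \<in> B" using az by blast
      then have "a \<otimes> z = (x \<otimes> x) \<otimes> (a \<otimes> u)" using az(1) BR xxB by (simp add: m_lcomm)
      then show ?thesis using B'(6)[OF az(1) u(2)] by blast
    qed
    have ZsmA: "a \<otimes> z \<in> ?Z" if "a \<in> A" "z \<in> ?Z" for a z using Zsm[of a z] that sub(1) by blast
    have Zm: "y \<otimes> z \<in> A <+>\<^bsub>R\<^esub> ?Z" if yz: "y \<in> ?Z" "z \<in> ?Z" for y z
    proof -
      have "y \<otimes> z \<in> ?Z" using Zsm[OF subsetD[OF ZB yz(1)] yz(2)] .
      moreover have "y \<otimes> z = \<zero> \<oplus> y \<otimes> z" using subsetD[OF Z yz(1)] subsetD[OF Z yz(2)] by simp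
      ultimately show ?thesis unfolding mem_set_add using A'(2) by blast
    qed
    have S: "subring (A <+>\<^bsub>R\<^esub> ?Z) R" "A \<subseteq> A <+>\<^bsub>R\<^esub> ?Z" "?Z \<subseteq> A <+>\<^bsub>R\<^esub> ?Z"
      by (rule subring_set_add[OF A Z Z0]; (rule Zadd | rule ZsmA | rule Zm); assumption)+
    have "x \<otimes> x = (x \<otimes> x) \<otimes> \<one>" using xR by simp
    then have "x \<otimes> x \<in> A <+>\<^bsub>R\<^esub> ?Z" using S(3) B'(3) by blast
    moreover have "A <+>\<^bsub>R\<^esub> ?Z \<subseteq> B"
      using subsetD[OF sub(1)] B'(7) B'(6)[OF xxB(1)] by (auto simp: mem_set_add)
    ultimately have "A <+>\<^bsub>R\<^esub> ?Z = B" using min[OF S(1,2)] xx by blast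
    then have "x \<in> A <+>\<^bsub>R\<^esub> ?Z" using xB by simp
    then obtain a y where ay: "a \<in> A" "y \<in> B" "x = a \<oplus> (x \<otimes> x) \<otimes> y" unfolding mem_set_add by blast
    have R: "a \<in> carrier R" "y \<in> carrier R" using ay AR BR by auto
    \<comment> \<open>From \<open>x = a + x^2 y\<close> come \<open>x = a + x e\<close>, with
      \<open>a\<close> in \<open>M\<close>, and \<open>e^2 - e = -a y\<close>, again in
      \<open>M\<close>. By u-closedness \<open>e\<close> is in \<open>A\<close>, hence in
      \<open>M\<close>, and then so is \<open>x\<close>, against \<open>xA\<close>.\<close>
    define e where "e = x \<otimes> y"
    have eB: "e \<in> B" and eR: "e \<in> carrier R" and eQ: "e \<in> Q"
      unfolding e_def using B'(6)[OF xB ay(2)] xR R QI(5)[OF R(2) xQ] by auto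
    have xe: "x = a \<oplus> x \<otimes> e" unfolding e_def using ay(3) xR R by (simp add: m_assoc)
    have "a = (a \<oplus> x \<otimes> e) \<ominus> x \<otimes> e" using R eR xR by algebra
    also have "\<dots> = x \<ominus> x \<otimes> e" unfolding xe[symmetric] ..
    also have "\<dots> \<in> Q" using QI(7)[OF xQ QI(4)[OF xR eQ]] .
    finally have aM: "a \<in> ?M" using ay(1) by blast
    have "e [^] (2::nat) \<ominus> e = (x \<otimes> e) \<otimes> y \<ominus> x \<otimes> y"
      unfolding nat_pow_two[OF eR] unfolding e_def using xR R by algebra
    also have "\<dots> = (x \<otimes> e) \<otimes> y \<ominus> (a \<oplus> x \<otimes> e) \<otimes> y" unfolding xe[symmetric] ..
    also have "\<dots> = (\<ominus> a) \<otimes> y" using xR R eR by algebra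
    also have "\<dots> \<in> ?M" using MB(5)[OF ay(2) MB(6)[OF aM]] .
    finally have e2: "e [^] (2::nat) \<ominus> e \<in> ?M" .
    have "e [^] (3::nat) \<ominus> e [^] (2::nat) = e \<otimes> (e [^] (2::nat) \<ominus> e)"
      unfolding nat_pow_two[OF eR] nat_pow_three[OF eR] using eR by algebra
    also have "\<dots> \<in> ?M" using MB(4)[OF eB e2] .
    finally have "e \<in> A" using uA e2 eR unfolding u_closed_def by blast
    then have "e \<in> ?M" using eQ by blast
    then have "a \<oplus> x \<otimes> e \<in> ?M" using MB(3)[OF aM MB(4)[OF xB]] by blast
    then show False using xe xA by simp
  qed
  then have "x \<otimes> x \<in> ?M" using QI(4)[OF xR xQ] by blast
  then show False
    using not_catenarian_of_ramified_step[OF AB T(1,2) TA MIA T(3) F xB xA _ Mx] cat by blast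
qed

text \<open>Injectivity comes from u-closedness of the intersection; for the residue fields, primes
  are separated according to whether they contain its conductor.\<close>

theorem subintegral_Int:
  assumes V: "u_closed (W1 \<inter> W2) R" "integral_extension (W1 \<inter> W2) R" "catenarian (W1 \<inter> W2) R"
    and W: "subintegral W1 R" "subintegral W2 R"
  shows "subintegral (W1 \<inter> W2) R"
proof -
  let ?V = "W1 \<inter> W2"
  have subV: "subring ?V R" using V(1) unfolding u_closed_def ring_extension_def by blast
  have subW: "subring W1 R" "subring W2 R"
    using W unfolding subintegral_def integral_extension_def ring_extension_def by auto
  have FCP: "FCP ?V R" using V(3) unfolding catenarian_def by blast
  have int: "integral_over ?V R x" if "x \<in> carrier R" for x
    using V(2) that unfolding integral_extension_def by blast
  have inj: "inj_on (\<lambda>Q. Q \<inter> ?V) {Q. primeideal Q R}" using u_closed_imp_inj[OF V(1) int FCP] .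
  have res: "\<exists>u\<in>?V - Q. \<exists>w\<in>?V. u \<otimes> x \<ominus> w \<in> Q" if Q: "primeideal Q R" and x: "x \<in> carrier R" for Q x
  proof (cases "conductor ?V (carrier R) \<subseteq> Q")
    case False
    \<comment> \<open>A conductor element outside \<open>Q\<close> is a denominator for every
      \<open>x\<close> at once.\<close>
    then obtain c where c: "c \<in> conductor ?V (carrier R)" "c \<notin> Q" by blast
    then have cV: "c \<in> ?V" "c \<otimes> x \<in> ?V" using x unfolding conductor_def by auto
    have "c \<otimes> x \<in> carrier R" using cV subringE(1)[OF subV] by blast
    then have "c \<otimes> x \<ominus> c \<otimes> x \<in> Q" using idealE(2)[OF primeidealE(1)[OF Q]] by (simp add: minus_eq r_neg)
    then show ?thesis using cV c(2) by blast
  next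
    case True
    \<comment> \<open>Otherwise \<open>c\<close> and \<open>d\<close> outside \<open>Q\<close> exist
      in the two conductors; \<open>c \<otimes> d\<close> carries everything into both subrings and
      so lies in the conductor of the intersection, against primality of \<open>Q\<close>.\<close>
    have "conductor W1 (carrier R) \<inter> ?V \<subseteq> Q \<or> conductor W2 (carrier R) \<inter> ?V \<subseteq> Q"
    proof (rule ccontr)
      assume "\<not> ?thesis"
      then obtain c d where cd: "c \<in> conductor W1 (carrier R)" "c \<in> ?V" "c \<notin> Q"
        "d \<in> conductor W2 (carrier R)" "d \<in> ?V" "d \<notin> Q" by blast
      have cdR: "c \<in> carrier R" "d \<in> carrier R" using cd subringE(1)[OF subV] by auto
      have "c \<otimes> d \<otimes> s \<in> ?V" if s: "s \<in> carrier R" for s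
      proof
        have "c \<otimes> d \<otimes> s = d \<otimes> (c \<otimes> s)" "c \<otimes> d \<otimes> s = c \<otimes> (d \<otimes> s)"
          using cdR s by (simp_all add: m_ac)
        moreover have "c \<otimes> s \<in> W1" "d \<otimes> s \<in> W2" using cd s unfolding conductor_def by auto
        ultimately show "c \<otimes> d \<otimes> s \<in> W1" "c \<otimes> d \<otimes> s \<in> W2"
          using subringE(6)[OF subW(1), of d "c \<otimes> s"] subringE(6)[OF subW(2), of c "d \<otimes> s"] cd by auto
      qed
      then have "c \<otimes> d \<in> conductor ?V (carrier R)"
        using subringE(6)[OF subV cd(2,5)] unfolding conductor_def by blast
      then show False using True primeidealE(3)[OF Q cdR] cd(3,6) by blast
    qed
    moreover have "\<exists>v\<in>?V. x \<ominus> v \<in> Q"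
      if W': "subintegral W R" "?V \<subseteq> W" "conductor W (carrier R) \<inter> ?V \<subseteq> Q" for W
    proof -
      have sW: "subring W R" using W'(1) unfolding subintegral_def integral_extension_def ring_extension_def by blast
      then have "\<exists>u\<in>W - Q. \<exists>w\<in>W. u \<otimes> s \<ominus> w \<in> Q" if "s \<in> carrier R" for s
        using W'(1) Q that unfolding subintegral_iff[OF sW] by blast
      then show ?thesis
        using residue_surj_of_catenarian[OF subV int inj V(3) sW W'(2) Q _ W'(3) x] by blast
    qed
    ultimately obtain v where v: "v \<in> ?V" "x \<ominus> v \<in> Q" using W by blast
    show ?thesis
    proof (intro bexI)
      show "\<one> \<otimes> x \<ominus> v \<in> Q" using v(2) x by simp
    qed (use v(1) primeidealE(2)[OF Q] subringE(3)[OF subV] in auto)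
  qed
  show ?thesis unfolding subintegral_iff[OF subV] using V(2) inj res by blast
qed

text \<open>FCP gives a minimal subintegral subextension, and stability under binary intersections
  makes it the least. Each such intersection is u-closed and contains the u-closure, so it inherits
  catenarity.\<close>

theorem exists_co_subintegral_closure:
  assumes int: "integral_extension T R" and cat: "catenarian (u_closure T R) R" and FCP: "FCP T R"
  shows "\<exists>V. is_co_subintegral_closure T R V"
proof -
  let ?U = "u_closure T R"
  have ext: "ring_extension T R" using int unfolding integral_extension_def by blast
  then have T: "subring T R" unfolding ring_extension_def by blast
  let ?F = "{W \<in> intermediate_rings T R. subintegral W R}"
  have "carrier R \<in> ?F"
    using subintegral_carrier carrier_is_subring subringE(1)[OF T] unfolding intermediate_rings_def by blast
  then have "\<exists>V\<in>?F. \<forall>W\<in>?F. W \<subseteq> V \<longrightarrow> W = V" by (intro FCP_minimal[OF FCP]) auto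
  then obtain V where V: "V \<in> ?F" and Vmin: "\<forall>W\<in>?F. W \<subseteq> V \<longrightarrow> W = V" by (rule bexE)
  have uF: "u_closed W R" if "W \<in> ?F" for W
    using that inj_imp_u_closed[of W]
    unfolding subintegral_def integral_extension_def ring_extension_def by blast
  have "V \<subseteq> W" if W: "W \<in> ?F" for W
  proof -
    have TVW: "T \<subseteq> V \<inter> W" "subring (V \<inter> W) R"
      using V W subring_inter unfolding intermediate_rings_def by auto
    have "u_closed (V \<inter> W) R"
      using uF[OF V] uF[OF W] TVW(2) is_cring unfolding u_closed_def ring_extension_def by blast
    moreover from this have "?U \<subseteq> V \<inter> W"
      using u_closure_eq_Inter(1)[OF ext] TVW unfolding intermediate_rings_def by auto
    moreover have "integral_extension (V \<inter> W) R"
      using int integral_over_mono[OF _ TVW(1)] TVW(2) is_cring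
      unfolding integral_extension_def ring_extension_def by blast
    ultimately have "subintegral (V \<inter> W) R"
      using catenarian_mono[OF cat TVW(2)] V W by (intro subintegral_Int) auto
    then have "V \<inter> W \<in> ?F" using TVW unfolding intermediate_rings_def by blast
    then show ?thesis using Vmin by blast
  qed
  then show ?thesis using V unfolding is_co_subintegral_closure_def by blast
qed

end

theorem corollary6p16:
  fixes S :: "('a, 'b) ring_scheme" and R :: "'a set"
  assumes "cring S" and "subring R S" and "R \<subset> carrier S"
    and "integral_extension R S" and "FCP R S"
  shows "(catenarian (u_closure R S) S \<longrightarrow> (\<exists>V. is_co_subintegral_closure R S V)) \<and>
         (catenarian R S \<longrightarrow>
            catenarian (u_closure R S) S \<and> (\<exists>V. is_co_subintegral_closure R S V))"
proof -
  interpret cring S by fact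
  have "ring_extension R S" using assms(1,2) unfolding ring_extension_def by simp
  then have "u_closure R S \<in> intermediate_rings R S" by (rule u_closure_eq_Inter(2))
  then have "catenarian (u_closure R S) S" if "catenarian R S"
    using catenarian_mono[OF that] unfolding intermediate_rings_def by simp
  then show ?thesis using exists_co_subintegral_closure[OF assms(4) _ assms(5)] by blast
qed

end
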